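(* Let $f:(\mathbb{C}^n,0)\to(\mathbb{C}^n,0)$ be a germ of biholomorphism whose components have the form $$f_i(x_1,\dots,x_n)=x_i\Big(1+\mathbf{x}^M\big(a_i+A_i(x_1,\dots,x_n)\big)\Big),\qquad i=1,\dots,n,$$ where $M=(M_1,\dots,M_n)\in\mathbb{N}^n$, $\mathbf{x}^M=x_1^{M_1}\cdots x_n^{M_n}$, $a_i\in\mathbb{C}^*$, and $A_i:(\mathbb{C}^n,0)\to(\mathbb{C},0)$ is a holomorphic germ for every $i$. Let $\langle a,M\rangle=\sum_{i=1}^n a_iM_i$ and suppose that $\operatorname{Re}\left(\frac{a_i}{\langle a,M\rangle}\right)>0$ for all $i\in\{1,\dots,n\}$. Let $d=\gcd(M_1,\dots,M_n)$, $m_i=M_i/d$ and $\bar m=\#\{i: m_i=0\}$. Then in any neighbourhood of the origin there exist $d$ pairwise disjoint connected open sets $\Omega^+_0,\dots,\Omega^+_{d-1}$ with $0\in\partial\Omega^+_k$ for all $k$, and $d$ pairwise disjoint connected open sets $\Omega^-_0,\dots,\Omega^-_{d-1}$ with $0\in\partial\Omega^-_k$ for all $k$, such that: 1. The sets $\Omega^+_k$ are invariant by $f$, and $f^{\circ j}\to 0$ as $j\to+\infty$ uniformly on compact subsets of $\Omega^+_k$ for all $k$; the sets $\Omega^-_k$ are invariant by $f^{-1}$, and $f^{\circ -j}\to0$ as $j\to+\infty$ uniformly on compact subsets of $\Omega^-_k$ for all $k$. 2. The union of the sets $\Omega^+_0,\dots,\Omega^+_{d-1},\Omega^-_0,\dots,\Omega^-_{d-1}$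 together with the fixed set $\{\mathbf{x}^M=0\}$ forms a neighbourhood of the origin. 3. For each $k$ there exist biholomorphisms $\phi^+_k:\Omega^+_k\to W^+_k\subset\mathbb{C}^n$ and $\phi^-_k:\Omega^-_k\to W^-_k\subset\mathbb{C}^n$ such that - $\phi^+_k$ and $\phi^-_k$ conjugate $f$ to $(z,w_1,\dots,w_{n-1})\mapsto(z+1,w_1,\dots,w_{n-1})$; - $\displaystyle\bigcup_{j\in\mathbb{N}}T_j(W^+_k)=\mathbb{C}\times(\mathbb{C}^* )^{n-\bar m-1}\times\mathbb{C}^{\bar m}$ and $\displaystyle\bigcup_{-j\in\mathbb{N}}T_j(W^-_k)=\mathbb{C}\times(\mathbb{C}^* )^{n-\bar m-1}\times\mathbb{C}^{\bar m}$, where $T_j(z_1,\dots,z_n)=(z_1-j,z_2,\dots,z_n)$.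
   Context: $\mathbb{N}=\{0,1,2,\dots\}$. $f^{\circ j}$ is the $j$-th iterate of $f$ and $f^{\circ -j}$ the $j$-th iterate of $f^{-1}$. A set $\Omega$ is invariant by $g$ if $g(\Omega)\subset\Omega$. Since $\Omega_k^-$ is only assumed invariant by $f^{-1}$, the statement that $\phi^-_k$ conjugates $f$ to the translation means $\phi^-_k(f(\mathbf{x}))=\phi^-_k(\mathbf{x})+(1,0,\dots,0)$ whenever $\mathbf{x},f(\mathbf{x})\in\Omega^-_k$, i.e. $\phi^-_k\circ f^{-1}=\phi^-_k-(1,0,\dots,0)$ on $\Omega_k^-$. The hypothesis includes that $\langle a,M\rangle\neq0$ (so the quotients make sense). *)

theory Defs
  imports "HOL-Analysis.Analysis"
begin

text \<open>Holomorphic functions and maps of several complex variables, in the sense of complex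
  (Frechet) differentiability; meant for open sets \<open>S\<close>.\<close>

definition holomorphic_fun_on :: "(complex ^ 'n \<Rightarrow> complex) \<Rightarrow> (complex ^ 'n) set \<Rightarrow> bool" where
  "holomorphic_fun_on g S \<longleftrightarrow>
     (\<forall>x\<in>S. \<exists>g'. (g has_derivative g') (at x) \<and> (\<forall>c v. g' (c *s v) = c * g' v))"

definition holomorphic_map_on ::
    "(complex ^ 'n \<Rightarrow> complex ^ 'm) \<Rightarrow> (complex ^ 'n) set \<Rightarrow> bool" where
  "holomorphic_map_on F S \<longleftrightarrow> (\<forall>i. holomorphic_fun_on (\<lambda>x. F x $ i) S)"

definition biholomorphism ::
    "(complex ^ 'n \<Rightarrow> complex ^ 'm) \<Rightarrow> (complex ^ 'n) set \<Rightarrow> (complex ^ 'm) set \<Rightarrow> bool" where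
  "biholomorphism F U V \<longleftrightarrow> open U \<and> open V \<and> bij_betw F U V \<and>
     holomorphic_map_on F U \<and> holomorphic_map_on (inv_into U F) V"

text \<open>A germ at the origin is given by a function, of which only the values near the origin
  matter.\<close>

definition holomorphic_germ0 :: "(complex ^ 'n \<Rightarrow> complex) \<Rightarrow> bool" where
  "holomorphic_germ0 g \<longleftrightarrow> (\<exists>S. open S \<and> 0 \<in> S \<and> holomorphic_fun_on g S) \<and> g 0 = 0"

definition monom_power :: "complex ^ 'n \<Rightarrow> nat ^ 'n \<Rightarrow> complex" where
  "monom_power x M = (\<Prod>i\<in>UNIV. x $ i ^ M $ i)"

definition pairing :: "complex ^ 'n \<Rightarrow> nat ^ 'n \<Rightarrow> complex" where
  "pairing a M = (\<Sum>i\<in>UNIV. a $ i * of_nat (M $ i))"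

text \<open>The first coordinate is the one with index \<open>p\<close>.\<close>

definition transl :: "'n \<Rightarrow> int \<Rightarrow> complex ^ 'n \<Rightarrow> complex ^ 'n" where
  "transl p j z = z - axis p (of_int j)"

text \<open>Here \<open>e\<close> enumerates the coordinates as \<open>e 1, \<dots>, e n\<close>. The set is
  \<open>\<complex> \<times> (\<complex> - {0}) ^ (n - r - 1) \<times> \<complex> ^ r\<close>.\<close>

definition model_space :: "(nat \<Rightarrow> 'n) \<Rightarrow> nat \<Rightarrow> (complex ^ 'n) set" where
  "model_space e r = {z. \<forall>j\<in>{2..CARD('n) - r}. z $ e j \<noteq> 0}"

end

theory Submission
  imports Defs "HOL-Complex_Analysis.Complex_Analysis"
begin

text \<open>
  Put \<open>u = \<bold>x\<^sup>M\<close>, \<open>b = \<langle>a, M\<rangle>\<close> and \<open>z = - 1 / (b u)\<close>; then \<open>z \<circ> f = z + 1 + O(\<bold>x)\<close>, and with \<open>\<alpha>\<^sub>i = a\<^sub>i / b\<close> the functions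
  \<open>E\<^sub>i = x\<^sub>i z\<^bsup>\<alpha>\<^sub>i\<^esup>\<close> are almost invariant on the sector \<open>Re z + |Im z| > 0\<close>. There the inequalities
  \<open>|E\<^sub>i| < \<epsilon> (Re z + 2 |Im z|)\<^bsup>Re \<alpha>\<^sub>i\<^esup>\<close> define an invariant domain, on which the \<open>d\<close>-th power of \<open>\<bold>x\<^sup>m z\<^bsup>1/d\<^esup>\<close> is the
  constant \<open>- 1 / b\<close>; the \<open>d\<close> possible values of that function cut out the petals \<open>\<Omega>\<^sup>+\<^sub>k\<close>.
  A unimodular integer matrix with first row \<open>m\<close> turns the \<open>E\<^sub>i\<close> into coordinates \<open>Y\<^sub>l\<close> on the model space,
  and \<open>lim Y\<^sub>l \<circ> f\<^bsup>\<circ>j\<^esup>\<close> are the invariant components of \<open>\<phi>\<close>. For the first component, \<open>z\<close> is corrected by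
  finitely many terms \<open>\<bold>x\<^sup>k / u\<close>, and \<open>\<bold>x\<^sup>k log z / u\<close> for the resonances \<open>\<langle>a, k\<rangle> = b\<close>, until the deviation from the
  translation is summable along orbits. Seen from \<open>f\<^bsup>\<circ>j\<^esup>\<close> and with \<open>z\<close> divided by \<open>j\<close>, \<open>\<phi>\<close> converges to the
  identity, which gives injectivity, nonvanishing Jacobian and the exhaustion of the model space at once.
  The sets \<open>\<Omega>\<^sup>-\<^sub>k\<close> are the petals of \<open>f\<^sup>-\<^sup>1\<close>, a germ of the same form with \<open>- a\<close> in place of \<open>a\<close>.
\<close>

section \<open>Holomorphic functions of several variables\<close>

text \<open>On the invariant domain each x_i is merely bounded; decay like |z|^(- Re \<alpha>_i)
  only sets in along orbits, with a constant depending on the starting point. Estimates therefore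
  separate a power of the size G of z, which grows linearly with the number of steps, from a weight
  h fixed at the starting point, in which polynomial growth is harmless. Before the E_i are known to
  converge they might still grow like a small power of G, so a fraction \<kappa> of each decay
  exponent is given up in advance. The rest must suffice at the worst place: a resonant monomial has
  order slightly above -1, and only a further factor vanishing at 0 brings the errors below -1, with
  room for a logarithm. The sector has opening 3\<pi>/2 so that it and its opposite, which belongs
  to the inverse germ, cover the punctured plane; this gives the neighbourhood of the origin. On so
  wide a sector Re z may be negative and |z| may decrease in a step, hence a gauge that weighs |Im
  z| twice. Connectedness and surjectivity become visible only after multiplying z by a large
  factor; the E_i do not change under this scaling, so the weight stays bounded.\<close>

definition holo_at :: "(complex ^ 'n \<Rightarrow> complex) \<Rightarrow> complex ^ 'n \<Rightarrow> bool" where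
  "holo_at g x \<longleftrightarrow> (\<exists>g'. (g has_derivative g') (at x) \<and> (\<forall>c v. g' (c *s v) = c * g' v))"

lemma holomorphic_fun_on_iff: "holomorphic_fun_on g S \<longleftrightarrow> (\<forall>x\<in>S. holo_at g x)"
  by (simp add: holomorphic_fun_on_def holo_at_def)

lemma norm_smult [simp]: "norm (c *s (v :: complex ^ 'n)) = cmod c * norm v"
  by (simp add: norm_vec_def norm_mult L2_set_right_distrib)

lemma bounded_linear_smult_left: "bounded_linear (\<lambda>c. c *s (v :: complex ^ 'n))"
  by (rule bounded_linear_intro[of _ "norm v"])
    (auto simp: vec_eq_iff algebra_simps scaleR_conv_of_real[where 'a=complex])

lemma bounded_linear_nth: "bounded_linear (\<lambda>x. (x :: complex ^ 'n) $ i)"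
  by (rule bounded_linear_vec_nth)

lemma holo_at_const [simp]: "holo_at (\<lambda>_. c) x"
  unfolding holo_at_def by (rule exI[of _ "\<lambda>_. 0"]) auto

lemma holo_at_nth [simp]: "holo_at (\<lambda>x. x $ i) x"
  unfolding holo_at_def
  by (rule exI[of _ "\<lambda>v. v $ i"]) (auto intro: bounded_linear.has_derivative[OF bounded_linear_nth])

lemma holo_at_add: "holo_at f x \<Longrightarrow> holo_at g x \<Longrightarrow> holo_at (\<lambda>x. f x + g x) x"
  unfolding holo_at_def
proof clarify
  fix f' g' assume f: "(f has_derivative f') (at x)" "\<forall>c v. f' (c *s v) = c * f' v"
    "(g has_derivative g') (at x)" "\<forall>c v. g' (c *s v) = c * g' v"
  show "\<exists>g'. ((\<lambda>x. f x + g x) has_derivative g') (at x) \<and> (\<forall>c v. g' (c *s v) = c * g' v)"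
    by (rule exI[of _ "\<lambda>v. f' v + g' v"]) (use f in \<open>auto intro: has_derivative_add simp: algebra_simps\<close>)
qed

lemma holo_at_mult: "holo_at f x \<Longrightarrow> holo_at g x \<Longrightarrow> holo_at (\<lambda>x. f x * g x) x"
  unfolding holo_at_def
proof clarify
  fix f' g' assume f: "(f has_derivative f') (at x)" "\<forall>c v. f' (c *s v) = c * f' v"
    "(g has_derivative g') (at x)" "\<forall>c v. g' (c *s v) = c * g' v"
  show "\<exists>g'. ((\<lambda>x. f x * g x) has_derivative g') (at x) \<and> (\<forall>c v. g' (c *s v) = c * g' v)"
    by (rule exI[of _ "\<lambda>v. f x * g' v + f' v * g x"])
       (use f in \<open>auto intro: has_derivative_mult simp: algebra_simps\<close>)
qed

lemma holo_at_comp1: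
  assumes "f field_differentiable (at (g x))" "holo_at g x"
  shows "holo_at (\<lambda>x. f (g x)) x"
proof -
  obtain D where D: "(f has_field_derivative D) (at (g x))"
    using assms(1) by (auto simp: field_differentiable_def)
  obtain g' where g': "(g has_derivative g') (at x)" "\<forall>c v. g' (c *s v) = c * g' v"
    using assms(2) by (auto simp: holo_at_def)
  show ?thesis unfolding holo_at_def
    by (rule exI[of _ "\<lambda>v. D * g' v"])
      (use has_derivative_compose[OF g'(1) D[unfolded has_field_derivative_def]] g'(2) in \<open>auto simp: algebra_simps\<close>)
qed

lemma holo_at_uminus: "holo_at f x \<Longrightarrow> holo_at (\<lambda>x. - f x) x"
  using holo_at_mult[of "\<lambda>_. -1" x f] by simp

lemma holo_at_diff: "holo_at f x \<Longrightarrow> holo_at g x \<Longrightarrow> holo_at (\<lambda>x. f x - g x) x"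
  using holo_at_add[of f x "\<lambda>x. - g x"] holo_at_uminus[of g x] by simp

lemma holo_at_inverse: "holo_at f x \<Longrightarrow> f x \<noteq> 0 \<Longrightarrow> holo_at (\<lambda>x. inverse (f x)) x"
  by (rule holo_at_comp1[of inverse f]) (auto intro!: derivative_intros field_differentiable_inverse)

lemma holo_at_divide: "holo_at f x \<Longrightarrow> holo_at g x \<Longrightarrow> g x \<noteq> 0 \<Longrightarrow> holo_at (\<lambda>x. f x / g x) x"
  by (simp add: divide_inverse holo_at_mult holo_at_inverse)

lemma holo_at_sum: "(\<And>i. i \<in> I \<Longrightarrow> holo_at (f i) x) \<Longrightarrow> holo_at (\<lambda>x. \<Sum>i\<in>I. f i x) x"
  by (induction I rule: infinite_finite_induct) (auto intro: holo_at_add)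

lemma holo_at_prod: "(\<And>i. i \<in> I \<Longrightarrow> holo_at (f i) x) \<Longrightarrow> holo_at (\<lambda>x. \<Prod>i\<in>I. f i x) x"
  by (induction I rule: infinite_finite_induct) (auto intro: holo_at_mult)

lemma holo_at_power: "holo_at f x \<Longrightarrow> holo_at (\<lambda>x. f x ^ k) x"
  by (induction k) (auto intro: holo_at_mult)

lemma holo_at_powi: "holo_at f x \<Longrightarrow> f x \<noteq> 0 \<or> k \<ge> 0 \<Longrightarrow> holo_at (\<lambda>x. f x powi k) x"
  unfolding power_int_def by (cases "k \<ge> 0") (auto intro: holo_at_power holo_at_inverse)

lemma holo_at_exp: "holo_at f x \<Longrightarrow> holo_at (\<lambda>x. exp (f x)) x"
  by (rule holo_at_comp1[of exp]) (auto intro: field_differentiable_within_exp)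

lemma holo_at_Ln: "holo_at f x \<Longrightarrow> f x \<notin> \<real>\<^sub>\<le>\<^sub>0 \<Longrightarrow> holo_at (\<lambda>x. Ln (f x)) x"
  by (rule holo_at_comp1[of Ln]) (auto intro: field_differentiable_at_Ln)

lemmas holo_at_intros = holo_at_const holo_at_nth holo_at_add holo_at_mult holo_at_uminus holo_at_diff
  holo_at_divide holo_at_sum holo_at_prod holo_at_power holo_at_powi holo_at_exp holo_at_Ln

lemma holo_at_cong:
  assumes "\<forall>\<^sub>F y in nhds x. f y = g y" "holo_at f x"
  shows "holo_at g x"
proof -
  have "\<forall>\<^sub>F y in at x. f y = g y" "f x = g x"
    using assms(1) by (auto simp: eventually_nhds_conv_at)
  then have "(f has_derivative g') (at x) \<Longrightarrow> (g has_derivative g') (at x)" for g'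
    by (auto intro: has_derivative_transform_eventually)
  then show ?thesis using assms(2) unfolding holo_at_def by blast
qed

lemma holo_at_imp_isCont: "holo_at f x \<Longrightarrow> isCont f x"
  by (auto simp: holo_at_def intro: has_derivative_continuous)

lemma has_derivative_vec_nth_iff:
  fixes F :: "'a::real_normed_vector \<Rightarrow> complex ^ 'm"
  shows "(F has_derivative F') (at x within S) \<longleftrightarrow> (\<forall>i. ((\<lambda>x. F x $ i) has_derivative (\<lambda>v. F' v $ i)) (at x within S))"
proof
  assume "(F has_derivative F') (at x within S)"
  then show "\<forall>i. ((\<lambda>x. F x $ i) has_derivative (\<lambda>v. F' v $ i)) (at x within S)"
    using bounded_linear.has_derivative[OF bounded_linear_nth] by blast
next
  assume L: "\<forall>i. ((\<lambda>x. F x $ i) has_derivative (\<lambda>v. F' v $ i)) (at x within S)"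
  \<comment> \<open>The real basis of \<open>complex ^ 'm\<close> consists of the vectors
    \<open>axis i b\<close> with \<open>b\<close> in the basis of \<open>complex\<close>, so every
    coordinate splits into real and imaginary part.\<close>
  have "((\<lambda>x. F x \<bullet> axis i b) has_derivative (\<lambda>v. F' v \<bullet> axis i b)) (at x within S)" for i b
    using bounded_linear.has_derivative[OF bounded_linear_inner_left[of b] spec[OF L, of i]]
    by (simp add: inner_axis)
  then show "(F has_derivative F') (at x within S)"
    by (subst has_derivative_componentwise_within) (auto simp: Basis_vec_def)
qed

definition holo_map_at :: "(complex ^ 'n \<Rightarrow> complex ^ 'm) \<Rightarrow> complex ^ 'n \<Rightarrow> bool" where
  "holo_map_at F x \<longleftrightarrow> (\<forall>i. holo_at (\<lambda>x. F x $ i) x)"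

lemma holo_map_at_iff:
  "holo_map_at F x \<longleftrightarrow> (\<exists>F'. (F has_derivative F') (at x) \<and> (\<forall>c v. F' (c *s v) = c *s F' v))"
proof
  assume "holo_map_at F x"
  then obtain F' where "\<And>i. ((\<lambda>x. F x $ i) has_derivative F' i) (at x)" "\<And>i c v. F' i (c *s v) = c * F' i v"
    unfolding holo_map_at_def holo_at_def by metis
  then show "\<exists>F'. (F has_derivative F') (at x) \<and> (\<forall>c v. F' (c *s v) = c *s F' v)"
    by (intro exI[of _ "\<lambda>v. \<chi> i. F' i v"]) (auto simp: has_derivative_vec_nth_iff vec_eq_iff)
next
  assume "\<exists>F'. (F has_derivative F') (at x) \<and> (\<forall>c v. F' (c *s v) = c *s F' v)"
  then obtain F' where F': "(F has_derivative F') (at x)" "\<forall>c v. F' (c *s v) = c *s F' v" by blast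
  then show "holo_map_at F x" unfolding holo_map_at_def holo_at_def
    by (intro allI, rule_tac x="\<lambda>v. F' v $ i" in exI) (auto simp: has_derivative_vec_nth_iff)
qed

lemma holomorphic_map_on_iff: "holomorphic_map_on F S \<longleftrightarrow> (\<forall>x\<in>S. holo_map_at F x)"
  by (auto simp: holomorphic_map_on_def holo_map_at_def holomorphic_fun_on_iff)

lemma holo_map_at_imp_isCont: "holo_map_at F x \<Longrightarrow> isCont F x"
  by (auto simp: holo_map_at_iff intro: has_derivative_continuous)

lemma holo_at_compose:
  assumes "holo_map_at F x" "holo_at g (F x)"
  shows "holo_at (\<lambda>x. g (F x)) x"
proof -
  obtain F' where F': "(F has_derivative F') (at x)" "\<forall>c v. F' (c *s v) = c *s F' v"
    using assms(1) by (auto simp: holo_map_at_iff)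
  obtain g' where g': "(g has_derivative g') (at (F x))" "\<forall>c v. g' (c *s v) = c * g' v"
    using assms(2) by (auto simp: holo_at_def)
  show ?thesis unfolding holo_at_def
    by (rule exI[of _ "\<lambda>v. g' (F' v)"])
      (use has_derivative_compose[OF F'(1) g'(1)] F'(2) g'(2) in auto)
qed

lemma holo_map_at_compose: "holo_map_at F x \<Longrightarrow> holo_map_at G (F x) \<Longrightarrow> holo_map_at (\<lambda>x. G (F x)) x"
  using holo_at_compose unfolding holo_map_at_def by blast

lemma holo_map_at_cong:
  assumes "\<forall>\<^sub>F y in nhds x. f y = g y" "holo_map_at f x"
  shows "holo_map_at g x"
proof -
  have "\<forall>\<^sub>F y in nhds x. f y $ i = g y $ i" for i
    using assms(1) by eventually_elim simp
  then show ?thesis using assms(2) holo_at_cong[of "\<lambda>y. f y $ _" "\<lambda>y. g y $ _"] unfolding holo_map_at_def by blast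
qed

text \<open>Restriction to a complex line is the bridge to one-variable theory; complex homogeneity
  of \<open>g'\<close> turns the real derivative along the line into multiplication by
  \<open>g' v\<close>.\<close>

lemma holo_at_line:
  fixes x v :: "complex ^ 'n"
  assumes "(g has_derivative g') (at (x + t *s v))" "\<forall>c v. g' (c *s v) = c * g' v"
  shows "((\<lambda>t. g (x + t *s v)) has_field_derivative g' v) (at t)"
proof -
  have "((\<lambda>t. x + t *s v) has_derivative (\<lambda>h. h *s v)) (at t)"
    using bounded_linear_imp_has_derivative[OF bounded_linear_smult_left]
    by (auto intro!: derivative_eq_intros)
  moreover have eq: "(\<lambda>h. g' (h *s v)) = (*) (g' v)"
    using assms(2) by (simp add: fun_eq_iff mult.commute)
  ultimately have "((\<lambda>t. g (x + t *s v)) has_derivative (\<lambda>h. g' (h *s v))) (at t)"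
    using has_derivative_compose assms(1) by blast
  then show ?thesis
    using eq by (simp add: has_field_derivative_def o_def)
qed

text \<open>Cauchy's estimate, applied on complex lines through the centre.\<close>

lemma holo_derivative_bound:
  assumes hol: "\<And>y. y \<in> cball x r \<Longrightarrow> holo_at g y" and r: "r > 0"
    and B: "\<And>y. y \<in> cball x r \<Longrightarrow> cmod (g y) \<le> B"
    and g': "(g has_derivative g') (at x)" "\<forall>c v. g' (c *s v) = c * g' v"
  shows "cmod (g' v) \<le> B / r * norm v"
proof (cases "v = 0")
  case True
  have "g' 0 = 0" using g'(1) by (simp add: has_derivative_bounded_linear linear_simps(3))
  then show ?thesis using True by simp
next
  case False
  define w where "w = of_real (r / norm v) *s v"
  have nw: "norm w = r" using False r by (simp add: w_def norm_divide)
  define f where "f = (\<lambda>t. g (x + t *s w))"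
  have in_ball: "x + t *s w \<in> cball x r" if "norm t \<le> 1" for t
    using that nw r by (auto simp: dist_norm mult_left_le_one_le)
  have dif: "f field_differentiable (at t)" if "norm t \<le> 1" for t
    using hol[OF in_ball[OF that]] holo_at_line unfolding holo_at_def f_def field_differentiable_def by blast
  have "f holomorphic_on cball 0 1"
    by (auto simp: holomorphic_on_def intro!: field_differentiable_at_within dif)
  then have hol1: "f holomorphic_on ball 0 1" "continuous_on (cball 0 1) f"
    using holomorphic_on_subset[of f "cball 0 1" "ball 0 1"] holomorphic_on_imp_continuous_on by auto
  have "norm ((deriv ^^ 1) f 0) \<le> fact 1 * B / 1 ^ 1"
    by (rule Cauchy_inequality[OF hol1]) (auto simp: f_def intro!: B in_ball)
  moreover have "deriv f 0 = g' w"
    unfolding f_def using holo_at_line[of g g' x 0 w] g' by (simp add: DERIV_imp_deriv)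
  ultimately have "cmod (g' w) \<le> B" by simp
  moreover have "cmod (g' w) = r / norm v * cmod (g' v)"
    using spec[OF spec[OF g'(2)], of "of_real (r / norm v)" v] r by (simp add: w_def norm_mult norm_divide)
  ultimately show ?thesis using False r by (simp add: field_simps)
qed

text \<open>Cauchy's estimate for the differences \<open>f m - f n\<close> turns uniform convergence
  of the functions into uniform convergence of the derivatives on a smaller ball, so the limit may
  be differentiated; complex homogeneity passes to the limit.\<close>

theorem holo_at_uniform_limit:
  assumes hol: "\<And>n y. y \<in> ball x r \<Longrightarrow> holo_at (f n) y" and r: "r > 0"
    and ul: "uniform_limit (ball x r) f g sequentially"
  shows "holo_at g x"
proof -
  obtain f' where f': "\<And>n y. y \<in> ball x r \<Longrightarrow> (f n has_derivative f' n y) (at y)"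
      "\<And>n y c v. y \<in> ball x r \<Longrightarrow> f' n y (c *s v) = c * f' n y v"
  proof -
    define F where "F n y = (SOME F. (f n has_derivative F) (at y) \<and> (\<forall>c v. F (c *s v) = c * F v))" for n y
    have "(f n has_derivative F n y) (at y) \<and> (\<forall>c v. F n y (c *s v) = c * F n y v)" if "y \<in> ball x r" for n y
      unfolding F_def using hol[OF that, of n, unfolded holo_at_def] by (rule someI_ex)
    then show ?thesis using that by blast
  qed
  \<comment> \<open>A third of the radius: a ball of radius \<open>s\<close> about a point of the
    \<open>s\<close>-ball stays inside the \<open>r\<close>-ball.\<close>
  define s where "s = r / 3"
  have s: "s > 0" "s < r" using r by (auto simp: s_def)
  have sub: "cball y s \<subseteq> ball x r" if "y \<in> ball x s" for y
  proof
    fix w assume "w \<in> cball y s"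
    then show "w \<in> ball x r"
      using that r dist_triangle[of x w y] by (auto simp: s_def)
  qed
  have cau: "\<exists>N. \<forall>m\<ge>N. \<forall>n\<ge>N. \<forall>y\<in>ball x s. \<forall>v. cmod (f' m y v - f' n y v) \<le> e * norm v" if e: "e > 0" for e
  proof -
    have "\<forall>\<^sub>F n in sequentially. \<forall>y\<in>ball x r. dist (f n y) (g y) < e * s / 2"
      using uniform_limitD[OF ul, of "e * s / 2"] e s by simp
    then obtain N where N: "\<And>n y. n \<ge> N \<Longrightarrow> y \<in> ball x r \<Longrightarrow> dist (f n y) (g y) < e * s / 2"
      unfolding eventually_sequentially by blast
    have "cmod (f' m y v - f' n y v) \<le> e * norm v" if "m \<ge> N" "n \<ge> N" "y \<in> ball x s" for m n y v
    proof -
      have "y \<in> ball x r" using that s by auto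
      have "cmod (f' m y v - f' n y v) \<le> (e * s) / s * norm v"
      proof (rule holo_derivative_bound[of y s "\<lambda>y. f m y - f n y" "e * s" "\<lambda>v. f' m y v - f' n y v"])
        fix w assume "w \<in> cball y s"
        then have w: "w \<in> ball x r" using sub that by blast
        show "holo_at (\<lambda>y. f m y - f n y) w" using w hol by (intro holo_at_diff) auto
        have "cmod (f m w - f n w) \<le> dist (f m w) (g w) + dist (f n w) (g w)"
          by (metis dist_norm dist_triangle2)
        also have "\<dots> \<le> e * s" using N[OF that(1) w] N[OF that(2) w] by simp
        finally show "cmod (f m w - f n w) \<le> e * s" .
      qed (use f' \<open>y \<in> ball x r\<close> s in \<open>auto intro: has_derivative_diff simp: algebra_simps\<close>)
      then show ?thesis using s by simp
    qed
    then show ?thesis by blast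
  qed
  have "\<exists>l. (\<lambda>n. f' n y v) \<longlonglongrightarrow> l" if "y \<in> ball x s" for y v
  proof -
    have "Cauchy (\<lambda>n. f' n y v)"
    proof (rule CauchyI)
      fix e :: real assume e: "e > 0"
      obtain N where N: "\<And>m n. m \<ge> N \<Longrightarrow> n \<ge> N \<Longrightarrow> cmod (f' m y v - f' n y v) \<le> e / (norm v + 1) * norm v"
      proof -
        have "e / (norm v + 1) > 0" using e by (simp add: add_nonneg_pos)
        from cau[OF this] that show ?thesis using \<open>y \<in> ball x s\<close> by blast
      qed
      have "e / (norm v + 1) * norm v < e"
      proof -
        have "norm v + 1 > 0" by (simp add: add_nonneg_pos)
        then show ?thesis using e by (simp add: pos_divide_less_eq algebra_simps)
      qed
      then show "\<exists>M. \<forall>m\<ge>M. \<forall>n\<ge>M. cmod (f' m y v - f' n y v) < e" using N by force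
    qed
    then show ?thesis by (simp add: Cauchy_convergent_iff convergent_def)
  qed
  then obtain G where G: "\<And>y v. y \<in> ball x s \<Longrightarrow> (\<lambda>n. f' n y v) \<longlonglongrightarrow> G y v" by metis
  have x: "x \<in> ball x s" using s by simp
  have "\<exists>h. \<forall>y\<in>ball x s. (\<lambda>n. f n y) \<longlonglongrightarrow> h y \<and> (h has_derivative G y) (at y within ball x s)"
  proof (rule has_derivative_sequence[of _ f f'])
    show "(f n has_derivative f' n y) (at y within ball x s)" if "y \<in> ball x s" for n y
      using f'(1)[of y n] that s by (auto intro: has_derivative_at_withinI)
    show "\<forall>\<^sub>F n in sequentially. \<forall>y\<in>ball x s. \<forall>h. cmod (f' n y h - G y h) \<le> e * norm h" if e: "e > 0" for e
    proof -
      obtain N where N: "\<And>m n y v. m \<ge> N \<Longrightarrow> n \<ge> N \<Longrightarrow> y \<in> ball x s \<Longrightarrow> cmod (f' m y v - f' n y v) \<le> e * norm v"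
        using cau[OF e] by blast
      have "cmod (f' n y v - G y v) \<le> e * norm v" if "n \<ge> N" "y \<in> ball x s" for n y v
      proof (rule tendsto_upperbound)
        show "(\<lambda>m. cmod (f' n y v - f' m y v)) \<longlonglongrightarrow> cmod (f' n y v - G y v)"
          by (intro tendsto_intros G that)
        show "\<forall>\<^sub>F m in sequentially. cmod (f' n y v - f' m y v) \<le> e * norm v"
          using N[OF that(1) _ that(2)] by (auto simp: eventually_sequentially)
      qed auto
      then show ?thesis unfolding eventually_sequentially by blast
    qed
    show "(\<lambda>n. f n x) \<longlonglongrightarrow> g x" using ul r by (intro tendsto_uniform_limitI[OF ul]) auto
  qed (use x in auto)
  then obtain h where h: "\<And>y. y \<in> ball x s \<Longrightarrow> (\<lambda>n. f n y) \<longlonglongrightarrow> h y"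
      "(h has_derivative G x) (at x within ball x s)" using x by blast
  have hg: "h y = g y" if "y \<in> ball x s" for y
    using that s tendsto_uniform_limitI[OF ul, of y] h(1)[OF that] LIMSEQ_unique by fastforce
  have "(g has_derivative G x) (at x within ball x s)"
    by (rule has_derivative_transform[OF x _ h(2)]) (simp add: hg)
  then have "(g has_derivative G x) (at x)" using x by (simp add: at_within_open[OF _ open_ball])
  moreover have "G x (c *s v) = c * G x v" for c v
  proof (rule LIMSEQ_unique[OF G[OF x]])
    show "(\<lambda>n. f' n x (c *s v)) \<longlonglongrightarrow> c * G x v"
      using x s by (subst f'(2)) (auto intro!: tendsto_intros G)
  qed
  ultimately show ?thesis unfolding holo_at_def by blast
qed

section \<open>Injective derivatives, biholomorphisms onto the image, maps close to the
  identity\<close>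

definition nondegenerate :: "('a::real_normed_vector \<Rightarrow> 'b::real_normed_vector) \<Rightarrow> 'a \<Rightarrow> bool" where
  "nondegenerate F x \<longleftrightarrow> (\<exists>F'. (F has_derivative F') (at x) \<and> (\<forall>v. F' v = 0 \<longrightarrow> v = 0))"

lemma nondegenerate_compose:
  assumes "nondegenerate F x" "nondegenerate G (F x)"
  shows "nondegenerate (\<lambda>x. G (F x)) x"
proof -
  obtain F' where F': "(F has_derivative F') (at x)" "\<forall>v. F' v = 0 \<longrightarrow> v = 0"
    using assms(1) by (auto simp: nondegenerate_def)
  obtain G' where G': "(G has_derivative G') (at (F x))" "\<forall>v. G' v = 0 \<longrightarrow> v = 0"
    using assms(2) by (auto simp: nondegenerate_def)
  show ?thesis unfolding nondegenerate_def
    by (rule exI[of _ "\<lambda>v. G' (F' v)"]) (use has_derivative_compose[OF F'(1) G'(1)] F'(2) G'(2) in auto)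
qed

lemma nondegenerate_cong:
  assumes "\<forall>\<^sub>F y in nhds x. F y = G y" "nondegenerate F x"
  shows "nondegenerate G x"
proof -
  have "\<forall>\<^sub>F y in at x. F y = G y" "F x = G x"
    using assms(1) by (auto simp: eventually_nhds_conv_at)
  then have "(F has_derivative F') (at x) \<Longrightarrow> (G has_derivative F') (at x)" for F'
    by (auto intro: has_derivative_transform_eventually)
  then show ?thesis using assms(2) unfolding nondegenerate_def by blast
qed

lemma nondegenerate_if_left_inverse:
  assumes F: "F differentiable (at x)" and G: "G differentiable (at (F x))"
    and inv: "\<forall>\<^sub>F y in nhds x. G (F y) = y"
  shows "nondegenerate F x"
proof -
  obtain F' where F': "(F has_derivative F') (at x)" using F by (auto simp: differentiable_def)
  obtain G' where G': "(G has_derivative G') (at (F x))" using G by (auto simp: differentiable_def)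
  have "((\<lambda>y. G (F y)) has_derivative (\<lambda>v. G' (F' v))) (at x)"
    using has_derivative_compose[OF F' G'] .
  moreover have "((\<lambda>y. G (F y)) has_derivative (\<lambda>v. v)) (at x)"
    using inv by (intro has_derivative_transform_eventually[OF has_derivative_ident])
      (auto simp: eventually_nhds_conv_at eq_commute elim: eventually_mono)
  ultimately have "G' (F' v) = v" for v using has_derivative_unique by metis
  moreover have "G' 0 = 0" using G' by (simp add: has_derivative_bounded_linear linear_simps(3))
  ultimately show ?thesis unfolding nondegenerate_def using F' by metis
qed

lemma holo_map_at_differentiable: "holo_map_at F x \<Longrightarrow> F differentiable (at x)"
  by (auto simp: holo_map_at_iff differentiable_def)

lemma holo_map_at_ident: "holo_map_at (\<lambda>x. x) x"
  by (simp add: holo_map_at_def)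

text \<open>Invariance of domain makes the image open and the inverse continuous; the derivative,
  injective between spaces of equal dimension, is invertible, and its inverse is the derivative of
  the inverse map.\<close>

theorem biholomorphismI:
  fixes F :: "complex ^ 'n \<Rightarrow> complex ^ 'n"
  assumes U: "open U" and inj: "inj_on F U" and hol: "\<And>x. x \<in> U \<Longrightarrow> holo_map_at F x"
    and nd: "\<And>x. x \<in> U \<Longrightarrow> nondegenerate F x"
  shows "biholomorphism F U (F ` U)"
proof -
  have cont: "continuous_on U F"
    using hol holo_map_at_imp_isCont by (auto intro: continuous_at_imp_continuous_on)
  have opn: "open (F ` U)" using invariance_of_domain[OF cont U inj] .
  have contg: "continuous_on (F ` U) (inv_into U F)"
  proof -
    obtain g where g: "homeomorphism U (F ` U) F g"
      using invariance_of_domain_homeomorphism[OF U cont _ inj] by auto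
    then have "continuous_on (F ` U) g" "\<And>x. x \<in> U \<Longrightarrow> g (F x) = x"
      by (auto simp: homeomorphism_def)
    then show ?thesis
      by (subst continuous_on_cong[of _ _ _ g]) (auto simp: inv_into_f_f[OF inj])
  qed
  have "holo_map_at (inv_into U F) y" if y: "y \<in> F ` U" for y
  proof -
    define x where "x = inv_into U F y"
    have x: "x \<in> U" "F x = y" using y by (auto simp: x_def inv_into_into f_inv_into_f)
    obtain F' where F': "(F has_derivative F') (at x)" "\<forall>v. F' v = 0 \<longrightarrow> v = 0"
      using nd[OF x(1)] by (auto simp: nondegenerate_def)
    obtain F'' where F'': "(F has_derivative F'') (at x)" "\<forall>c v. F'' (c *s v) = c *s F'' v"
      using hol[OF x(1)] by (auto simp: holo_map_at_iff)
    have eq: "F'' = F'" using F'(1) F''(1) has_derivative_unique by blast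
    have lin: "linear F'" using F'(1) by (simp add: has_derivative_linear)
    have injF: "inj F'" using F'(2) lin by (simp add: linear_injective_0)
    obtain G where G: "linear G" "F' \<circ> G = id" "G \<circ> F' = id"
      using linear_injective_isomorphism[OF lin injF] unfolding o_def id_def by (metis ext)
    have "(inv_into U F has_derivative G) (at y)"
    proof (rule has_derivative_inverse_basic[of F F' _ _ _ "F ` U"])
      show "bounded_linear G" using G(1) by (simp add: linear_conv_bounded_linear)
      show "isCont (inv_into U F) y" using contg opn y by (metis continuous_on_eq_continuous_at)
    qed (use F' G opn y in \<open>auto simp: x_def[symmetric] f_inv_into_f\<close>)
    \<comment> \<open>The inverse of a complex linear bijection is complex linear.\<close>
    moreover have "G (c *s v) = c *s G v" for c v
    proof -
      have "F' (c *s G v) = c *s v" using F''(2) G(2) unfolding eq by (simp add: fun_eq_iff)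
      then show ?thesis using G(3) by (simp add: fun_eq_iff) metis
    qed
    ultimately show ?thesis by (auto simp: holo_map_at_iff)
  qed
  then show ?thesis
    unfolding biholomorphism_def using U opn inj hol by (auto simp: bij_betw_def holomorphic_map_on_iff)
qed

lemma biholomorphism_nondegenerate:
  assumes "biholomorphism F U V" "x \<in> U"
  shows "nondegenerate F x"
proof (rule nondegenerate_if_left_inverse)
  have V: "F x \<in> V" using assms by (auto simp: biholomorphism_def bij_betw_def)
  show "F differentiable at x" "inv_into U F differentiable at (F x)"
    using assms V by (auto simp: biholomorphism_def holomorphic_map_on_iff intro: holo_map_at_differentiable)
  show "\<forall>\<^sub>F y in nhds x. inv_into U F (F y) = y"
    using assms by (intro eventually_nhds_in_open[THEN eventually_mono, of U])
      (auto simp: biholomorphism_def bij_betw_def inv_into_f_f)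
qed

lemma nondegenerate_iterate:
  assumes "\<And>x. x \<in> S \<Longrightarrow> nondegenerate F x" "F ` S \<subseteq> S" "x \<in> S"
  shows "nondegenerate (F ^^ j) x"
proof -
  have "(F ^^ j) x \<in> S \<and> nondegenerate (F ^^ j) x"
  proof (induction j)
    case 0
    show ?case using assms(3) by (auto simp: nondegenerate_def intro!: exI[of _ "\<lambda>v. v"] has_derivative_ident)
  next
    case (Suc j)
    then show ?case using assms nondegenerate_compose[of "F ^^ j" x F] by (auto simp: o_def)
  qed
  then show ?thesis ..
qed

lemma norm_vec_le_sum: "norm (x :: complex ^ 'n) \<le> (\<Sum>i\<in>UNIV. cmod (x $ i))"
  by (simp add: norm_vec_def L2_set_le_sum)

text \<open>Cauchy's estimate makes \<open>h x - x\<close> Lipschitz with constant 1/2 on the half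
  ball, which yields injectivity and an injective derivative. Surjectivity onto the quarter ball
  comes from Brouwer's theorem: a preimage of y is a fixed point of
  \<open>y - (h x - x)\<close>.\<close>

theorem near_identity:
  fixes h :: "complex ^ 'n \<Rightarrow> complex ^ 'n"
  assumes hol: "\<And>x. x \<in> ball \<xi> r \<Longrightarrow> holo_map_at h x" and r: "r > 0"
    and close: "\<And>x. x \<in> ball \<xi> r \<Longrightarrow> norm (h x - x) \<le> r / (8 * CARD('n))"
  shows "inj_on h (ball \<xi> (r/2))" "\<And>x. x \<in> ball \<xi> (r/2) \<Longrightarrow> nondegenerate h x"
    "ball \<xi> (r/4) \<subseteq> h ` ball \<xi> (r/2)"
proof -
  define \<eta> where "\<eta> = r / (8 * CARD('n))"
  have eta: "0 < \<eta>" "\<eta> \<le> r / 8" using r by (auto simp: \<eta>_def field_simps)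
  define k where "k = (\<lambda>x. h x - x)"
  have holk: "holo_map_at k x" if "x \<in> ball \<xi> r" for x
    using hol[OF that] by (auto simp: k_def holo_map_at_def intro: holo_at_diff)
  have kder: "norm (k' v) \<le> 1/2 * norm v" if x: "x \<in> ball \<xi> (r/2)" and k': "(k has_derivative k') (at x)" for x k' v
  proof -
    obtain k'' where k'': "(k has_derivative k'') (at x)" "\<forall>c v. k'' (c *s v) = c *s k'' v"
      using holk[of x] x r by (auto simp: holo_map_at_iff)
    have eq: "k'' = k'" using k' k''(1) has_derivative_unique by blast
    \<comment> \<open>The radius r/3 fits since r/2 + r/3 < r; summed over the n coordinates the
      bound becomes 3/8, below 1/2.\<close>
    have "cmod (k' v $ i) \<le> \<eta> / (r/3) * norm v" for i
    proof (rule holo_derivative_bound[of x "r/3" "\<lambda>x. k x $ i"])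
      show "((\<lambda>x. k x $ i) has_derivative (\<lambda>v. k' v $ i)) (at x)"
        using k' by (simp add: has_derivative_vec_nth_iff)
      show "\<forall>c v. k' (c *s v) $ i = c * k' v $ i" using k''(2) eq by simp
      fix y assume "y \<in> cball x (r/3)"
      then have y: "y \<in> ball \<xi> r" using x r dist_triangle[of \<xi> y x] by auto
      show "holo_at (\<lambda>x. k x $ i) y" using holk[OF y] by (simp add: holo_map_at_def)
      show "cmod (k y $ i) \<le> \<eta>" using close[OF y] order_trans[OF Finite_Cartesian_Product.norm_nth_le[of "k y" i]]
        by (simp add: k_def \<eta>_def)
    qed (use r in auto)
    then have "norm (k' v) \<le> (\<Sum>i::'n\<in>UNIV. \<eta> / (r/3) * norm v)"
      by (intro order_trans[OF norm_vec_le_sum] sum_mono) auto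
    also have "\<dots> = 3/8 * norm v" using r by (simp add: \<eta>_def)
    also have "\<dots> \<le> 1/2 * norm v" by (intro mult_right_mono) auto
    finally show ?thesis .
  qed
  obtain k' where k': "\<And>x. x \<in> ball \<xi> r \<Longrightarrow> (k has_derivative k' x) (at x)"
    using holk unfolding holo_map_at_iff by metis
  have lip: "norm (k x - k y) \<le> 1/2 * norm (x - y)" if "x \<in> ball \<xi> (r/2)" "y \<in> ball \<xi> (r/2)" for x y
  proof (rule differentiable_bound[OF convex_ball _ _ that])
    fix x assume x: "x \<in> ball \<xi> (r/2)"
    then have x': "x \<in> ball \<xi> r" using r by auto
    show "(k has_derivative k' x) (at x within ball \<xi> (r/2))"
      using k'[OF x'] has_derivative_at_withinI by blast
    show "onorm (k' x) \<le> 1/2" using kder[OF x k'[OF x']] by (intro onorm_le)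
  qed
  show "inj_on h (ball \<xi> (r/2))"
  proof (rule inj_onI)
    fix x y assume xy: "x \<in> ball \<xi> (r/2)" "y \<in> ball \<xi> (r/2)" "h x = h y"
    have "k x - k y = - (x - y)" using xy(3) by (simp add: k_def)
    then have "norm (x - y) \<le> 1/2 * norm (x - y)" using lip[OF xy(1,2)] by (metis norm_minus_cancel)
    then show "x = y" by simp
  qed
  show "nondegenerate h x" if x: "x \<in> ball \<xi> (r/2)" for x
  proof -
    have x': "x \<in> ball \<xi> r" using x r by auto
    have "((\<lambda>x. k x + x) has_derivative (\<lambda>v. k' x v + v)) (at x)"
      by (intro has_derivative_add k' x' has_derivative_ident)
    then have "(h has_derivative (\<lambda>v. k' x v + v)) (at x)" by (simp add: k_def)
    moreover have "v = 0" if "k' x v + v = 0" for v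
    proof -
      have "k' x v = - v" using that by (simp add: eq_neg_iff_add_eq_0)
      then have "norm v \<le> 1/2 * norm v" using kder[OF x k'[OF x'], of v] by simp
      then show ?thesis by simp
    qed
    ultimately show ?thesis unfolding nondegenerate_def by blast
  qed
  show "ball \<xi> (r/4) \<subseteq> h ` ball \<xi> (r/2)"
  proof
    fix y assume y: "y \<in> ball \<xi> (r/4)"
    define T where "T = (\<lambda>x. y - k x)"
    \<comment> \<open>The radius 3r/8 is r/4, which bounds the distance from y to the centre, plus
      r/8, which bounds \<open>k\<close>; so \<open>T\<close> maps this ball to itself.\<close>
    have sub: "cball \<xi> (3*r/8) \<subseteq> ball \<xi> r" "cball \<xi> (3*r/8) \<subseteq> ball \<xi> (r/2)" using r by auto
    have "continuous_on (cball \<xi> (3*r/8)) k"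
      using holk sub holo_map_at_imp_isCont by (intro continuous_at_imp_continuous_on) blast
    then have "continuous_on (cball \<xi> (3*r/8)) T" unfolding T_def by (intro continuous_intros)
    moreover have "T x \<in> cball \<xi> (3*r/8)" if "x \<in> cball \<xi> (3*r/8)" for x
    proof -
      have "norm (k x) \<le> r/8" using close[of x] that sub eta by (auto simp: k_def \<eta>_def)
      have "dist \<xi> (T x) \<le> dist \<xi> y + dist y (T x)" by (rule dist_triangle)
      also have "dist y (T x) = norm (k x)" by (simp add: T_def dist_norm)
      also note \<open>norm (k x) \<le> r/8\<close>
      finally show ?thesis using y by simp
    qed
    ultimately obtain x where x: "x \<in> cball \<xi> (3*r/8)" "T x = x"
      using brouwer_ball[of "3*r/8" \<xi> T] r by auto
    then have "h x = y" by (auto simp: T_def k_def algebra_simps)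
    then show "y \<in> h ` ball \<xi> (r/2)" using x(1) sub(2) by blast
  qed
qed

section \<open>Germs and Taylor expansion\<close>

definition hgerm :: "(complex ^ 'n \<Rightarrow> complex) \<Rightarrow> bool" where
  "hgerm h \<longleftrightarrow> (\<forall>\<^sub>F x in nhds 0. holo_at h x)"

lemma hgerm_iff: "hgerm h \<longleftrightarrow> (\<exists>S. open S \<and> 0 \<in> S \<and> holomorphic_fun_on h S)"
  unfolding hgerm_def eventually_nhds holomorphic_fun_on_iff by blast

lemma hgerm_const [simp]: "hgerm (\<lambda>_. c)" and hgerm_nth [simp]: "hgerm (\<lambda>x. x $ i)"
  by (auto simp: hgerm_def)

lemma hgerm_add: "hgerm f \<Longrightarrow> hgerm g \<Longrightarrow> hgerm (\<lambda>x. f x + g x)"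
  and hgerm_diff: "hgerm f \<Longrightarrow> hgerm g \<Longrightarrow> hgerm (\<lambda>x. f x - g x)"
  and hgerm_mult: "hgerm f \<Longrightarrow> hgerm g \<Longrightarrow> hgerm (\<lambda>x. f x * g x)"
  unfolding hgerm_def by (auto elim: eventually_elim2 intro: holo_at_add holo_at_diff holo_at_mult)

lemma hgerm_isCont: "hgerm f \<Longrightarrow> isCont f 0"
  unfolding hgerm_def by (drule eventually_nhds_x_imp_x) (rule holo_at_imp_isCont)

lemma hgerm_tendsto: "hgerm f \<Longrightarrow> (f \<longlongrightarrow> f 0) (nhds 0)"
  using hgerm_isCont[of f] by (simp add: tendsto_at_iff_tendsto_nhds isCont_def)

lemma hgerm_compose1:
  assumes "hgerm g" "open T" "g 0 \<in> T" "\<phi> holomorphic_on T"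
  shows "hgerm (\<lambda>x. \<phi> (g x))"
proof -
  have "\<forall>\<^sub>F x in nhds 0. g x \<in> T"
    using hgerm_tendsto[OF assms(1)] assms(2,3) by (auto simp: tendsto_def)
  with assms(1) show ?thesis unfolding hgerm_def
  proof eventually_elim
    case (elim x)
    then show ?case using assms(2,4)
      by (intro holo_at_comp1[of \<phi>]) (auto simp: holomorphic_on_open field_differentiable_def)
  qed
qed

lemma hgerm_inverse: "hgerm g \<Longrightarrow> g 0 \<noteq> 0 \<Longrightarrow> hgerm (\<lambda>x. inverse (g x))"
  by (rule hgerm_compose1[of g "- {0}" inverse]) (auto intro!: holomorphic_intros)

lemma hgerm_divide: "hgerm f \<Longrightarrow> hgerm g \<Longrightarrow> g 0 \<noteq> 0 \<Longrightarrow> hgerm (\<lambda>x. f x / g x)"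
  by (simp add: divide_inverse hgerm_mult hgerm_inverse)

lemma hgerm_cong:
  assumes "\<forall>\<^sub>F x in nhds 0. f x = g x" "hgerm f"
  shows "hgerm g"
proof -
  have "\<forall>\<^sub>F x in nhds 0. \<forall>\<^sub>F y in nhds x. f y = g y"
    using assms(1) by (simp add: eventually_eventually)
  with assms(2) show ?thesis unfolding hgerm_def
    by eventually_elim (rule holo_at_cong)
qed

lemma hgerm_bound:
  assumes "hgerm h"
  shows "\<exists>C\<ge>0. \<forall>\<^sub>F x in nhds 0. cmod (h x - h 0) \<le> C * norm x"
proof -
  have "holo_at h 0" using assms unfolding hgerm_def by (rule eventually_nhds_x_imp_x)
  then obtain h' where h': "(h has_derivative h') (at 0)" by (auto simp: holo_at_def)
  obtain C0 where C0: "\<And>v. cmod (h' v) \<le> norm v * C0" "C0 > 0"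
    using bounded_linear.pos_bounded[OF has_derivative_bounded_linear[OF h']] by blast
  obtain \<delta> where \<delta>: "\<delta> > 0" "\<And>y. norm (y - 0) < \<delta> \<Longrightarrow> cmod (h y - h 0 - h' (y - 0)) \<le> 1 * norm (y - 0)"
    using has_derivative_within_alt[THEN iffD1, OF h'[unfolded at_within_def[of 0 UNIV, symmetric]]]
    by (metis UNIV_I zero_less_one)
  have "cmod (h y - h 0) \<le> (C0 + 1) * norm y" if "norm y < \<delta>" for y
  proof -
    have "cmod (h y - h 0) \<le> cmod (h y - h 0 - h' y) + cmod (h' y)" by (metis norm_triangle_sub add.commute)
    then show ?thesis using \<delta>(2)[of y] C0(1)[of y] that by (simp add: algebra_simps)
  qed
  moreover have "\<forall>\<^sub>F y in nhds (0 :: complex^'a). norm y < \<delta>"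
    using \<delta>(1) by (auto simp: eventually_nhds_metric)
  ultimately show ?thesis using C0(2)
    by (intro exI[of _ "C0 + 1"] conjI) (auto elim: eventually_mono)
qed

section \<open>Monomials, polynomials and Taylor approximation\<close>

definition total_degree :: "nat ^ 'n \<Rightarrow> nat" where
  "total_degree k = (\<Sum>i\<in>UNIV. k $ i)"

lemma monom_power_add: "monom_power x (k + l) = monom_power x k * monom_power x l"
  by (simp add: monom_power_def power_add prod.distrib)

lemma monom_power_axis: "monom_power x (axis i 1) = x $ i"
proof -
  have "monom_power x (axis i 1) = (\<Prod>j\<in>UNIV. if j = i then x $ i else 1)"
    unfolding monom_power_def by (intro prod.cong) (auto simp: axis_def)
  then show ?thesis by simp
qed

lemma monom_power_at_0: "k \<noteq> 0 \<Longrightarrow> monom_power 0 k = 0"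
  by (auto simp: monom_power_def vec_eq_iff)

lemma holo_at_monom_power: "holo_at (\<lambda>x. monom_power x k) x"
  unfolding monom_power_def by (intro holo_at_prod holo_at_power holo_at_nth)

lemma hgerm_monom_power [simp]: "hgerm (\<lambda>x. monom_power x k)"
  by (simp add: hgerm_def holo_at_monom_power)

lemma total_degree_add: "total_degree (k + l) = total_degree k + total_degree l"
  by (simp add: total_degree_def sum.distrib)

lemma total_degree_axis: "total_degree (axis i 1) = 1"
  by (simp add: total_degree_def axis_def)

lemma total_degree_pos: "k \<noteq> 0 \<Longrightarrow> total_degree k > 0"
  by (auto simp: total_degree_def vec_eq_iff sum_pos2)

lemma norm_monom_power_le: "cmod (monom_power x k) \<le> norm x ^ total_degree k"
proof -
  have "cmod (monom_power x k) = (\<Prod>i\<in>UNIV. cmod (x $ i) ^ k $ i)"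
    by (simp add: monom_power_def prod_norm[symmetric] norm_power)
  also have "\<dots> \<le> (\<Prod>i\<in>UNIV. norm x ^ k $ i)"
    by (intro prod_mono conjI power_mono Finite_Cartesian_Product.norm_nth_le) auto
  finally show ?thesis by (simp add: total_degree_def power_sum)
qed

lemma monom_power_scale: "monom_power (t *\<^sub>R x) k = of_real (t ^ total_degree k) * monom_power x k"
  by (simp add: monom_power_def total_degree_def power_mult_distrib prod.distrib power_sum scaleR_conv_of_real[where 'a=complex])

text \<open>Polynomial functions without constant term, generated term by term so that properties
  stable under linear combinations reduce to single monomials.\<close>

inductive poly0 :: "(complex ^ 'n \<Rightarrow> complex) \<Rightarrow> bool" where
  zero: "poly0 (\<lambda>_. 0)"
| add: "poly0 p \<Longrightarrow> k \<noteq> 0 \<Longrightarrow> poly0 (\<lambda>x. p x + c * monom_power x k)"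

lemma poly0_monom: "k \<noteq> 0 \<Longrightarrow> poly0 (\<lambda>x. c * monom_power x k)"
  using poly0.add[OF poly0.zero] by simp

lemma poly0_add:
  assumes "poly0 p" "poly0 q"
  shows "poly0 (\<lambda>x. p x + q x)"
  using assms(2)
proof (induction q rule: poly0.induct)
  case (add q k c)
  then have "poly0 (\<lambda>x. (p x + q x) + c * monom_power x k)" by (intro poly0.add) auto
  then show ?case by (simp add: add.assoc)
qed (use assms(1) in simp)

lemma poly0_sum: "(\<And>i. i \<in> I \<Longrightarrow> poly0 (p i)) \<Longrightarrow> poly0 (\<lambda>x. \<Sum>i\<in>I. p i x)"
  by (induction I rule: infinite_finite_induct) (auto intro: poly0_add poly0.zero)

text \<open>Along a ray, x_i x^k scales like t^(N+1) with N the degree of k, so division by N + 1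
  integrates it. This lifts Taylor polynomials of the partial derivatives to one of the
  function.\<close>

lemma poly0_radial_integral:
  fixes p :: "complex ^ 'n \<Rightarrow> complex"
  assumes "poly0 p"
  shows "\<exists>q. poly0 q \<and> (\<forall>x t. ((\<lambda>t. q (t *\<^sub>R x)) has_vector_derivative x $ i * p (t *\<^sub>R x)) (at t))"
  using assms
proof induction
  case zero
  show ?case by (intro exI[of _ "\<lambda>_. 0"]) (auto intro: poly0.zero)
next
  case (add p k c)
  then obtain q where q: "poly0 q" "\<And>x t. ((\<lambda>t. q (t *\<^sub>R x)) has_vector_derivative x $ i * p (t *\<^sub>R x)) (at t)"
    by blast
  define N where "N = total_degree k"
  let ?q = "\<lambda>x. q x + c / of_nat (Suc N) * monom_power x (k + axis i 1)"
  have "k + axis i 1 \<noteq> 0" using add by (auto simp: vec_eq_iff)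
  then have "poly0 ?q" using q(1) by (rule poly0.add[rotated])
  moreover have "((\<lambda>t. ?q (t *\<^sub>R x)) has_vector_derivative x $ i * (p (t *\<^sub>R x) + c * monom_power (t *\<^sub>R x) k)) (at t)" for x t
  proof -
    have eq: "c / of_nat (Suc N) * monom_power (t *\<^sub>R x) (k + axis i 1)
        = of_real (t ^ Suc N) * (c / of_nat (Suc N) * (monom_power x k * x $ i))" for t
      by (simp add: monom_power_add monom_power_scale N_def[symmetric] monom_power_axis[unfolded One_nat_def]
         total_degree_axis[unfolded One_nat_def] scaleR_conv_of_real[where 'a=complex])
    have "((\<lambda>t::real. t ^ Suc N) has_real_derivative of_nat (Suc N) * t ^ N) (at t)"
      using DERIV_pow[of "Suc N" t] by simp
    then have "((\<lambda>t. of_real (t ^ Suc N) * (c / of_nat (Suc N) * (monom_power x k * x $ i)))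
       has_vector_derivative of_real (of_nat (Suc N) * t ^ N) * (c / of_nat (Suc N) * (monom_power x k * x $ i))) (at t)"
      by (intro has_vector_derivative_mult_left has_vector_derivative_of_real)
        (simp add: has_real_derivative_iff_has_vector_derivative)
    moreover have "of_real (of_nat (Suc N) * t ^ N) * (c / of_nat (Suc N) * (monom_power x k * x $ i))
       = x $ i * (c * monom_power (t *\<^sub>R x) k)"
      by (simp add: monom_power_scale N_def[symmetric] field_simps del: of_nat_Suc)
    ultimately have "((\<lambda>t. c / of_nat (Suc N) * monom_power (t *\<^sub>R x) (k + axis i 1))
       has_vector_derivative x $ i * (c * monom_power (t *\<^sub>R x) k)) (at t)"
      unfolding eq by simp
    from has_vector_derivative_add[OF q(2) this] show ?thesis by (simp add: algebra_simps)
  qed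
  ultimately show ?case by (intro exI[of _ ?q]) blast
qed

text \<open>Difference quotients with real steps tending to 0 are holomorphic and converge uniformly
  near \<open>x\<close>, because the second derivative along the coordinate direction is bounded
  there.\<close>

lemma holo_at_partial_derivative:
  fixes h :: "complex ^ 'n \<Rightarrow> complex"
  assumes hol: "\<And>y. y \<in> ball x r \<Longrightarrow> holo_at h y" and r: "r > 0"
    and h': "\<And>y. y \<in> ball x r \<Longrightarrow> (h has_derivative h' y) (at y)"
  shows "holo_at (\<lambda>y. h' y (axis i 1)) x"
proof -
  define s where "s = r / 4"
  have s: "s > 0" using r by (simp add: s_def)
  let ?e = "axis i 1 :: complex ^ 'n"
  have lin: "\<forall>c v. h' y (c *s v) = c * h' y v" if y: "y \<in> ball x r" for y
  proof -
    obtain g' where g': "(h has_derivative g') (at y)" "\<forall>c v. g' (c *s v) = c * g' v"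
      using hol[OF y] unfolding holo_at_def by blast
    then show ?thesis using has_derivative_unique[OF h'[OF y] g'(1)] by simp
  qed
  have "compact (cball x (3 * s))" by simp
  moreover have "continuous_on (cball x (3 * s)) h"
    using r by (intro continuous_at_imp_continuous_on ballI holo_at_imp_isCont hol) (auto simp: s_def)
  ultimately have "bounded (h ` cball x (3 * s))" using compact_continuous_image compact_imp_bounded by blast
  then obtain B where B: "B > 0" "\<And>y. y \<in> cball x (3 * s) \<Longrightarrow> cmod (h y) \<le> B"
    by (auto simp: bounded_pos)
  \<comment> \<open>Cauchy's bound for the second derivative on discs of radius \<open>s\<close>;
    with Taylor's formula it makes the difference quotients converge at the rate C |t|.\<close>
  define C where "C = fact 2 * B / s ^ 2"
  have C: "C \<ge> 0" using B by (simp add: C_def)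
  have est: "cmod (h (y + t *s ?e) - h y - t * h' y ?e) \<le> C * cmod t ^ 2"
    if y: "y \<in> ball x s" and t: "cmod t \<le> s / 2" for y t
  proof -
    define f where "f = (\<lambda>t. h (y + t *s ?e))"
    have inb: "y + u *s ?e \<in> cball x (3 * s)" if "cmod u \<le> 2 * s" for u
      using y that dist_triangle[of x "y + u *s ?e" y] by (auto simp: dist_norm)
    have inb': "y + u *s ?e \<in> ball x r" if "cmod u \<le> 2 * s" for u
      using inb[OF that] s by (auto simp: s_def)
    have fd: "(f has_field_derivative h' (y + u *s ?e) ?e) (at u)" if "cmod u \<le> 2 * s" for u
      unfolding f_def using holo_at_line[OF h'[OF inb'[OF that]] lin[OF inb'[OF that]]] .
    have fh: "f holomorphic_on ball 0 (2 * s)"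
      unfolding holomorphic_on_open[OF open_ball]
    proof
      fix u :: complex assume "u \<in> ball 0 (2 * s)"
      then have "cmod u \<le> 2 * s" by simp
      from fd[OF this] show "\<exists>f'. (f has_field_derivative f') (at u)" ..
    qed
    have d1: "(f has_field_derivative deriv f u) (at u)" "(deriv f has_field_derivative deriv (deriv f) u) (at u)"
      if "u \<in> ball 0 (2 * s)" for u
      using that fh holomorphic_derivI[OF fh open_ball that] holomorphic_derivI[OF holomorphic_deriv[OF fh open_ball] open_ball that]
      by auto
    have d2: "cmod (deriv (deriv f) u) \<le> C" if "cmod u \<le> s / 2" "t = t" for u
    proof -
      have sb: "cball u s \<subseteq> ball 0 (2 * s)"
      proof
        fix w assume "w \<in> cball u s"
        then show "w \<in> ball 0 (2 * s)" using that(1) s dist_triangle[of 0 w u] by auto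
      qed
      have "norm ((deriv ^^ 2) f u) \<le> fact 2 * B / s ^ 2"
      proof (rule Cauchy_inequality)
        show "f holomorphic_on ball u s" using fh sb by (rule holomorphic_on_subset[OF _ order_trans[OF ball_subset_cball]])
        show "continuous_on (cball u s) f"
          using holomorphic_on_imp_continuous_on[OF fh] sb continuous_on_subset by blast
        fix w assume "cmod (u - w) = s"
        then have "w \<in> ball 0 (2 * s)" using sb by (auto simp: dist_norm)
        then show "cmod (f w) \<le> B" unfolding f_def by (intro B inb) auto
      qed (rule s)
      then show ?thesis by (simp add: C_def numeral_2_eq_2)
    qed
    have "cmod ((\<lambda>i. (deriv ^^ i) f) 0 t - (\<Sum>i\<le>1. (deriv ^^ i) f 0 * (t - 0) ^ i / fact i)) \<le> C * cmod (t - 0) ^ Suc 1 / fact 1"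
    proof (rule complex_Taylor[of "cball 0 (s/2)"])
      fix i and u :: complex assume "u \<in> cball 0 (s/2)" and i: "i \<le> (1::nat)"
      then have "u \<in> ball 0 (2 * s)" using s by auto
      then show "((deriv ^^ i) f has_field_derivative (deriv ^^ Suc i) f u) (at u within cball 0 (s/2))"
        using d1[of u] i by (cases i) (auto intro: has_field_derivative_at_within)
    next
      fix u :: complex assume "u \<in> cball 0 (s/2)"
      then show "cmod ((deriv ^^ Suc 1) f u) \<le> C" using d2[of u] by auto
    qed (use t s in auto)
    moreover have "deriv f 0 = h' y ?e" using fd[of 0] s by (simp add: DERIV_imp_deriv)
    ultimately show ?thesis by (simp add: f_def power2_eq_square algebra_simps)
  qed
  define t where "t = (\<lambda>n. s / 2 * inverse (real (Suc n)))"
  have t: "t n > 0" "t n \<le> s / 2" for n using s by (auto simp: t_def field_simps)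
  have tlim: "t \<longlonglongrightarrow> 0" unfolding t_def by (rule tendsto_mult_right_zero[OF LIMSEQ_inverse_real_of_nat])
  show ?thesis
  proof (rule holo_at_uniform_limit[OF _ s])
    fix n y assume y: "y \<in> ball x s"
    have "y + of_real (t n) *s ?e \<in> ball x r"
      using y t(1,2)[of n] s dist_triangle[of x "y + of_real (t n) *s ?e" y] by (auto simp: dist_norm s_def)
    moreover have "y \<in> ball x r" using y s by (auto simp: s_def)
    moreover have "holo_map_at (\<lambda>y. y + of_real (t n) *s ?e) y"
      by (auto simp: holo_map_at_def intro!: holo_at_intros)
    ultimately show "holo_at (\<lambda>y. (h (y + of_real (t n) *s ?e) - h y) / of_real (t n)) y"
      using t(1)[of n] by (intro holo_at_intros holo_at_compose[of "\<lambda>y. y + of_real (t n) *s ?e" y h] hol) auto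
  next
    show "uniform_limit (ball x s) (\<lambda>n y. (h (y + of_real (t n) *s ?e) - h y) / of_real (t n)) (\<lambda>y. h' y ?e) sequentially"
    proof (rule uniform_limitI)
      fix e :: real assume e: "e > 0"
      have "\<forall>\<^sub>F n in sequentially. C * t n < e"
        using tendsto_mult_right_zero[OF tlim, of C] e by (rule order_tendstoD)
      then show "\<forall>\<^sub>F n in sequentially. \<forall>y\<in>ball x s. dist ((h (y + of_real (t n) *s ?e) - h y) / of_real (t n)) (h' y ?e) < e"
      proof eventually_elim
        case (elim n)
        have "dist ((h (y + of_real (t n) *s ?e) - h y) / of_real (t n)) (h' y ?e) < e" if "y \<in> ball x s" for y
        proof -
          have "(h (y + of_real (t n) *s ?e) - h y) / of_real (t n) - h' y ?e
              = (h (y + of_real (t n) *s ?e) - h y - of_real (t n) * h' y ?e) / of_real (t n)"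
            using t(1)[of n] by (simp add: field_simps)
          then have "dist ((h (y + of_real (t n) *s ?e) - h y) / of_real (t n)) (h' y ?e) \<le> C * t n ^ 2 / t n"
            using est[OF that, of "of_real (t n)"] t[of n] by (simp add: dist_norm norm_divide divide_right_mono)
          also have "\<dots> = C * t n" using t(1)[of n] by (simp add: power2_eq_square)
          finally show ?thesis using elim by simp
        qed
        then show ?case ..
      qed
    qed
  qed
qed

text \<open>Induction on the order: along a ray the derivative of h is the sum of x_i times the
  partial derivatives, to which the induction hypothesis applies. Integrating their approximations
  over [0, 1] gains one order; the mean value inequality replaces the integral of the error.\<close>

theorem hgerm_taylor:
  assumes "hgerm h"
  shows "\<exists>p C. poly0 p \<and> (\<forall>\<^sub>F x in nhds 0. cmod (h x - h 0 - p x) \<le> C * norm x ^ N)"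
  using assms
proof (induction N arbitrary: h)
  case 0
  obtain C where C: "\<forall>\<^sub>F x in nhds 0. cmod (h x - h 0) \<le> C * norm x" "C \<ge> 0"
    using hgerm_bound[OF 0] by blast
  have "\<forall>\<^sub>F x in nhds 0. norm (x :: complex ^ 'a) < 1"
    by (auto simp: eventually_nhds_metric intro: exI[of _ 1])
  with C(1) have "\<forall>\<^sub>F x in nhds 0. cmod (h x - h 0 - 0) \<le> C * norm x ^ 0"
  proof eventually_elim
    case (elim x)
    then have "C * norm x \<le> C * 1" using C(2) by (intro mult_left_mono) auto
    with elim show ?case by simp
  qed
  then show ?case using poly0.zero by blast
next
  case (Suc N)
  obtain r where r: "r > 0" "\<And>x. x \<in> ball 0 r \<Longrightarrow> holo_at h x"
    using Suc.prems unfolding hgerm_def eventually_nhds_metric by (auto simp: dist_commute)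
  obtain h' where h': "\<And>y. y \<in> ball 0 r \<Longrightarrow> (h has_derivative h' y) (at y)"
    "\<And>y c v. y \<in> ball 0 r \<Longrightarrow> h' y (c *s v) = c * h' y v"
  proof -
    define F where "F y = (SOME F. (h has_derivative F) (at y) \<and> (\<forall>c v. F (c *s v) = c * F v))" for y
    have "(h has_derivative F y) (at y) \<and> (\<forall>c v. F y (c *s v) = c * F y v)" if "y \<in> ball 0 r" for y
      unfolding F_def using r(2)[OF that, unfolded holo_at_def] by (rule someI_ex)
    then show ?thesis using that by blast
  qed
  define D where "D = (\<lambda>i x. h' x (axis i 1))"
  have D: "hgerm (D i)" for i
  proof -
    have "holo_at (D i) x" if x: "x \<in> ball 0 r" for x
    proof -
      obtain s where s: "s > 0" "ball x s \<subseteq> ball 0 r"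
        using x open_contains_ball[THEN iffD1, OF open_ball, of 0 r] by blast
      show ?thesis unfolding D_def
      proof (rule holo_at_partial_derivative[OF _ s(1)])
        fix y assume "y \<in> ball x s"
        then have y: "y \<in> ball 0 r" using s(2) by blast
        show "holo_at h y" "(h has_derivative h' y) (at y)" using r(2) h'(1) y by blast+
      qed
    qed
    then show ?thesis unfolding hgerm_def using r(1)
      by (intro eventually_nhds_in_open[THEN eventually_mono, of "ball 0 r"]) auto
  qed
  have hD: "h' y v = (\<Sum>i\<in>UNIV. v $ i * D i y)" if "y \<in> ball 0 r" for y v
  proof -
    have lin: "linear (h' y)" using h'(1)[OF that] by (rule has_derivative_linear)
    have "v = (\<Sum>i\<in>UNIV. v $ i *s axis i 1)" by (simp add: basis_expansion)
    then have "h' y v = (\<Sum>i\<in>UNIV. h' y (v $ i *s axis i 1))" using linear_sum[OF lin] by metis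
    then show ?thesis using h'(2)[OF that] by (simp add: D_def)
  qed
  obtain p C where pC: "\<And>i. poly0 (p i)" "\<And>i. \<forall>\<^sub>F x in nhds 0. cmod (D i x - D i 0 - p i x) \<le> C i * norm x ^ N"
  proof -
    have "\<forall>i. \<exists>p C. poly0 p \<and> (\<forall>\<^sub>F x in nhds 0. cmod (D i x - D i 0 - p x) \<le> C * norm x ^ N)"
      using Suc.IH[OF D] by blast
    then show ?thesis using that unfolding choice_iff by blast
  qed
  obtain q where q: "\<And>i. poly0 (q i)"
    "\<And>i x t. ((\<lambda>t. q i (t *\<^sub>R x)) has_vector_derivative x $ i * p i (t *\<^sub>R x)) (at t)"
  proof -
    have "\<forall>i. \<exists>q. poly0 q \<and> (\<forall>x t. ((\<lambda>t. q (t *\<^sub>R x)) has_vector_derivative x $ i * p i (t *\<^sub>R x)) (at t))"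
      using poly0_radial_integral[OF pC(1)] by blast
    then show ?thesis using that unfolding choice_iff by blast
  qed
  \<comment> \<open>The constant term of a partial derivative, kept apart in the induction
    hypothesis, integrates to a linear monomial.\<close>
  define P where "P = (\<lambda>x. \<Sum>i\<in>UNIV. D i 0 * monom_power x (axis i 1) + q i x)"
  have "axis i (1::nat) \<noteq> 0" for i :: 'a by (auto simp: vec_eq_iff axis_def)
  then have P: "poly0 P" unfolding P_def by (intro poly0_sum poly0_add poly0_monom q(1))
  have P0: "P 0 = 0"
  proof -
    have "p 0 = 0" if "poly0 p" for p :: "complex ^ 'a \<Rightarrow> complex"
      using that by induction (auto simp: monom_power_at_0)
    then show ?thesis using P by blast
  qed
  have "\<forall>\<^sub>F x in nhds 0. \<forall>i. cmod (D i x - D i 0 - p i x) \<le> C i * norm x ^ N"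
    using pC(2) by (simp add: eventually_all_finite)
  then obtain s where s: "s > 0" "\<And>x i. norm x < s \<Longrightarrow> cmod (D i x - D i 0 - p i x) \<le> C i * norm x ^ N"
    by (auto simp: eventually_nhds_metric)
  have "cmod (h x - h 0 - P x) \<le> (\<Sum>i\<in>UNIV. \<bar>C i\<bar>) * norm x ^ Suc N" if x: "norm x < min r s" for x
  proof -
    define g where "g = (\<lambda>t. h (t *\<^sub>R x) - P (t *\<^sub>R x))"
    define g' where "g' = (\<lambda>t. \<Sum>i\<in>UNIV. x $ i * (D i (t *\<^sub>R x) - D i 0 - p i (t *\<^sub>R x)))"
    have small: "norm (t *\<^sub>R x) < min r s" "norm (t *\<^sub>R x) \<le> norm x" if "t \<in> {0..1}" for t
    proof -
      have "norm (t *\<^sub>R x) \<le> norm x" using that by (auto simp: mult_left_le_one_le)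
      then show "norm (t *\<^sub>R x) < min r s" "norm (t *\<^sub>R x) \<le> norm x" using x by auto
    qed
    have "norm (g 1 - g 0) \<le> (\<Sum>i\<in>UNIV. \<bar>C i\<bar>) * norm x ^ Suc N * norm (1 - 0 :: real)"
    proof (rule differentiable_bound[of "{0..1}" g "\<lambda>t u. u *\<^sub>R g' t"])
      fix t :: real assume t: "t \<in> {0..1}"
      have tb: "t *\<^sub>R x \<in> ball 0 r" using small(1)[OF t] by simp
      have "((\<lambda>t. t *\<^sub>R x) has_derivative (\<lambda>u. u *\<^sub>R x)) (at t)"
        by (auto intro!: derivative_eq_intros)
      from has_derivative_compose[OF this h'(1)[OF tb]]
      have "((\<lambda>t. h (t *\<^sub>R x)) has_vector_derivative (\<Sum>i\<in>UNIV. x $ i * D i (t *\<^sub>R x))) (at t)"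
        using has_derivative_linear[OF h'(1)[OF tb]] tb
        by (simp add: has_vector_derivative_def linear_scale hD)
      moreover have "((\<lambda>t. P (t *\<^sub>R x)) has_vector_derivative (\<Sum>i\<in>UNIV. D i 0 * x $ i + x $ i * p i (t *\<^sub>R x))) (at t)"
        unfolding P_def monom_power_axis
        by (intro has_vector_derivative_sum has_vector_derivative_add q(2))
          (auto simp: scaleR_conv_of_real[where 'a=complex] intro!: derivative_eq_intros)
      ultimately have "(g has_vector_derivative (\<Sum>i\<in>UNIV. x $ i * D i (t *\<^sub>R x)) - (\<Sum>i\<in>UNIV. D i 0 * x $ i + x $ i * p i (t *\<^sub>R x))) (at t)"
        unfolding g_def by (rule has_vector_derivative_diff)
      also have "(\<Sum>i\<in>UNIV. x $ i * D i (t *\<^sub>R x)) - (\<Sum>i\<in>UNIV. D i 0 * x $ i + x $ i * p i (t *\<^sub>R x)) = g' t"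
        unfolding g'_def by (simp add: sum_subtractf[symmetric] algebra_simps)
      finally show "(g has_derivative (\<lambda>u. u *\<^sub>R g' t)) (at t within {0..1})"
        by (auto simp: has_vector_derivative_def intro: has_derivative_at_withinI)
      have "cmod (g' t) \<le> (\<Sum>i\<in>UNIV. norm x * (\<bar>C i\<bar> * norm x ^ N))"
        unfolding g'_def
      proof (intro order_trans[OF norm_sum] sum_mono)
        fix i
        have "cmod (D i (t *\<^sub>R x) - D i 0 - p i (t *\<^sub>R x)) \<le> C i * norm (t *\<^sub>R x) ^ N"
          using s(2)[of "t *\<^sub>R x"] small(1)[OF t] by simp
        also have "\<dots> \<le> \<bar>C i\<bar> * norm x ^ N" by (intro mult_mono power_mono small(2)[OF t]) auto
        finally show "cmod (x $ i * (D i (t *\<^sub>R x) - D i 0 - p i (t *\<^sub>R x))) \<le> norm x * (\<bar>C i\<bar> * norm x ^ N)"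
          unfolding norm_mult by (intro mult_mono Finite_Cartesian_Product.norm_nth_le) auto
      qed
      also have "\<dots> = (\<Sum>i\<in>UNIV. \<bar>C i\<bar>) * norm x ^ Suc N"
        by (simp add: sum_distrib_left sum_distrib_right algebra_simps)
      finally show "onorm (\<lambda>u. u *\<^sub>R g' t) \<le> (\<Sum>i\<in>UNIV. \<bar>C i\<bar>) * norm x ^ Suc N"
        by (intro onorm_le) (auto simp: mult.commute[of "\<bar>_\<bar>"] intro: mult_right_mono)
    qed auto
    then show ?thesis by (simp add: g_def P0 algebra_simps)
  qed
  moreover have "\<forall>\<^sub>F x in nhds (0 :: complex ^ 'a). norm x < min r s"
    using r(1) s(1) unfolding eventually_nhds_metric by (intro exI[of _ "min r s"]) auto
  ultimately have "\<forall>\<^sub>F x in nhds 0. cmod (h x - h 0 - P x) \<le> (\<Sum>i\<in>UNIV. \<bar>C i\<bar>) * norm x ^ Suc N"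
    by (rule eventually_mono[rotated])
  then show ?case using P by blast
qed

section \<open>Unimodular completion and monomial maps\<close>

text \<open>Euclid's algorithm: subtracting one nonzero entry of \<open>m\<close> from an entry at
  least as large is an elementary column operation, undone on the matrix afterwards. When no such
  pair is left, gcd 1 leaves a single entry 1, and a permutation matrix does.\<close>

lemma unimodular_completion_aux:
  fixes m :: "'a \<Rightarrow> nat"
  assumes "finite I" "Gcd (m ` I) = 1" "p \<in> I"
  shows "\<exists>P Q :: 'a \<Rightarrow> 'a \<Rightarrow> int. (\<forall>i\<in>I. P p i = int (m i)) \<and>
    (\<forall>i\<in>I. \<forall>j\<in>I. (\<Sum>k\<in>I. P i k * Q k j) = (if i = j then 1 else 0)) \<and>
    (\<forall>i\<in>I. \<forall>j\<in>I. (\<Sum>k\<in>I. Q i k * P k j) = (if i = j then 1 else 0))"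
  using assms(2)
proof (induction "\<Sum>i\<in>I. m i" arbitrary: m rule: less_induct)
  case less
  note fin = assms(1)
  show ?case
  proof (cases "\<exists>i\<in>I. \<exists>j\<in>I. i \<noteq> j \<and> 0 < m i \<and> m i \<le> m j")
    case True
    then obtain i j where ij: "i \<in> I" "j \<in> I" "i \<noteq> j" "0 < m i" "m i \<le> m j" by blast
    define m' where "m' = m(j := m j - m i)"
    have "(\<Sum>i\<in>I. m' i) < (\<Sum>i\<in>I. m i)"
      using ij fin by (intro sum_strict_mono_ex1) (auto simp: m'_def)
    moreover have "Gcd (m' ` I) = 1"
    proof -
      have "Gcd (m' ` I) dvd m k" if k: "k \<in> I" for k
      proof (cases "k = j")
        case True
        have "Gcd (m' ` I) dvd m' j" "Gcd (m' ` I) dvd m' i" using ij by (auto intro: Gcd_dvd)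
        then have "Gcd (m' ` I) dvd m' j + m' i" by (rule dvd_add)
        then show ?thesis using ij True by (simp add: m'_def)
      next
        case False
        have "Gcd (m' ` I) dvd m' k" using k by (auto intro: Gcd_dvd)
        then show ?thesis using False by (simp add: m'_def)
      qed
      then have "Gcd (m' ` I) dvd Gcd (m ` I)" by (auto intro: Gcd_greatest)
      then show ?thesis using less.prems by simp
    qed
    ultimately obtain P Q :: "'a \<Rightarrow> 'a \<Rightarrow> int" where PQ: "\<forall>i\<in>I. P p i = int (m' i)"
      "\<forall>i\<in>I. \<forall>j\<in>I. (\<Sum>k\<in>I. P i k * Q k j) = (if i = j then 1 else 0)"
      "\<forall>i\<in>I. \<forall>j\<in>I. (\<Sum>k\<in>I. Q i k * P k j) = (if i = j then 1 else 0)"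
      using less.hyps[of m'] by blast
    \<comment> \<open>Column \<open>j\<close> of \<open>P\<close> gains column \<open>i\<close>;
      accordingly row \<open>i\<close> of the inverse loses row \<open>j\<close>.\<close>
    define P' where "P' = (\<lambda>l k. P l k + (if k = j then P l i else 0))"
    define Q' where "Q' = (\<lambda>k l. Q k l - (if k = i then Q j l else 0))"
    have sj: "(\<Sum>k\<in>I. (if k = j then a else 0) * b k) = a * b j"
      and si: "(\<Sum>k\<in>I. b k * (if k = i then a else 0)) = b i * a" for a :: int and b
      using ij fin by (simp_all add: if_distrib if_distribR sum.delta cong: if_cong)
    have 1: "P' p k = int (m k)" if "k \<in> I" for k
      using PQ(1) ij that by (auto simp: P'_def m'_def of_nat_diff)
    have 2: "(\<Sum>k\<in>I. P' l k * Q' k l') = (\<Sum>k\<in>I. P l k * Q k l')" for l l'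
    proof -
      have "P' l k * Q' k l' = P l k * Q k l' + (if k = j then P l i else 0) * Q k l' - P l k * (if k = i then Q j l' else 0)" for k
        using ij by (auto simp: P'_def Q'_def algebra_simps)
      then show ?thesis by (simp add: sum.distrib sum_subtractf sj si)
    qed
    have 3: "(\<Sum>k\<in>I. Q' l k * P' k l') = (if l = l' then 1 else 0)" if "l \<in> I" "l' \<in> I" for l l'
    proof -
      have "(\<Sum>k\<in>I. Q' l k * P' k l') = (\<Sum>k\<in>I. Q l k * P k l') + (if l' = j then (\<Sum>k\<in>I. Q l k * P k i) else 0)
         - (if l = i then (\<Sum>k\<in>I. Q j k * P k l') else 0) - (if l = i \<and> l' = j then (\<Sum>k\<in>I. Q j k * P k i) else 0)"
        by (auto simp: Q'_def P'_def sum.distrib sum_subtractf algebra_simps)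
      then show ?thesis using PQ(3) that ij by auto
    qed
    show ?thesis by (rule exI[of _ P'], rule exI[of _ Q']) (use 1 2 3 PQ(2) in auto)
  next
    case False
    have "\<exists>i\<in>I. m i > 0"
    proof (rule ccontr)
      assume "\<not> (\<exists>i\<in>I. m i > 0)"
      then have "m ` I = {0}" using assms(3) by auto
      then show False using less.prems by simp
    qed
    then obtain i where i: "i \<in> I" "m i > 0" by blast
    have m0: "m j = 0" if "j \<in> I" "j \<noteq> i" for j
      using False i that by (metis linorder_le_cases not_gr_zero)
    have "m i dvd Gcd (m ` I)" by (rule Gcd_greatest) (use m0 in \<open>force\<close>)
    then have mi: "m i = 1" using less.prems by simp
    \<comment> \<open>A transposition is its own inverse, so its matrix serves as both
      \<open>P\<close> and \<open>Q\<close>.\<close>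
    define s where "s = Transposition.transpose p i"
    have s: "s k \<in> I \<longleftrightarrow> k \<in> I" "s (s k) = k" for k using i assms(3)
      by (auto simp: s_def Transposition.transpose_def)
    define P :: "'a \<Rightarrow> 'a \<Rightarrow> int" where "P = (\<lambda>l k. if k = s l then 1 else 0)"
    have "P p k = int (m k)" if "k \<in> I" for k
      using m0[OF that] mi by (auto simp: P_def s_def)
    moreover have "(\<Sum>k\<in>I. P l k * P k l') = (if l = l' then 1 else 0)" if "l \<in> I" "l' \<in> I" for l l'
    proof -
      have "(\<Sum>k\<in>I. P l k * P k l') = (\<Sum>k\<in>I. if k = s l then P (s l) l' else 0)"
        by (intro sum.cong) (auto simp: P_def)
      also have "\<dots> = P (s l) l'" using s(1)[of l] that fin by simp
      finally show ?thesis using s(2)[of l] by (auto simp: P_def)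
    qed
    ultimately show ?thesis by (intro exI[of _ P]) auto
  qed
qed

text \<open>The columns outside \<open>I\<close> and the rows outside \<open>J\<close> carry a permutation matrix; the sign conditions
  make the monomial maps of \<open>P\<close> and \<open>Q\<close> inverse to each other also where coordinates vanish.\<close>

lemma unimodular_completion:
  fixes m :: "'n::finite \<Rightarrow> nat"
  assumes gcd: "Gcd (range m) = 1" and p: "p \<in> J" and I: "I = {i. m i \<noteq> 0}" and card: "card I = card J"
  shows "\<exists>P Q :: 'n \<Rightarrow> 'n \<Rightarrow> int. (\<forall>i. P p i = int (m i)) \<and>
    (\<forall>i j. (\<Sum>k\<in>UNIV. P i k * Q k j) = (if i = j then 1 else 0)) \<and>
    (\<forall>i j. (\<Sum>k\<in>UNIV. Q i k * P k j) = (if i = j then 1 else 0)) \<and>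
    (\<forall>l. l \<notin> J \<longrightarrow> (\<forall>i. Q i l \<ge> 0 \<and> (\<forall>l'. P l' i * Q i l \<ge> 0))) \<and>
    (\<forall>i. i \<notin> I \<longrightarrow> (\<forall>l. P l i \<ge> 0 \<and> (\<forall>i'. Q i' l * P l i \<ge> 0))) \<and>
    (\<forall>l\<in>J. \<forall>i. i \<notin> I \<longrightarrow> P l i = 0)"
proof -
  have "Gcd (m ` I) = 1"
  proof -
    have "Gcd (m ` I) dvd m k" for k by (cases "k \<in> I") (auto simp: I intro: Gcd_dvd)
    then have "Gcd (m ` I) dvd Gcd (range m)" by (auto intro: Gcd_greatest)
    then show ?thesis using gcd by simp
  qed
  have "card (- I) = card (- J)" using card by (simp add: Compl_eq_Diff_UNIV card_Diff_subset)
  then obtain g where g: "bij_betw g (- J) (- I)" using finite_same_card_bij[of "- J" "- I"] by auto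
  have "card J > 0" using p by (simp add: card_gt_0_iff) auto
  obtain g0 where g0: "bij_betw g0 J I" using finite_same_card_bij[of J I] card by auto
  \<comment> \<open>Relabels rows so that the block carrying \<open>m\<close>, whose rows and
    columns are indexed by \<open>I\<close>, gets its rows indexed by \<open>J\<close>; the identity
    block on the complement becomes a permutation matrix.\<close>
  define \<tau> where "\<tau> = (\<lambda>l. if l \<in> J then g0 l else g l)"
  have "bij_betw \<tau> J I" using g0 by (auto simp: \<tau>_def cong: bij_betw_cong)
  moreover have "bij_betw \<tau> (-J) (-I)"
    using g by (subst bij_betw_cong[of _ _ g]) (auto simp: \<tau>_def)
  ultimately have \<tau>: "bij \<tau>" using bij_betw_combine[of \<tau> J I "-J" "-I"] by (simp add: Compl_partition)
  have \<tau>I: "\<tau> l \<in> I \<longleftrightarrow> l \<in> J" for l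
    using \<open>bij_betw \<tau> J I\<close> \<open>bij_betw \<tau> (-J) (-I)\<close> unfolding bij_betw_def by blast
  obtain P Q :: "'n \<Rightarrow> 'n \<Rightarrow> int" where PQ: "\<forall>i\<in>I. P (\<tau> p) i = int (m i)"
    "\<forall>i\<in>I. \<forall>j\<in>I. (\<Sum>k\<in>I. P i k * Q k j) = (if i = j then 1 else 0)"
    "\<forall>i\<in>I. \<forall>j\<in>I. (\<Sum>k\<in>I. Q i k * P k j) = (if i = j then 1 else 0)"
    using unimodular_completion_aux[of I m "\<tau> p"] \<open>Gcd (m ` I) = 1\<close> p \<tau>I by auto
  define P0 where "P0 = (\<lambda>i j. if i \<in> I \<and> j \<in> I then P i j else if i = j then 1 else 0)"
  define Q0 where "Q0 = (\<lambda>i j. if i \<in> I \<and> j \<in> I then Q i j else if i = j then 1 else 0)"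
  have mul: "(\<Sum>k\<in>UNIV. A0 i k * B0 k j) = (if i = j then 1 else 0)"
    if A0: "A0 = (\<lambda>i j. if i \<in> I \<and> j \<in> I then A i j else if i = j then 1 else 0)"
    and B0: "B0 = (\<lambda>i j. if i \<in> I \<and> j \<in> I then B i j else if i = j then 1 else 0)"
    and AB: "\<forall>i\<in>I. \<forall>j\<in>I. (\<Sum>k\<in>I. A i k * B k j) = (if i = j then 1 else 0)" for A B A0 B0 :: "'n \<Rightarrow> 'n \<Rightarrow> int" and i j
  proof (cases "i \<in> I")
    case True
    have "(\<Sum>k\<in>UNIV. A0 i k * B0 k j) = (\<Sum>k\<in>I. A0 i k * B0 k j)"
      using True by (intro sum.mono_neutral_right) (auto simp: A0)
    also have "\<dots> = (if j \<in> I then \<Sum>k\<in>I. A i k * B k j else 0)"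
      using True by (auto simp: A0 B0 intro!: sum.cong sum.neutral)
    finally show ?thesis using AB True by auto
  next
    case False
    have "(\<Sum>k\<in>UNIV. A0 i k * B0 k j) = (\<Sum>k\<in>UNIV. if k = i then B0 i j else 0)"
      using False by (intro sum.cong) (auto simp: A0)
    then show ?thesis using False by (auto simp: B0)
  qed
  define P1 where "P1 = (\<lambda>l i. P0 (\<tau> l) i)"
  define Q1 where "Q1 = (\<lambda>i l. Q0 i (\<tau> l))"
  have "P1 p i = int (m i)" for i using PQ(1) p \<tau>I[of p] by (auto simp: P1_def P0_def I)
  moreover have "(\<Sum>k\<in>UNIV. P1 i k * Q1 k j) = (if i = j then 1 else 0)" for i j
    using mul[OF P0_def Q0_def PQ(2), of "\<tau> i" "\<tau> j"] bij_is_inj[OF \<tau>] by (simp add: P1_def Q1_def inj_eq)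
  moreover have "(\<Sum>k\<in>UNIV. Q1 i k * P1 k j) = (if i = j then 1 else 0)" for i j
    using mul[OF Q0_def P0_def PQ(3), of i j] sum.reindex_bij_betw[OF \<tau>, of "\<lambda>k. Q0 i k * P0 k j"]
    by (simp add: P1_def Q1_def)
  moreover have "Q1 i l \<ge> 0 \<and> P1 l' i * Q1 i l \<ge> 0" if "l \<notin> J" for i l l'
    using that \<tau>I[of l] by (auto simp: P1_def Q1_def P0_def Q0_def)
  moreover have "P1 l i \<ge> 0 \<and> Q1 i' l * P1 l i \<ge> 0" if "i \<notin> I" for i i' l
    using that by (auto simp: P1_def Q1_def P0_def Q0_def)
  moreover have "P1 l i = 0" if "l \<in> J" "i \<notin> I" for l i
    using that \<tau>I[of l] by (auto simp: P1_def P0_def)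
  ultimately have "(\<forall>i. P1 p i = int (m i)) \<and>
    (\<forall>i j. (\<Sum>k\<in>UNIV. P1 i k * Q1 k j) = (if i = j then 1 else 0)) \<and>
    (\<forall>i j. (\<Sum>k\<in>UNIV. Q1 i k * P1 k j) = (if i = j then 1 else 0)) \<and>
    (\<forall>l. l \<notin> J \<longrightarrow> (\<forall>i. Q1 i l \<ge> 0 \<and> (\<forall>l'. P1 l' i * Q1 i l \<ge> 0))) \<and>
    (\<forall>i. i \<notin> I \<longrightarrow> (\<forall>l. P1 l i \<ge> 0 \<and> (\<forall>i'. Q1 i' l * P1 l i \<ge> 0))) \<and>
    (\<forall>l\<in>J. \<forall>i. i \<notin> I \<longrightarrow> P1 l i = 0)"
    by simp
  then show ?thesis by (rule_tac exI, rule_tac exI, assumption)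
qed

section \<open>Laurent monomials\<close>

definition lmono :: "('n::finite \<Rightarrow> int) \<Rightarrow> complex ^ 'n \<Rightarrow> complex" where
  "lmono q x = (\<Prod>i\<in>UNIV. x $ i powi q i)"

text \<open>At 0 a negative power is 0 by convention, so exponents add only if cancellation is
  excluded: \<open>0 powi 1 * 0 powi (-1)\<close> is 0, whereas \<open>0 powi 0\<close> is
  1.\<close>

lemma prod_powi_eq:
  assumes "finite S" "(x::complex) \<noteq> 0 \<or> (\<forall>k\<in>S. g k \<ge> 0)"
  shows "(\<Prod>k\<in>S. x powi g k) = x powi (\<Sum>k\<in>S. g k)"
  using assms
proof (induction S rule: finite_induct)
  case (insert k S)
  have "x powi (g k + sum g S) = x powi g k * x powi (sum g S)"
  proof (cases "x = 0")
    case True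
    then have "g k \<ge> 0" "sum g S \<ge> 0" using insert by (auto intro: sum_nonneg)
    then show ?thesis using True by (auto simp: power_int_0_left_if)
  qed (simp add: power_int_add)
  then show ?case using insert by auto
qed simp

lemma prod_powi_distrib: "(\<Prod>k\<in>S. g k) powi n = (\<Prod>k\<in>S. (g k :: complex) powi n)"
  by (induction S rule: infinite_finite_induct) (auto simp: power_int_mult_distrib)

text \<open>Substitution of monomials multiplies exponent matrices. The sign condition at vanishing
  coordinates rules out that a zero and its formal inverse cancel.\<close>

lemma lmono_inverse:
  fixes P Q :: "'n::finite \<Rightarrow> 'n \<Rightarrow> int"
  assumes PQ: "\<And>i j. (\<Sum>k\<in>UNIV. P i k * Q k j) = (if i = j then 1 else 0)"
    and x: "\<And>l. x $ l \<noteq> 0 \<or> (\<forall>i k. P i k * Q k l \<ge> 0)"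
  shows "lmono (P j) (\<chi> i. lmono (Q i) x) = x $ j"
proof -
  have "lmono (P j) (\<chi> i. lmono (Q i) x) = (\<Prod>k\<in>UNIV. \<Prod>l\<in>UNIV. x $ l powi (Q k l * P j k))"
    by (simp add: lmono_def prod_powi_distrib power_int_mult)
  also have "\<dots> = (\<Prod>l\<in>UNIV. \<Prod>k\<in>UNIV. x $ l powi (P j k * Q k l))"
    by (subst prod.swap) (simp add: mult.commute)
  also have "\<dots> = (\<Prod>l\<in>UNIV. x $ l powi (\<Sum>k\<in>UNIV. P j k * Q k l))"
    using x by (intro prod.cong prod_powi_eq) auto
  also have "\<dots> = (\<Prod>l\<in>UNIV. if l = j then x $ j else 1)"
    by (intro prod.cong) (auto simp: PQ)
  finally show ?thesis by simp
qed

lemma lmono_mult: "lmono q (\<chi> i. x $ i * y $ i) = lmono q x * lmono q y"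
  by (simp add: lmono_def power_int_mult_distrib prod.distrib)

lemma lmono_exp: "lmono q (\<chi> i. exp (c i)) = exp (\<Sum>i\<in>UNIV. of_int (q i) * c i)"
proof -
  have "exp (z :: complex) powi k = exp (of_int k * z)" for z k
    by (cases k rule: int_cases4)
      (auto simp: power_int_minus exp_of_nat_mult[symmetric] exp_minus)
  then show ?thesis by (simp add: lmono_def exp_sum)
qed

lemma holo_at_lmono: "(\<And>i. x $ i \<noteq> 0 \<or> q i \<ge> 0) \<Longrightarrow> holo_at (lmono q) x"
  unfolding lmono_def by (intro holo_at_prod holo_at_powi holo_at_nth) auto

lemma lmono_nonzero: "(\<And>i. x $ i \<noteq> 0 \<or> q i = 0) \<Longrightarrow> lmono q x \<noteq> 0"
  by (auto simp: lmono_def)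

lemma lmono_axis: "lmono (\<lambda>j. if j = i then 1 else 0) x = x $ i"
proof -
  have "lmono (\<lambda>j. if j = i then 1 else 0) x = (\<Prod>j\<in>UNIV. if j = i then x $ i else 1)"
    unfolding lmono_def by (intro prod.cong) auto
  then show ?thesis by simp
qed

lemma lmono_of_nat: "lmono (\<lambda>i. int (k $ i)) x = monom_power x k"
  by (simp add: lmono_def monom_power_def)

section \<open>The dynamics in one step\<close>

definition Sect :: "complex set" where "Sect = {z. Re z + \<bar>Im z\<bar> > 0}"

text \<open>A size function on the sector which grows by a fixed amount under translations close to 1.\<close>

definition sgauge :: "complex \<Rightarrow> real" where "sgauge z = Re z + 2 * \<bar>Im z\<bar>"

text \<open>The gauge is comparable to the modulus on the sector, and may thus replace it in all
  power estimates.\<close>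

lemma Sect_sgauge:
  assumes "z \<in> Sect"
  shows "sgauge z > 0" "cmod z \<le> 2 * sgauge z" "sgauge z \<le> 3 * cmod z" "z \<noteq> 0" "z \<notin> \<real>\<^sub>\<le>\<^sub>0"
proof -
  have "cmod z \<le> \<bar>Re z\<bar> + \<bar>Im z\<bar>" by (rule cmod_le)
  then show "sgauge z > 0" "cmod z \<le> 2 * sgauge z" using assms by (auto simp: Sect_def sgauge_def)
  show "sgauge z \<le> 3 * cmod z" using abs_Re_le_cmod[of z] abs_Im_le_cmod[of z] by (simp add: sgauge_def)
  show "z \<noteq> 0" "z \<notin> \<real>\<^sub>\<le>\<^sub>0" using assms by (auto simp: Sect_def complex_nonpos_Reals_iff)
qed

text \<open>Only the error \<open>w\<close> can lower the terms: Re changes by at least 1 - 1/8 and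
  |Im| by at least -1/8, a total gain of at least 5/8 in the gauge.\<close>

lemma Sect_add:
  assumes "z \<in> Sect" "cmod w \<le> 1/8"
  shows "z + 1 + w \<in> Sect" "sgauge (z + 1 + w) \<ge> sgauge z + 1/2"
proof -
  define s t where "s = \<bar>Im z + Im w\<bar>" and "t = \<bar>Im z\<bar>"
  have "\<bar>Re w\<bar> \<le> 1/8" "\<bar>Im w\<bar> \<le> 1/8" "Re z + t > 0"
    using assms abs_Re_le_cmod[of w] abs_Im_le_cmod[of w] by (auto simp: Sect_def t_def)
  moreover from this have "t \<le> s + 1/8" "Re w \<ge> -1/8" unfolding s_def t_def by linarith+
  ultimately have "Re z + 1 + Re w + s > 0" "Re z + 1 + Re w + 2 * s \<ge> Re z + 2 * t + 1/2"
    by linarith+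
  then show "z + 1 + w \<in> Sect" "sgauge (z + 1 + w) \<ge> sgauge z + 1/2" by (simp_all add: Sect_def sgauge_def s_def t_def)
qed

lemma open_Sect: "open Sect"
  unfolding Sect_def by (intro open_Collect_less continuous_intros)

text \<open>Each half of the sector is turned into the right half plane by a rotation through
  \<pi>/4. The margin of \<pi>/4 to the branch cut later allows splitting the logarithm of a product
  with a factor near 1.\<close>

lemma Sect_Ln: assumes "z \<in> Sect" shows "\<bar>Im (Ln z)\<bar> < 3 * pi / 4"
proof -
  have aux: "\<bar>Im (Ln z)\<bar> < 3 * pi / 4" if "Re (z / exp (\<i> * of_real \<theta>)) > 0" "\<bar>\<theta>\<bar> = pi/4" for \<theta>
  proof -
    define w where "w = z / exp (\<i> * of_real \<theta>)"
    have Rew: "Re w > 0" using that(1) by (simp add: w_def)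
    then have w: "w \<noteq> 0" by auto
    with Rew have w: "\<bar>Im (Ln w)\<bar> < pi / 2" "w \<noteq> 0" using Re_Ln_pos_lt[of w] by blast+
    have "Ln z = \<i> * of_real \<theta> + Ln w"
    proof (rule Ln_unique)
      show "exp (\<i> * of_real \<theta> + Ln w) = z" using w(2) by (simp add: exp_add w_def)
    qed (use w that(2) in \<open>auto simp: abs_if split: if_splits\<close>)
    then show ?thesis using w that(2) by (auto simp: abs_if split: if_splits)
  qed
  show ?thesis
  proof (cases "Im z \<ge> 0")
    case True
    have eq: "\<i> * complex_of_real (- pi/4) = - (\<i> * of_real (pi/4))" by simp
    have "z / exp (\<i> * of_real (pi/4)) = z * exp (\<i> * of_real (- pi/4))"
      unfolding eq exp_minus by (rule divide_inverse)
    also have "Re \<dots> = (Re z + Im z) * (sqrt 2 / 2)"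
      by (simp add: Re_exp Im_exp cos_45 sin_45 cos_minus sin_minus algebra_simps)
    finally have "Re (z / exp (\<i> * of_real (pi/4))) = (Re z + Im z) * (sqrt 2 / 2)" .
    moreover have "(Re z + Im z) * (sqrt 2 / 2) > 0" using assms True by (simp add: Sect_def)
    ultimately have "Re (z / exp (\<i> * of_real (pi/4))) > 0" by (simp only:)
    then show ?thesis by (rule aux) simp
  next
    case False
    have eq: "\<i> * complex_of_real (pi/4) = - (\<i> * of_real (- pi/4))" by simp
    have "z / exp (\<i> * of_real (- pi/4)) = z * exp (\<i> * of_real (pi/4))"
      unfolding eq exp_minus by (rule divide_inverse)
    also have "Re \<dots> = (Re z - Im z) * (sqrt 2 / 2)"
      by (simp add: Re_exp Im_exp cos_45 sin_45 algebra_simps)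
    finally have "Re (z / exp (\<i> * of_real (- pi/4))) = (Re z - Im z) * (sqrt 2 / 2)" .
    moreover have "(Re z - Im z) * (sqrt 2 / 2) > 0" using assms False by (simp add: Sect_def)
    ultimately have "Re (z / exp (\<i> * of_real (- pi/4))) > 0" by (simp only:)
    then show ?thesis by (rule aux) simp
  qed
qed

text \<open>The domain and the image of \<open>f\<close> are parameters, so that the inverse germ
  becomes an instance with \<open>U\<close> and \<open>V\<close> exchanged.\<close>

locale parabolic_germ =
  fixes f :: "complex ^ 'n \<Rightarrow> complex ^ 'n" and U V :: "(complex ^ 'n) set"
    and A :: "'n \<Rightarrow> complex ^ 'n \<Rightarrow> complex" and a :: "complex ^ 'n" and M :: "nat ^ 'n"
  assumes f_bihol: "biholomorphism f U V" and U0: "0 \<in> U" and f0: "f 0 = 0"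
    and f_form: "\<forall>\<^sub>F x in nhds 0. \<forall>i. f x $ i = x $ i * (1 + monom_power x M * (a $ i + A i x))"
    and A: "\<And>i. holomorphic_germ0 (A i)"
    and aM: "pairing a M \<noteq> 0"
    and Re_pos: "\<And>i. Re (a $ i / pairing a M) > 0"
begin

definition b :: complex where "b = pairing a M"
definition u :: "complex ^ 'n \<Rightarrow> complex" where "u x = monom_power x M"
definition zc :: "complex ^ 'n \<Rightarrow> complex" where "zc x = - 1 / (b * u x)"
definition \<alpha> :: "'n \<Rightarrow> complex" where "\<alpha> i = a $ i / b"
definition \<beta> :: "'n \<Rightarrow> real" where "\<beta> i = Re (\<alpha> i)"
definition SD :: "(complex ^ 'n) set" where "SD = {x. u x \<noteq> 0 \<and> zc x \<in> Sect}"
definition c :: "'n \<Rightarrow> complex ^ 'n \<Rightarrow> complex" where "c i x = a $ i + A i x"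
definition G :: "complex ^ 'n \<Rightarrow> real" where "G x = sgauge (zc x)"

lemma b0: "b \<noteq> 0" using aM by (simp add: b_def)

lemma beta_pos: "\<beta> i > 0" using Re_pos by (simp add: \<beta>_def \<alpha>_def b_def)

lemma b_alpha: "b * \<alpha> i = a $ i" using b0 by (simp add: \<alpha>_def)

lemma M0: "M \<noteq> 0" using aM by (auto simp: pairing_def)

lemma u_0: "u 0 = 0" using M0 by (simp add: u_def monom_power_at_0)

lemma hgerm_u: "hgerm u" unfolding u_def[abs_def] by simp

lemma hgerm_c: "hgerm (c i)"
proof -
  have "hgerm (A i)" using A[of i] by (auto simp: holomorphic_germ0_def hgerm_iff)
  then show ?thesis unfolding c_def[abs_def] by (intro hgerm_add) auto
qed

lemma c_0: "c i 0 = a $ i" using A[of i] by (simp add: c_def holomorphic_germ0_def)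

lemma f_eq: "\<forall>\<^sub>F x in nhds 0. \<forall>i. f x $ i = x $ i * (1 + u x * c i x)"
  using f_form by (simp add: u_def c_def)

lemma zero_notin_SD: "0 \<notin> SD" by (simp add: SD_def u_0)

lemma eventually_SD: "\<forall>\<^sub>F x in nhds 0. P x \<Longrightarrow> \<forall>\<^sub>F x in at 0 within SD. x \<in> SD \<and> P x"
  by (auto simp: eventually_at_filter elim: eventually_mono)

lemma SD_zc: "x \<in> SD \<Longrightarrow> zc x \<in> Sect" "x \<in> SD \<Longrightarrow> u x \<noteq> 0"
  by (auto simp: SD_def)

lemma u_zc: "u x \<noteq> 0 \<Longrightarrow> u x = - 1 / (b * zc x)"
  using b0 by (simp add: zc_def)

text \<open>\<open>s\<close> is the coefficient of \<open>u\<close> to first order: additive under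
  products, and multiplied by the derivative at 1 when a function fixing 1 is applied.\<close>

definition unit_germ :: "(complex ^ 'n \<Rightarrow> complex) \<Rightarrow> complex \<Rightarrow> bool" where
  "unit_germ \<gamma> s \<longleftrightarrow> (\<exists>H. hgerm H \<and> H 0 = s \<and> (\<forall>\<^sub>F x in nhds 0. \<gamma> x = 1 + u x * H x))"

lemma unit_germ_mult:
  assumes "unit_germ \<gamma> s" "unit_germ \<gamma>' s'"
  shows "unit_germ (\<lambda>x. \<gamma> x * \<gamma>' x) (s + s')"
proof -
  obtain H where H: "hgerm H" "H 0 = s" "\<forall>\<^sub>F x in nhds 0. \<gamma> x = 1 + u x * H x"
    using assms(1) by (auto simp: unit_germ_def)
  obtain H' where H': "hgerm H'" "H' 0 = s'" "\<forall>\<^sub>F x in nhds 0. \<gamma>' x = 1 + u x * H' x"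
    using assms(2) by (auto simp: unit_germ_def)
  have "hgerm (\<lambda>x. H x + H' x + u x * (H x * H' x))"
    by (intro hgerm_add hgerm_mult H H' hgerm_u)
  moreover have "\<forall>\<^sub>F x in nhds 0. \<gamma> x * \<gamma>' x = 1 + u x * (H x + H' x + u x * (H x * H' x))"
    using H(3) H'(3) by eventually_elim (simp add: algebra_simps)
  ultimately show ?thesis unfolding unit_germ_def using H(2) H'(2) u_0
    by (intro exI[of _ "\<lambda>x. H x + H' x + u x * (H x * H' x)"]) auto
qed

lemma unit_germ_1: "unit_germ (\<lambda>_. 1) 0"
  unfolding unit_germ_def by (intro exI[of _ "\<lambda>_. 0"]) auto

lemma unit_germ_prod:
  "(\<And>i. i \<in> I \<Longrightarrow> unit_germ (\<gamma> i) (s i)) \<Longrightarrow> unit_germ (\<lambda>x. \<Prod>i\<in>I. \<gamma> i x) (\<Sum>i\<in>I. s i)"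
  by (induction I rule: infinite_finite_induct) (auto intro: unit_germ_mult unit_germ_1)

lemma unit_germ_compose:
  assumes g: "unit_germ \<gamma> s" and T: "open T" "1 \<in> T" and hol: "\<phi> holomorphic_on T"
    and \<phi>: "\<phi> 1 = 1" "(\<phi> has_field_derivative D) (at 1)"
  shows "unit_germ (\<lambda>x. \<phi> (\<gamma> x)) (D * s)"
proof -
  obtain H where H: "hgerm H" "H 0 = s" "\<forall>\<^sub>F x in nhds 0. \<gamma> x = 1 + u x * H x"
    using g by (auto simp: unit_germ_def)
  \<comment> \<open>The difference quotient of \<phi> at 1, holomorphic by removal of the
    singularity; it extracts the factor \<open>u x * H x\<close> from
    \<open>\<phi> (\<gamma> x) - 1\<close>.\<close>
  define \<psi> where "\<psi> = (\<lambda>z. if z = 1 then deriv \<phi> 1 else (\<phi> z - \<phi> 1) / (z - 1))"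
  have \<psi>: "\<psi> holomorphic_on T" "\<psi> 1 = D" "\<phi> w = 1 + (w - 1) * \<psi> w" for w
    using pole_lemma_open[OF hol T(1), of 1] DERIV_imp_deriv[OF \<phi>(2)] \<phi>(1) by (auto simp: \<psi>_def)
  have "hgerm (\<lambda>x. \<psi> (1 + u x * H x))"
    by (rule hgerm_compose1[OF _ T(1) _ \<psi>(1)]) (auto simp: u_0 T intro!: hgerm_add hgerm_mult hgerm_u H)
  then have "hgerm (\<lambda>x. H x * \<psi> (1 + u x * H x))" using H(1) by (intro hgerm_mult)
  moreover have "\<forall>\<^sub>F x in nhds 0. \<phi> (\<gamma> x) = 1 + u x * (H x * \<psi> (1 + u x * H x))"
    using H(3)
  proof eventually_elim
    case (elim x)
    then show ?case using \<psi>(3)[of "\<gamma> x"] by simp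
  qed
  ultimately show ?thesis unfolding unit_germ_def using H(2) u_0 \<psi>(2)
    by (intro exI[of _ "\<lambda>x. H x * \<psi> (1 + u x * H x)"]) auto
qed

lemma unit_germ_tendsto: assumes "unit_germ \<gamma> s" shows "(\<gamma> \<longlongrightarrow> 1) (nhds 0)"
proof -
  obtain H where H: "hgerm H" "\<forall>\<^sub>F x in nhds 0. \<gamma> x = 1 + u x * H x"
    using assms by (auto simp: unit_germ_def)
  have "((\<lambda>x. 1 + u x * H x) \<longlongrightarrow> 1 + u 0 * H 0) (nhds 0)"
    using H(1) hgerm_u by (intro tendsto_intros hgerm_tendsto)
  then show ?thesis using H(2) u_0 by (simp add: tendsto_cong)
qed

text \<open>The factor by which one step of \<open>f\<close> multiplies the Laurent monomial with
  exponents \<open>q\<close>.\<close>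

definition \<gamma> :: "('n \<Rightarrow> int) \<Rightarrow> complex ^ 'n \<Rightarrow> complex" where
  "\<gamma> q x = (\<Prod>i\<in>UNIV. (1 + u x * c i x) powi q i)"

definition \<gamma>M :: "complex ^ 'n \<Rightarrow> complex" where "\<gamma>M = \<gamma> (\<lambda>i. int (M $ i))"

lemma unit_germ_\<gamma>: "unit_germ (\<gamma> q) (\<Sum>i\<in>UNIV. of_int (q i) * a $ i)"
  unfolding \<gamma>_def[abs_def]
proof (rule unit_germ_prod)
  fix i
  have "unit_germ (\<lambda>x. 1 + u x * c i x) (a $ i)"
    unfolding unit_germ_def by (intro exI[of _ "c i"] conjI hgerm_c c_0) simp
  then show "unit_germ (\<lambda>x. (1 + u x * c i x) powi q i) (of_int (q i) * a $ i)"
  proof (rule unit_germ_compose[where \<phi> = "\<lambda>w. w powi q i" and T = "- {0}"])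
    show "(\<lambda>w. w powi q i) holomorphic_on - {0::complex}" by (auto intro!: holomorphic_intros)
    show "((\<lambda>w. w powi q i) has_field_derivative of_int (q i)) (at (1::complex))"
      by (auto intro!: derivative_eq_intros)
  qed auto
qed

lemma lmono_f: "\<forall>\<^sub>F x in nhds 0. lmono q (f x) = lmono q x * \<gamma> q x"
  using f_eq
proof eventually_elim
  case (elim x)
  then have "f x = (\<chi> i. x $ i * (1 + u x * c i x))" by (simp add: vec_eq_iff)
  then show ?case using lmono_mult[of q x "\<chi> i. 1 + u x * c i x"] by (simp add: \<gamma>_def lmono_def)
qed

lemma unit_germ_\<gamma>M: "unit_germ \<gamma>M b"
  using unit_germ_\<gamma>[of "\<lambda>i. int (M $ i)"] by (simp add: \<gamma>M_def b_def pairing_def mult.commute)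

lemma u_f: "\<forall>\<^sub>F x in nhds 0. u (f x) = u x * \<gamma>M x"
  using lmono_f[of "\<lambda>i. int (M $ i)"] by (simp add: \<gamma>M_def u_def lmono_of_nat)

lemma unit_germ_nonzero: "unit_germ g s \<Longrightarrow> \<forall>\<^sub>F x in nhds 0. g x \<noteq> 0"
  by (rule tendsto_imp_eventually_ne[OF unit_germ_tendsto]) auto

lemma \<gamma>M_nonzero: "\<forall>\<^sub>F x in nhds 0. \<gamma>M x \<noteq> 0"
  using unit_germ_nonzero unit_germ_\<gamma>M by blast

lemma unit_germ_inverse_\<gamma>M: "unit_germ (\<lambda>x. inverse (\<gamma>M x)) (- b)"
proof -
  have "(inverse has_field_derivative -1) (at (1 :: complex))"
    using DERIV_inverse[of "1 :: complex"] by simp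
  moreover have "inverse holomorphic_on (- {0 :: complex})"
    using holomorphic_on_inverse[OF holomorphic_on_ident, of "- {0 :: complex}"] by auto
  ultimately show ?thesis using unit_germ_compose[OF unit_germ_\<gamma>M, of "- {0}" inverse "-1"] by auto
qed

text \<open>To first order the factor of x^k contributes \<langle>a, k\<rangle> and that of 1/u
  contributes -b. Hence x^k / u can correct a term x^k unless the two cancel, which is the resonant
  case.\<close>

lemma step_monom_over_u:
  "\<exists>H. hgerm H \<and> H 0 = pairing a k - b \<and>
    (\<forall>\<^sub>F x in nhds 0. u x \<noteq> 0 \<longrightarrow> monom_power (f x) k / u (f x) - monom_power x k / u x = monom_power x k * H x)"
proof -
  have "unit_germ (\<lambda>x. \<gamma> (\<lambda>i. int (k $ i)) x * inverse (\<gamma>M x)) (pairing a k + - b)"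
    using unit_germ_mult[OF unit_germ_\<gamma>[of "\<lambda>i. int (k $ i)"] unit_germ_inverse_\<gamma>M]
    by (simp add: pairing_def mult.commute)
  then obtain H where H: "hgerm H" "H 0 = pairing a k - b"
    "\<forall>\<^sub>F x in nhds 0. \<gamma> (\<lambda>i. int (k $ i)) x * inverse (\<gamma>M x) = 1 + u x * H x"
    by (auto simp: unit_germ_def)
  have "\<forall>\<^sub>F x in nhds 0. u x \<noteq> 0 \<longrightarrow> monom_power (f x) k / u (f x) - monom_power x k / u x = monom_power x k * H x"
    using H(3) lmono_f[of "\<lambda>i. int (k $ i)"] u_f \<gamma>M_nonzero
  proof eventually_elim
    case (elim x)
    show ?case
    proof
      assume ux: "u x \<noteq> 0"
      have "monom_power (f x) k / u (f x) = monom_power x k / u x * (\<gamma> (\<lambda>i. int (k $ i)) x * inverse (\<gamma>M x))"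
        using elim by (simp add: lmono_of_nat divide_inverse)
      then show "monom_power (f x) k / u (f x) - monom_power x k / u x = monom_power x k * H x"
        using elim ux by (simp add: field_simps)
    qed
  qed
  then show ?thesis using H by blast
qed

lemma zc_f: "\<forall>\<^sub>F x in nhds 0. zc (f x) = zc x * inverse (\<gamma>M x)"
  using u_f \<gamma>M_nonzero by eventually_elim (simp add: zc_def divide_inverse)

text \<open>1/u is multiplied by 1 + u H with H(0) = -b; since z u = -1/b, this adds -H/b to z, a
  function with value 1 at the origin.\<close>

lemma step_zc:
  "\<exists>B. hgerm B \<and> B 0 = 0 \<and> (\<forall>\<^sub>F x in nhds 0. u x \<noteq> 0 \<longrightarrow> zc (f x) = zc x + 1 + B x)"
proof -
  obtain H where H: "hgerm H" "H 0 = - b" "\<forall>\<^sub>F x in nhds 0. inverse (\<gamma>M x) = 1 + u x * H x"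
    using unit_germ_inverse_\<gamma>M by (auto simp: unit_germ_def)
  define B where "B = (\<lambda>x. - (1/b) * H x - 1)"
  have "hgerm B" unfolding B_def by (intro hgerm_diff hgerm_mult H(1)) auto
  moreover have "B 0 = 0" using H(2) b0 by (simp add: B_def)
  moreover have "\<forall>\<^sub>F x in nhds 0. u x \<noteq> 0 \<longrightarrow> zc (f x) = zc x + 1 + B x"
    using H(3) zc_f
  proof eventually_elim
    case (elim x)
    show ?case
    proof
      assume "u x \<noteq> 0"
      then show "zc (f x) = zc x + 1 + B x" using elim b0 by (simp add: zc_def B_def field_simps)
    qed
  qed
  ultimately show ?thesis by blast
qed

section \<open>One step of the dynamics on the sector\<close>

lemma f_step: "0 < \<epsilon> \<Longrightarrow> \<epsilon> \<le> 1/8 \<Longrightarrow>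
  \<forall>\<^sub>F x in at 0 within SD. x \<in> SD \<and> f x \<in> SD \<and> cmod (zc (f x) - zc x - 1) \<le> \<epsilon> \<and> G (f x) \<ge> G x + 1/2"
proof -
  assume \<epsilon>: "0 < \<epsilon>" "\<epsilon> \<le> 1/8"
  obtain B where B: "hgerm B" "B 0 = 0" "\<forall>\<^sub>F x in nhds 0. u x \<noteq> 0 \<longrightarrow> zc (f x) = zc x + 1 + B x"
    using step_zc by blast
  have "\<forall>\<^sub>F x in nhds 0. dist (B x) 0 < \<epsilon>"
    using tendstoD[OF hgerm_tendsto[OF B(1)] \<epsilon>(1)] B(2) by simp
  then have "\<forall>\<^sub>F x in nhds 0. (u x \<noteq> 0 \<longrightarrow> zc (f x) = zc x + 1 + B x) \<and> dist (B x) 0 < \<epsilon> \<and> u (f x) = u x * \<gamma>M x \<and> \<gamma>M x \<noteq> 0"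
    using B(3) u_f \<gamma>M_nonzero by eventually_elim auto
  from eventually_SD[OF this] show ?thesis
  proof eventually_elim
    case (elim x)
    then have x: "x \<in> SD" "zc (f x) = zc x + 1 + B x" "cmod (B x) < \<epsilon>" "u (f x) \<noteq> 0" using SD_zc by auto
    have "zc (f x) \<in> Sect" "sgauge (zc (f x)) \<ge> sgauge (zc x) + 1/2"
      using Sect_add[OF SD_zc(1)[OF x(1)], of "B x"] x(3) \<epsilon>(2) unfolding x(2) by simp_all
    moreover have "zc (f x) - zc x - 1 = B x" using x(2) by simp
    ultimately show ?case using x(1,3,4) by (simp add: SD_def G_def)
  qed
qed

text \<open>The arguments of z and of the factor near 1 are below 3\<pi>/4 and \<pi>/4, so their sum
  stays below \<pi> and no multiple of 2\<pi> enters.\<close>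

lemma Ln_zc_f: "\<forall>\<^sub>F x in at 0 within SD. Ln (zc (f x)) = Ln (zc x) - Ln (\<gamma>M x)"
proof -
  have "((\<lambda>x. Ln (inverse (\<gamma>M x))) \<longlongrightarrow> Ln 1) (nhds 0)"
    by (intro tendsto_Ln unit_germ_tendsto[OF unit_germ_inverse_\<gamma>M]) auto
  then have "\<forall>\<^sub>F x in nhds 0. dist (Ln (inverse (\<gamma>M x))) (Ln 1) < pi / 4"
    by (rule tendstoD) simp
  moreover have "\<forall>\<^sub>F x in nhds 0. \<gamma>M x \<notin> \<real>\<^sub>\<le>\<^sub>0"
  proof -
    have "open (- \<real>\<^sub>\<le>\<^sub>0 :: complex set)" by (simp add: open_Compl)
    from topological_tendstoD[OF unit_germ_tendsto[OF unit_germ_\<gamma>M] this] show ?thesis by auto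
  qed
  ultimately have "\<forall>\<^sub>F x in nhds 0. dist (Ln (inverse (\<gamma>M x))) (Ln 1) < pi / 4 \<and> zc (f x) = zc x * inverse (\<gamma>M x) \<and> \<gamma>M x \<notin> \<real>\<^sub>\<le>\<^sub>0 \<and> \<gamma>M x \<noteq> 0"
    using zc_f \<gamma>M_nonzero by eventually_elim auto
  from eventually_SD[OF this] show ?thesis
  proof eventually_elim
    case (elim x)
    let ?w = "inverse (\<gamma>M x)"
    have z: "zc x \<noteq> 0" "\<bar>Im (Ln (zc x))\<bar> < 3 * pi / 4" using elim SD_zc Sect_Ln Sect_sgauge(4) by auto
    have w: "\<bar>Im (Ln ?w)\<bar> < pi / 4"
      using elim abs_Im_le_cmod[of "Ln ?w"] by simp
    have "Ln (zc x * ?w) = Ln (zc x) + Ln ?w"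
      using z w elim by (intro Ln_times_simple) auto
    then show ?case using elim Ln_inverse[of "\<gamma>M x"] by simp
  qed
qed

definition lam :: "('n \<Rightarrow> int) \<Rightarrow> complex" where "lam q = (\<Sum>i\<in>UNIV. of_int (q i) * \<alpha> i)"

text \<open>The Laurent monomial with exponents \<open>q\<close> in the functions E_i, written with
  a single power of z.\<close>

definition Y :: "('n \<Rightarrow> int) \<Rightarrow> complex ^ 'n \<Rightarrow> complex" where
  "Y q x = lmono q x * exp (lam q * Ln (zc x))"

text \<open>The first-order coefficients cancel: the monomial contributes the sum of q_i a_i, the
  power of z contributes -b times the sum of q_i \<alpha>_i, and b \<alpha>_i = a_i.\<close>

lemma step_Y:
  "\<exists>H. hgerm H \<and> H 0 = 0 \<and> (\<forall>\<^sub>F x in at 0 within SD. x \<in> SD \<and> Y q (f x) = Y q x * (1 + u x * H x))"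
proof -
  have 1: "unit_germ (\<lambda>x. exp (- lam q * Ln (\<gamma>M x))) (- lam q * b)"
  proof (rule unit_germ_compose[OF unit_germ_\<gamma>M, where T = "- \<real>\<^sub>\<le>\<^sub>0" and \<phi> = "\<lambda>w. exp (- lam q * Ln w)"])
    show "((\<lambda>w. exp (- lam q * Ln w)) has_field_derivative - lam q) (at 1)"
      by (auto intro!: derivative_eq_intros)
  qed (auto intro!: holomorphic_intros simp: open_Compl)
  have "(\<Sum>i\<in>UNIV. of_int (q i) * a $ i) + - lam q * b = 0"
    by (simp add: lam_def sum_distrib_right b_alpha[symmetric] mult.assoc mult.left_commute[of b]) (simp add: mult.commute)
  then have "unit_germ (\<lambda>x. \<gamma> q x * exp (- lam q * Ln (\<gamma>M x))) 0"
    using unit_germ_mult[OF unit_germ_\<gamma>[of q] 1] by simp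
  then obtain H where H: "hgerm H" "H 0 = 0" "\<forall>\<^sub>F x in nhds 0. \<gamma> q x * exp (- lam q * Ln (\<gamma>M x)) = 1 + u x * H x"
    by (auto simp: unit_germ_def)
  from eventually_SD[OF eventually_conj[OF H(3) lmono_f[of q]]] Ln_zc_f
  have "\<forall>\<^sub>F x in at 0 within SD. x \<in> SD \<and> Y q (f x) = Y q x * (1 + u x * H x)"
  proof eventually_elim
    case (elim x)
    then have e: "\<gamma> q x * exp (- lam q * Ln (\<gamma>M x)) = 1 + u x * H x" "lmono q (f x) = lmono q x * \<gamma> q x"
      "Ln (zc (f x)) = Ln (zc x) - Ln (\<gamma>M x)" by blast+
    have "exp (lam q * (Ln (zc x) - Ln (\<gamma>M x))) = exp (lam q * Ln (zc x)) * exp (- lam q * Ln (\<gamma>M x))"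
      by (simp add: exp_add[symmetric] algebra_simps)
    then have "Y q (f x) = lmono q x * \<gamma> q x * (exp (lam q * Ln (zc x)) * exp (- lam q * Ln (\<gamma>M x)))"
      by (simp only: Y_def e(2,3))
    also have "\<dots> = lmono q x * exp (lam q * Ln (zc x)) * (\<gamma> q x * exp (- lam q * Ln (\<gamma>M x)))"
      by (simp only: mult_ac)
    also note e(1)
    finally show ?case using elim by (simp add: Y_def)
  qed
  then show ?thesis using H by blast
qed

lemma step_Ln:
  "\<exists>H. hgerm H \<and> H 0 = - b \<and> (\<forall>\<^sub>F x in at 0 within SD. Ln (zc (f x)) - Ln (zc x) = u x * H x)"
proof -
  \<comment> \<open>The function \<open>1 - Ln w\<close> is used because the outer function must fix
    1.\<close>
  have "unit_germ (\<lambda>x. 1 - Ln (\<gamma>M x)) (-1 * b)"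
  proof (rule unit_germ_compose[OF unit_germ_\<gamma>M, where T = "- \<real>\<^sub>\<le>\<^sub>0" and \<phi> = "\<lambda>w. 1 - Ln w"])
    show "((\<lambda>w. 1 - Ln w) has_field_derivative -1) (at 1)"
      by (auto intro!: derivative_eq_intros)
  qed (auto intro!: holomorphic_intros simp: open_Compl)
  then obtain H where H: "hgerm H" "H 0 = - b" "\<forall>\<^sub>F x in nhds 0. 1 - Ln (\<gamma>M x) = 1 + u x * H x"
    by (auto simp: unit_germ_def)
  have "\<forall>\<^sub>F x in at 0 within SD. Ln (zc (f x)) - Ln (zc x) = u x * H x"
    using Ln_zc_f eventually_SD[OF H(3)]
  proof eventually_elim
    case (elim x)
    then have "Ln (\<gamma>M x) = - (u x * H x)" by (simp add: algebra_simps eq_neg_iff_add_eq_0)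
    with elim show ?case by simp
  qed
  then show ?thesis using H by blast
qed

lemma Y_bound:
  "\<exists>C\<ge>0. \<forall>\<^sub>F x in at 0 within SD. cmod (Y q (f x) - Y q x) \<le> C * cmod (Y q x) * norm x / cmod (zc x)"
proof -
  obtain H where H: "hgerm H" "H 0 = 0" "\<forall>\<^sub>F x in at 0 within SD. x \<in> SD \<and> Y q (f x) = Y q x * (1 + u x * H x)"
    using step_Y by blast
  obtain C where C: "C \<ge> 0" "\<forall>\<^sub>F x in nhds 0. cmod (H x) \<le> C * norm x"
    using hgerm_bound[OF H(1)] H(2) by auto
  have "\<forall>\<^sub>F x in at 0 within SD. cmod (Y q (f x) - Y q x) \<le> (C / cmod b) * cmod (Y q x) * norm x / cmod (zc x)"
    using H(3) eventually_SD[OF C(2)]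
  proof eventually_elim
    case (elim x)
    have "cmod (Y q (f x) - Y q x) = cmod (Y q x) * (cmod (u x) * cmod (H x))"
      using elim by (simp add: algebra_simps norm_mult)
    also have "\<dots> \<le> cmod (Y q x) * (cmod (u x) * (C * norm x))"
      using elim by (intro mult_left_mono) auto
    also have "cmod (u x) = 1 / (cmod b * cmod (zc x))"
      using u_zc[of x] SD_zc(2)[of x] elim by (metis norm_divide norm_minus_cancel norm_mult norm_one)
    finally show ?case by (simp add: field_simps)
  qed
  then show ?thesis using C(1) by (intro exI[of _ "C / cmod b"]) auto
qed

lemma Y_small:
  assumes "\<eta> > 0"
  shows "\<forall>\<^sub>F x in at 0 within SD. cmod (Y q (f x) - Y q x) \<le> \<eta> * cmod (Y q x) / cmod (zc x)"
proof -
  obtain C where C: "C \<ge> 0" "\<forall>\<^sub>F x in at 0 within SD. cmod (Y q (f x) - Y q x) \<le> C * cmod (Y q x) * norm x / cmod (zc x)"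
    using Y_bound by blast
  have "((\<lambda>x :: complex ^ 'n. C * norm x) \<longlongrightarrow> C * norm (0 :: complex ^ 'n)) (at 0 within SD)"
    by (intro tendsto_intros)
  then have "((\<lambda>x :: complex ^ 'n. C * norm x) \<longlongrightarrow> 0) (at 0 within SD)" by simp
  then have "\<forall>\<^sub>F x :: complex ^ 'n in at 0 within SD. C * norm x < \<eta>"
    using assms by (rule order_tendstoD)
  with C(2) show ?thesis
  proof eventually_elim
    case (elim x)
    have "C * norm x * (cmod (Y q x) / cmod (zc x)) \<le> \<eta> * (cmod (Y q x) / cmod (zc x))"
      using elim by (intro mult_right_mono) auto
    with elim(1) show ?case by (simp add: mult_ac)
  qed
qed

end

section \<open>Asymptotic orders and the approximate Fatou coordinate\<close>

context parabolic_germ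
begin

definition \<mu> :: real where "\<mu> = min 1 (Min (range \<beta>))"
text \<open>The solution of (1 - \<kappa>) (1 + \<mu>) = 1 + \<mu>/2. A resonant monomial has order
  -(1 - \<kappa>), and a factor vanishing at 0 adds -\<theta> = -(1 - \<kappa>) \<mu>; the excess
  \<mu>/2 over 1 is 2\<delta>, of which one \<delta> may be spent on a logarithm or on growth of
  Y.\<close>

definition \<kappa> :: real where "\<kappa> = \<mu> / (2 * (1 + \<mu>))"
definition \<delta> :: real where "\<delta> = \<mu> / 4"
definition \<theta> :: real where "\<theta> = (1 - \<kappa>) * \<mu>"
definition \<rho> :: "'n \<Rightarrow> real" where "\<rho> i = (1 - \<kappa>) * \<beta> i"

lemma mu: "0 < \<mu>" "\<mu> \<le> 1" "\<mu> \<le> \<beta> i"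
  using beta_pos by (auto simp: \<mu>_def intro: min.coboundedI2)

lemma kappa: "0 < \<kappa>" "\<kappa> \<le> 1/4" "(1 - \<kappa>) * (1 + \<mu>) = 1 + 2 * \<delta>"
  using mu(1,2) by (auto simp: \<kappa>_def \<delta>_def field_simps power2_eq_square)

lemma delta: "0 < \<delta>" "\<delta> \<le> 1/4" "1 - \<kappa> + \<theta> = 1 + 2 * \<delta>" "2 * \<delta> \<le> \<theta>"
  using mu(1,2) kappa by (auto simp: \<delta>_def \<theta>_def algebra_simps)

lemma rho: "\<theta> \<le> \<rho> i" "0 < \<rho> i"
proof -
  show "\<theta> \<le> \<rho> i" unfolding \<theta>_def \<rho>_def using mu(3)[of i] kappa by (intro mult_left_mono) auto
  then show "0 < \<rho> i" using delta by linarith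
qed

text \<open>In the application \<open>G\<close> grows linearly along an orbit whereas \<open>h\<close> only depends on the initial point.\<close>

definition bnd :: "real \<Rightarrow> (complex ^ 'n \<Rightarrow> complex) \<Rightarrow> bool" where
  "bnd s R \<longleftrightarrow> (\<exists>C\<ge>0. \<exists>n. \<forall>\<^sub>F x in at 0 within SD. \<forall>h\<ge>1. (\<forall>i. cmod (x $ i) \<le> h * G x powr (- \<rho> i)) \<longrightarrow>
     cmod (R x) \<le> C * h ^ n * G x powr s)"

section \<open>Calculus of orders\<close>

lemma G_large: "\<forall>\<^sub>F x in at 0 within SD. x \<in> SD \<and> G x \<ge> K"
proof -
  define K' where "K' = max K 1"
  have "\<forall>\<^sub>F x in nhds 0. dist (u x) 0 < 1 / (2 * cmod b * K')"
    using tendstoD[OF hgerm_tendsto[OF hgerm_u], of "1 / (2 * cmod b * K')"] b0 u_0 by (simp add: K'_def)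
  from eventually_SD[OF this] show ?thesis
  proof eventually_elim
    case (elim x)
    then have x: "x \<in> SD" "u x \<noteq> 0" "cmod (u x) < 1 / (2 * cmod b * K')" using SD_zc by auto
    have "2 * K' \<le> cmod (zc x)" using x(2,3) b0 by (simp add: zc_def norm_divide norm_mult field_simps K'_def)
    also have "\<dots> \<le> 2 * G x" using Sect_sgauge(2) SD_zc(1) x(1) by (auto simp: G_def)
    finally show ?case using x(1) by (simp add: K'_def)
  qed
qed

lemma bndI:
  assumes "C \<ge> 0" "\<forall>\<^sub>F x in at 0 within SD. x \<in> SD \<and> G x \<ge> K \<longrightarrow> cmod (R x) \<le> C * G x powr s"
  shows "bnd s R"
proof -
  have "\<forall>\<^sub>F x in at 0 within SD. \<forall>h\<ge>1. (\<forall>i. cmod (x $ i) \<le> h * G x powr (- \<rho> i)) \<longrightarrow> cmod (R x) \<le> C * h ^ 0 * G x powr s"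
    using assms(2) G_large[of K] by eventually_elim auto
  then show ?thesis using assms(1) unfolding bnd_def by blast
qed

lemma bnd_dominate:
  assumes "bnd s R" "C \<ge> 0" "\<forall>\<^sub>F x in at 0 within SD. cmod (R' x) \<le> C * cmod (R x)"
  shows "bnd s R'"
proof -
  obtain D n where D: "D \<ge> 0" "\<forall>\<^sub>F x in at 0 within SD. \<forall>h\<ge>1. (\<forall>i. cmod (x $ i) \<le> h * G x powr (- \<rho> i)) \<longrightarrow>
     cmod (R x) \<le> D * h ^ n * G x powr s" using assms(1) unfolding bnd_def by blast
  have "\<forall>\<^sub>F x in at 0 within SD. \<forall>h\<ge>1. (\<forall>i. cmod (x $ i) \<le> h * G x powr (- \<rho> i)) \<longrightarrow>
     cmod (R' x) \<le> (C * D) * h ^ n * G x powr s"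
    using D(2) assms(3)
  proof eventually_elim
    case (elim x)
    show ?case
    proof (intro allI impI)
      fix h :: real assume "h \<ge> 1" "\<forall>i. cmod (x $ i) \<le> h * G x powr (- \<rho> i)"
      then have "cmod (R x) \<le> D * h ^ n * G x powr s" using elim(1) by blast
      then have "C * cmod (R x) \<le> C * (D * h ^ n * G x powr s)" using assms(2) by (rule mult_left_mono)
      with elim(2) show "cmod (R' x) \<le> (C * D) * h ^ n * G x powr s" by (simp add: mult.assoc)
    qed
  qed
  moreover have "C * D \<ge> 0" using assms(2) D(1) by simp
  ultimately show ?thesis unfolding bnd_def by blast
qed

lemma bnd_cong: "\<forall>\<^sub>F x in at 0 within SD. R x = R' x \<Longrightarrow> bnd s R \<Longrightarrow> bnd s R'"
  by (rule bnd_dominate[of s R 1]) (auto elim: eventually_mono)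

lemma bnd_weaken:
  assumes "bnd s R" "s \<le> t"
  shows "bnd t R"
proof -
  obtain D n where D: "D \<ge> 0" "\<forall>\<^sub>F x in at 0 within SD. \<forall>h\<ge>1. (\<forall>i. cmod (x $ i) \<le> h * G x powr (- \<rho> i)) \<longrightarrow>
     cmod (R x) \<le> D * h ^ n * G x powr s" using assms(1) unfolding bnd_def by blast
  have "\<forall>\<^sub>F x in at 0 within SD. \<forall>h\<ge>1. (\<forall>i. cmod (x $ i) \<le> h * G x powr (- \<rho> i)) \<longrightarrow>
     cmod (R x) \<le> D * h ^ n * G x powr t"
    using D(2) G_large[of 1]
  proof eventually_elim
    case (elim x)
    have "G x powr s \<le> G x powr t" using elim assms(2) by (intro powr_mono) auto
    then have "D * h ^ n * G x powr s \<le> D * h ^ n * G x powr t" if "h \<ge> 1" for h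
      using D(1) that by (intro mult_left_mono) auto
    with elim(1) show ?case by (meson order_trans)
  qed
  then show ?thesis using D(1) unfolding bnd_def by blast
qed

lemma bnd_add:
  assumes "bnd s R" "bnd s R'"
  shows "bnd s (\<lambda>x. R x + R' x)"
proof -
  obtain C n where C: "C \<ge> 0" "\<forall>\<^sub>F x in at 0 within SD. \<forall>h\<ge>1. (\<forall>i. cmod (x $ i) \<le> h * G x powr (- \<rho> i)) \<longrightarrow>
     cmod (R x) \<le> C * h ^ n * G x powr s" using assms(1) unfolding bnd_def by blast
  obtain D k where D: "D \<ge> 0" "\<forall>\<^sub>F x in at 0 within SD. \<forall>h\<ge>1. (\<forall>i. cmod (x $ i) \<le> h * G x powr (- \<rho> i)) \<longrightarrow>
     cmod (R' x) \<le> D * h ^ k * G x powr s" using assms(2) unfolding bnd_def by blast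
  have "\<forall>\<^sub>F x in at 0 within SD. \<forall>h\<ge>1. (\<forall>i. cmod (x $ i) \<le> h * G x powr (- \<rho> i)) \<longrightarrow>
     cmod (R x + R' x) \<le> (C + D) * h ^ max n k * G x powr s"
    using C(2) D(2)
  proof eventually_elim
    case (elim x)
    show ?case
    proof (intro allI impI)
      fix h :: real assume h: "h \<ge> 1" "\<forall>i. cmod (x $ i) \<le> h * G x powr (- \<rho> i)"
      have "cmod (R x + R' x) \<le> C * h ^ n * G x powr s + D * h ^ k * G x powr s"
        using elim h by (intro norm_triangle_mono) auto
      also have "\<dots> \<le> C * h ^ max n k * G x powr s + D * h ^ max n k * G x powr s"
        using h(1) C(1) D(1) by (intro add_mono mult_right_mono mult_left_mono power_increasing) auto
      finally show "cmod (R x + R' x) \<le> (C + D) * h ^ max n k * G x powr s" by (simp add: algebra_simps)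
    qed
  qed
  moreover have "C + D \<ge> 0" using C(1) D(1) by simp
  ultimately show ?thesis unfolding bnd_def by blast
qed

lemma bnd_mult:
  assumes "bnd s R" "bnd t R'"
  shows "bnd (s + t) (\<lambda>x. R x * R' x)"
proof -
  obtain C n where C: "C \<ge> 0" "\<forall>\<^sub>F x in at 0 within SD. \<forall>h\<ge>1. (\<forall>i. cmod (x $ i) \<le> h * G x powr (- \<rho> i)) \<longrightarrow>
     cmod (R x) \<le> C * h ^ n * G x powr s" using assms(1) unfolding bnd_def by blast
  obtain D k where D: "D \<ge> 0" "\<forall>\<^sub>F x in at 0 within SD. \<forall>h\<ge>1. (\<forall>i. cmod (x $ i) \<le> h * G x powr (- \<rho> i)) \<longrightarrow>
     cmod (R' x) \<le> D * h ^ k * G x powr t" using assms(2) unfolding bnd_def by blast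
  have "\<forall>\<^sub>F x in at 0 within SD. \<forall>h\<ge>1. (\<forall>i. cmod (x $ i) \<le> h * G x powr (- \<rho> i)) \<longrightarrow>
     cmod (R x * R' x) \<le> (C * D) * h ^ (n + k) * G x powr (s + t)"
    using C(2) D(2)
  proof eventually_elim
    case (elim x)
    show ?case
    proof (intro allI impI)
      fix h :: real assume h: "h \<ge> 1" "\<forall>i. cmod (x $ i) \<le> h * G x powr (- \<rho> i)"
      have "cmod (R x * R' x) \<le> (C * h ^ n * G x powr s) * (D * h ^ k * G x powr t)"
        unfolding norm_mult using elim h C(1) by (intro mult_mono) auto
      then show "cmod (R x * R' x) \<le> (C * D) * h ^ (n + k) * G x powr (s + t)" by (simp add: powr_add power_add mult_ac)
    qed
  qed
  moreover have "C * D \<ge> 0" using C(1) D(1) by simp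
  ultimately show ?thesis unfolding bnd_def by blast
qed

lemma bnd_const: "bnd 0 (\<lambda>_. w)"
proof (rule bndI[of "cmod w" 1])
  show "\<forall>\<^sub>F x in at 0 within SD. x \<in> SD \<and> G x \<ge> 1 \<longrightarrow> cmod w \<le> cmod w * G x powr 0"
    by (intro always_eventually) auto
qed simp

lemma bnd_cmult: "bnd s R \<Longrightarrow> bnd s (\<lambda>x. w * R x)"
  using bnd_mult[OF bnd_const] by simp

lemma bnd_zero: "bnd s (\<lambda>_. 0)"
  by (rule bndI[of 0]) auto

lemma bnd_sum: "(\<And>i. i \<in> I \<Longrightarrow> bnd s (R i)) \<Longrightarrow> bnd s (\<lambda>x. \<Sum>i\<in>I. R i x)"
  by (induction I rule: infinite_finite_induct) (auto intro: bnd_add bnd_zero)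

lemma bnd_nth: "bnd (- \<rho> i) (\<lambda>x. x $ i)"
  unfolding bnd_def by (intro exI[of _ 1] conjI) (auto intro!: always_eventually exI[of _ 1])

lemma bnd_power: "bnd s R \<Longrightarrow> bnd (of_nat k * s) (\<lambda>x. R x ^ k)"
proof (induction k)
  case 0
  then show ?case using bnd_const[of 1] by simp
next
  case (Suc k)
  then show ?case using bnd_mult[OF Suc.prems Suc.IH] by (simp add: algebra_simps)
qed

lemma bnd_prod: "(\<And>i. i \<in> I \<Longrightarrow> bnd (s i) (R i)) \<Longrightarrow> bnd (\<Sum>i\<in>I. s i) (\<lambda>x. \<Prod>i\<in>I. R i x)"
  using bnd_const[of 1] by (induction I rule: infinite_finite_induct) (auto intro: bnd_mult)

lemma bnd_monom: "bnd (- (\<Sum>i\<in>UNIV. k $ i * \<rho> i)) (\<lambda>x. monom_power x k)"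
  using bnd_prod[of UNIV "\<lambda>i. of_nat (k $ i) * - \<rho> i" "\<lambda>i x. (x $ i) ^ (k $ i)"] bnd_power[OF bnd_nth]
  by (simp add: monom_power_def sum_negf)

lemma bnd_norm: "bnd (- \<theta>) (\<lambda>x. of_real (norm x))"
proof -
  have "bnd (- \<theta>) (\<lambda>x. of_real (cmod (x $ i)))" for i
  proof (rule bnd_dominate[where C = 1])
    show "bnd (- \<theta>) (\<lambda>x. x $ i)" by (rule bnd_weaken[OF bnd_nth]) (use rho(1)[of i] in simp)
  qed auto
  then have "bnd (- \<theta>) (\<lambda>x. \<Sum>i\<in>UNIV. of_real (cmod (x $ i)))" by (rule bnd_sum)
  then show ?thesis
  proof (rule bnd_dominate[where C = 1])
    show "\<forall>\<^sub>F x in at 0 within SD. cmod (of_real (norm x)) \<le> 1 * cmod (\<Sum>i\<in>UNIV. complex_of_real (cmod (x $ i)))"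
    proof (intro always_eventually allI)
      fix x :: "complex ^ 'n"
      have "cmod (\<Sum>i\<in>UNIV. complex_of_real (cmod (x $ i))) = (\<Sum>i\<in>UNIV. cmod (x $ i))"
        by (subst of_real_sum[symmetric], subst norm_of_real) (simp add: sum_nonneg)
      then show "cmod (of_real (norm x)) \<le> 1 * cmod (\<Sum>i\<in>UNIV. complex_of_real (cmod (x $ i)))"
        using norm_vec_le_sum[of x] by simp
    qed
  qed simp
qed

lemma bnd_norm_power:
  assumes "\<forall>\<^sub>F x in nhds 0. cmod (R x) \<le> C * norm x ^ N"
  shows "bnd (- (of_nat N * \<theta>)) R"
proof (rule bnd_dominate[where C = "\<bar>C\<bar>"])
  show "bnd (- (of_nat N * \<theta>)) (\<lambda>x. of_real (norm x) ^ N)" using bnd_power[OF bnd_norm, of N] by simp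
  show "\<forall>\<^sub>F x in at 0 within SD. cmod (R x) \<le> \<bar>C\<bar> * cmod (of_real (norm x) ^ N)"
    using eventually_SD[OF assms]
  proof eventually_elim
    case (elim x)
    have "C * norm x ^ N \<le> \<bar>C\<bar> * norm x ^ N" by (intro mult_right_mono) auto
    then show ?case using elim by (simp add: norm_power)
  qed
qed simp

lemma bnd_hgerm0:
  assumes "hgerm H" "H 0 = 0"
  shows "bnd (- \<theta>) H"
  using hgerm_bound[OF assms(1)] assms(2) bnd_norm_power[of H _ 1] by auto

lemma bnd_hgerm: assumes "hgerm H" shows "bnd 0 H"
proof -
  have "bnd (- \<theta>) (\<lambda>x. H x - H 0)" by (intro bnd_hgerm0 hgerm_diff assms) auto
  then have "bnd 0 (\<lambda>x. H x - H 0)" using delta by (elim bnd_weaken) linarith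
  from bnd_add[OF this bnd_const[of "H 0"]] show ?thesis by simp
qed

lemma bnd_inverse_u: "bnd 1 (\<lambda>x. 1 / u x)"
proof (rule bndI[of "2 * cmod b" 1])
  show "\<forall>\<^sub>F x in at 0 within SD. x \<in> SD \<and> G x \<ge> 1 \<longrightarrow> cmod (1 / u x) \<le> 2 * cmod b * G x powr 1"
  proof (intro always_eventually allI impI)
    fix x assume x: "x \<in> SD \<and> G x \<ge> 1"
    have "cmod (1 / u x) = cmod b * cmod (zc x)" using b0 by (simp add: zc_def norm_divide norm_mult)
    also have "\<dots> \<le> cmod b * (2 * G x)" using Sect_sgauge(2)[OF SD_zc(1)] x by (intro mult_left_mono) (auto simp: G_def)
    finally show "cmod (1 / u x) \<le> 2 * cmod b * G x powr 1" using x by simp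
  qed
qed simp

lemma bnd_u: "bnd (-1) u"
proof (rule bndI[of "3 / cmod b" 1])
  show "\<forall>\<^sub>F x in at 0 within SD. x \<in> SD \<and> G x \<ge> 1 \<longrightarrow> cmod (u x) \<le> 3 / cmod b * G x powr -1"
  proof (intro always_eventually allI impI)
    fix x assume x: "x \<in> SD \<and> G x \<ge> 1"
    have "cmod (u x) = 1 / (cmod b * cmod (zc x))"
      using u_zc[of x] SD_zc(2) x by (metis norm_divide norm_minus_cancel norm_mult norm_one)
    also have "\<dots> \<le> 1 / (cmod b * (G x / 3))"
      using Sect_sgauge(3)[OF SD_zc(1), of x] x b0 by (intro divide_left_mono mult_left_mono) (auto simp: G_def intro!: mult_pos_pos)
    also have "\<dots> = 3 / cmod b * G x powr -1" using x powr_neg_one[of "G x"] by simp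
    finally show "cmod (u x) \<le> 3 / cmod b * G x powr -1" .
  qed
qed simp

lemma bnd_Ln: assumes "s > 0" shows "bnd s (\<lambda>x. Ln (zc x))"
proof (rule bndI[of "2 powr s / s + pi" 3])
  show "\<forall>\<^sub>F x in at 0 within SD. x \<in> SD \<and> G x \<ge> 3 \<longrightarrow> cmod (Ln (zc x)) \<le> (2 powr s / s + pi) * G x powr s"
  proof (intro always_eventually allI impI)
    fix x assume x: "x \<in> SD \<and> G x \<ge> 3"
    then have z: "zc x \<in> Sect" using SD_zc(1) by blast
    note g = Sect_sgauge[OF z]
    have z1: "cmod (zc x) \<ge> 1" using g(3) x by (simp add: G_def)
    have "cmod (Ln (zc x)) \<le> \<bar>Re (Ln (zc x))\<bar> + \<bar>Im (Ln (zc x))\<bar>" by (rule cmod_le)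
    also have "\<dots> \<le> ln (cmod (zc x)) + pi" using z1 g(4) Sect_Ln[OF z] by auto
    also have "\<dots> \<le> ln (2 * G x) + pi" using g(2) z1 by (intro add_right_mono ln_mono) (auto simp: G_def)
    also have "\<dots> \<le> (2 * G x) powr s / s + pi * 1" using x assms by (intro add_mono ln_powr_bound) auto
    also have "\<dots> \<le> (2 * G x) powr s / s + pi * G x powr s"
      using x assms by (intro add_left_mono mult_left_mono ge_one_powr_ge_zero) auto
    finally show "cmod (Ln (zc x)) \<le> (2 powr s / s + pi) * G x powr s"
      using x by (simp add: powr_mult algebra_simps)
  qed
qed (use assms in simp)

text \<open>Solvability of the cohomological equation up to an error summable along orbits:
  \<open>B\<close> is close to \<open>\<Psi> - \<Psi> \<circ> f\<close>, with a \<Psi> of lower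
  order than z.\<close>

definition good :: "(complex ^ 'n \<Rightarrow> complex) \<Rightarrow> bool" where
  "good B \<longleftrightarrow> (\<exists>\<Psi>. (\<forall>x\<in>SD. holo_at \<Psi> x) \<and> bnd (1 - \<delta>) \<Psi> \<and> bnd (- 1 - \<delta>) (\<lambda>x. B x + \<Psi> (f x) - \<Psi> x))"

lemma good_add:
  assumes "good B" "good B'"
  shows "good (\<lambda>x. B x + B' x)"
proof -
  obtain \<Psi> \<Psi>' where 1: "\<forall>x\<in>SD. holo_at \<Psi> x" "bnd (1 - \<delta>) \<Psi>" "bnd (- 1 - \<delta>) (\<lambda>x. B x + \<Psi> (f x) - \<Psi> x)"
    "\<forall>x\<in>SD. holo_at \<Psi>' x" "bnd (1 - \<delta>) \<Psi>'" "bnd (- 1 - \<delta>) (\<lambda>x. B' x + \<Psi>' (f x) - \<Psi>' x)"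
    using assms unfolding good_def by blast
  have "bnd (- 1 - \<delta>) (\<lambda>x. B x + B' x + (\<Psi> (f x) + \<Psi>' (f x)) - (\<Psi> x + \<Psi>' x))"
    using bnd_add[OF 1(3,6)] by (simp add: algebra_simps)
  then show ?thesis unfolding good_def
    using 1 by (intro exI[of _ "\<lambda>x. \<Psi> x + \<Psi>' x"]) (auto intro: holo_at_add bnd_add)
qed

lemma good_cmult:
  assumes "good B"
  shows "good (\<lambda>x. w * B x)"
proof -
  obtain \<Psi> where 1: "\<forall>x\<in>SD. holo_at \<Psi> x" "bnd (1 - \<delta>) \<Psi>" "bnd (- 1 - \<delta>) (\<lambda>x. B x + \<Psi> (f x) - \<Psi> x)"
    using assms unfolding good_def by blast
  have "bnd (- 1 - \<delta>) (\<lambda>x. w * B x + w * \<Psi> (f x) - w * \<Psi> x)"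
    using bnd_cmult[OF 1(3), of w] by (simp add: algebra_simps)
  then show ?thesis unfolding good_def
    using 1 by (intro exI[of _ "\<lambda>x. w * \<Psi> x"]) (auto intro: holo_at_mult bnd_cmult)
qed

lemma good_small: "bnd (- 1 - \<delta>) B \<Longrightarrow> good B"
  unfolding good_def by (intro exI[of _ "\<lambda>_. 0"]) (auto intro: bnd_zero)

section \<open>Solving the cohomological equation term by term\<close>

lemma holo_at_u: "holo_at u x"
  unfolding u_def[abs_def] by (rule holo_at_monom_power)

lemma holo_at_zc: "u x \<noteq> 0 \<Longrightarrow> holo_at zc x"
  unfolding zc_def[abs_def] using b0 by (intro holo_at_intros holo_at_u) auto

lemma holo_at_Ln_zc: "x \<in> SD \<Longrightarrow> holo_at (\<lambda>x. Ln (zc x)) x"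
  using SD_zc[of x] Sect_sgauge(5) by (intro holo_at_Ln holo_at_zc) auto

lemma monom_exponent: "(\<Sum>i\<in>UNIV. k $ i * \<rho> i) = (1 - \<kappa>) * Re (pairing a k / b)"
proof -
  have "pairing a k / b = (\<Sum>i\<in>UNIV. of_nat (k $ i) * \<alpha> i)"
    by (simp add: pairing_def \<alpha>_def sum_divide_distrib mult.commute)
  then have "Re (pairing a k / b) = (\<Sum>i\<in>UNIV. k $ i * \<beta> i)" by (simp add: \<beta>_def)
  then show ?thesis by (simp add: \<rho>_def sum_distrib_left mult_ac)
qed

text \<open>From this total degree on, monomials and Taylor remainders are themselves summable along
  orbits, which makes the elimination of monomials finite.\<close>

definition N :: nat where "N = nat \<lceil>(1 + \<delta>) / \<theta>\<rceil>"

lemma N: "k \<ge> N \<Longrightarrow> 1 + \<delta> \<le> of_nat k * \<theta>"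
proof -
  assume "k \<ge> N"
  then have "(1 + \<delta>) / \<theta> \<le> of_nat k" unfolding N_def by linarith
  then show ?thesis using delta by (simp add: pos_divide_le_eq)
qed

text \<open>Here x^k / u is invariant to first order, while Ln z changes by about -b u; so their
  product divided by b changes by about -x^k. Each error term keeps the factor x^k together with a
  germ vanishing at 0 or with a product of such a germ with u or Ln z.\<close>

lemma good_resonant:
  assumes "pairing a k = b"
  shows "good (\<lambda>x. monom_power x k)"
proof -
  obtain H where H: "hgerm H" "H 0 = 0"
    "\<forall>\<^sub>F x in nhds 0. u x \<noteq> 0 \<longrightarrow> monom_power (f x) k / u (f x) - monom_power x k / u x = monom_power x k * H x"
    using step_monom_over_u[of k] assms by auto
  obtain L where L: "hgerm L" "L 0 = - b" "\<forall>\<^sub>F x in at 0 within SD. Ln (zc (f x)) - Ln (zc x) = u x * L x"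
    using step_Ln by blast
  define \<Psi> where "\<Psi> = (\<lambda>x. 1 / b * (monom_power x k / u x * Ln (zc x)))"
  have mb: "bnd (- (1 - \<kappa>)) (\<lambda>x. monom_power x k)"
    using bnd_monom[of k] assms b0 by (simp add: monom_exponent)
  \<comment> \<open>The logarithm is charged 1/2: \<kappa> + 1/2 is at most 3/4, hence at most 1 -
    \<delta>.\<close>
  have "bnd (- (1 - \<kappa>) + 1 + 1/2) (\<lambda>x. monom_power x k * (1 / u x) * Ln (zc x))"
    by (intro bnd_mult mb bnd_inverse_u bnd_Ln) simp
  then have "bnd (1 - \<delta>) (\<lambda>x. monom_power x k * (1 / u x) * Ln (zc x))"
    by (rule bnd_weaken) (use kappa delta in linarith)
  then have Psib: "bnd (1 - \<delta>) \<Psi>" unfolding \<Psi>_def by (intro bnd_cmult) simp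
  have holo: "\<forall>x\<in>SD. holo_at \<Psi> x"
    unfolding \<Psi>_def using SD_zc b0 by (intro ballI holo_at_intros(3-12) holo_at_const holo_at_monom_power holo_at_u holo_at_Ln_zc) auto
  define R where "R = (\<lambda>x. 1 / b * (monom_power x k * (L x + b) + (monom_power x k * H x) * (u x * L x) + monom_power x k * H x * Ln (zc x)))"
  have H1: "bnd (- (1 - \<kappa>) + - \<theta>) (\<lambda>x. monom_power x k * H x)"
    by (intro bnd_mult mb bnd_hgerm0 H)
  have "bnd (- (1 - \<kappa>) + - \<theta>) (\<lambda>x. monom_power x k * (L x + b))"
    by (intro bnd_mult mb bnd_hgerm0 hgerm_add L hgerm_const) (simp add: L)
  then have R1: "bnd (- 1 - \<delta>) (\<lambda>x. monom_power x k * (L x + b))"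
    by (rule bnd_weaken) (use delta in linarith)
  have "bnd (- (1 - \<kappa>) + - \<theta> + (-1 + 0)) (\<lambda>x. (monom_power x k * H x) * (u x * L x))"
    by (intro bnd_mult[OF H1] bnd_mult bnd_u bnd_hgerm L)
  then have R2: "bnd (- 1 - \<delta>) (\<lambda>x. (monom_power x k * H x) * (u x * L x))"
    by (rule bnd_weaken) (use delta in linarith)
  \<comment> \<open>Here the logarithm may cost only \<delta>, lifting the order from -1 - 2\<delta>
    to -1 - \<delta>.\<close>
  have "bnd (- (1 - \<kappa>) + - \<theta> + \<delta>) (\<lambda>x. monom_power x k * H x * Ln (zc x))"
    by (intro bnd_mult[OF H1] bnd_Ln delta)
  then have R3: "bnd (- 1 - \<delta>) (\<lambda>x. monom_power x k * H x * Ln (zc x))"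
    by (rule bnd_weaken) (use delta in linarith)
  have Rb: "bnd (- 1 - \<delta>) R" unfolding R_def by (intro bnd_cmult bnd_add R1 R2 R3)
  have "\<forall>\<^sub>F x in at 0 within SD. R x = monom_power x k + \<Psi> (f x) - \<Psi> x"
    using L(3) eventually_SD[OF H(3)]
  proof eventually_elim
    case (elim x)
    then have ux: "u x \<noteq> 0" using SD_zc by blast
    have e: "monom_power (f x) k / u (f x) = monom_power x k / u x + monom_power x k * H x"
      using elim ux by (simp add: algebra_simps)
    have l: "Ln (zc (f x)) = Ln (zc x) + u x * L x" using elim by (simp add: algebra_simps)
    have "\<Psi> (f x) - \<Psi> x = 1 / b * ((monom_power x k / u x + monom_power x k * H x) * (Ln (zc x) + u x * L x)
       - monom_power x k / u x * Ln (zc x))"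
      unfolding \<Psi>_def e l by (simp only: right_diff_distrib)
    also have "\<dots> = 1 / b * (monom_power x k * L x + (monom_power x k * H x) * (u x * L x) + monom_power x k * H x * Ln (zc x))"
    proof -
      have "(e + mH) * (Z + U * l) - e * Z = (e * U) * l + mH * (U * l) + mH * Z" for e mH Z U l :: complex
        by (simp add: algebra_simps)
      from this[of "monom_power x k / u x" "monom_power x k * H x" "Ln (zc x)" "u x" "L x"]
      show ?thesis using ux by (simp only: nonzero_divide_eq_eq[symmetric] times_divide_eq_left nonzero_mult_div_cancel_right not_False_eq_True)
    qed
    finally show ?case unfolding R_def using b0 by (simp add: field_simps)
  qed
  from bnd_cong[OF this Rb] show ?thesis unfolding good_def using holo Psib by blast
qed

text \<open>The function -x^k / u solves the equation exactly, since x^k H is the increment of x^k /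
  u. What remains is its size: any nonconstant monomial is of order at most -\<theta>, so the
  quotient stays below order 1 - \<delta>.\<close>

lemma good_nonresonant:
  assumes "pairing a k \<noteq> b" "k \<noteq> 0" "hgerm H"
    "\<forall>\<^sub>F x in nhds 0. u x \<noteq> 0 \<longrightarrow> monom_power (f x) k / u (f x) - monom_power x k / u x = monom_power x k * H x"
  shows "good (\<lambda>x. monom_power x k * H x)"
proof -
  define \<Psi> where "\<Psi> = (\<lambda>x. (-1) * (monom_power x k * (1 / u x)))"
  obtain i where "k $ i \<noteq> 0" using assms(2) by (auto simp: vec_eq_iff)
  have "\<theta> \<le> 1 * \<rho> i" using rho by simp
  also have "\<dots> \<le> k $ i * \<rho> i" using \<open>k $ i \<noteq> 0\<close> rho(2)[of i] by (intro mult_right_mono) auto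
  also have "\<dots> \<le> (\<Sum>i\<in>UNIV. k $ i * \<rho> i)" using rho(2) by (intro member_le_sum mult_nonneg_nonneg) (auto intro: less_imp_le)
  finally have th: "\<theta> \<le> (\<Sum>i\<in>UNIV. k $ i * \<rho> i)" .
  have "bnd (- (\<Sum>i\<in>UNIV. k $ i * \<rho> i) + 1) (\<lambda>x. monom_power x k * (1 / u x))"
    by (intro bnd_mult bnd_monom bnd_inverse_u)
  then have "bnd (1 - \<delta>) (\<lambda>x. monom_power x k * (1 / u x))"
    by (rule bnd_weaken) (use delta th in linarith)
  then have Psib: "bnd (1 - \<delta>) \<Psi>" unfolding \<Psi>_def by (rule bnd_cmult)
  have holo: "\<forall>x\<in>SD. holo_at \<Psi> x"
    unfolding \<Psi>_def using SD_zc by (intro ballI holo_at_mult holo_at_divide holo_at_const holo_at_monom_power holo_at_u) auto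
  have "\<forall>\<^sub>F x in at 0 within SD. 0 = monom_power x k * H x + \<Psi> (f x) - \<Psi> x"
    using eventually_SD[OF assms(4)]
  proof eventually_elim
    case (elim x)
    then have "u x \<noteq> 0" using SD_zc by blast
    with elim have "monom_power x k * H x = monom_power (f x) k / u (f x) - monom_power x k / u x" by simp
    then show ?case by (simp add: \<Psi>_def)
  qed
  from bnd_cong[OF this bnd_zero] show ?thesis unfolding good_def using holo Psib by blast
qed

text \<open>Induction towards higher degree: for nonresonant k, x^k is x^k H divided by H(0), minus
  products of x^k with nonconstant monomials, plus a Taylor remainder. The first term is an exact
  increment, the products have larger total degree.\<close>

lemma good_monom: "k \<noteq> 0 \<Longrightarrow> good (\<lambda>x. monom_power x k)"
proof (induction "N - total_degree k" arbitrary: k rule: less_induct)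
  case less
  show ?case
  proof (cases "total_degree k \<ge> N")
    case True
    have "bnd (- (of_nat (total_degree k) * \<theta>)) (\<lambda>x. monom_power x k)"
      by (rule bnd_norm_power[where C = 1]) (auto intro!: always_eventually norm_monom_power_le)
    then show ?thesis using N[OF True] by (intro good_small) (elim bnd_weaken, linarith)
  next
    case False
    show ?thesis
    proof (cases "pairing a k = b")
      case True
      then show ?thesis by (rule good_resonant)
    next
      case nres: False
      obtain H where H: "hgerm H" "H 0 = pairing a k - b"
        "\<forall>\<^sub>F x in nhds 0. u x \<noteq> 0 \<longrightarrow> monom_power (f x) k / u (f x) - monom_power x k / u x = monom_power x k * H x"
        using step_monom_over_u[of k] by auto
      obtain p C where p: "poly0 p" "\<forall>\<^sub>F x in nhds 0. cmod (H x - H 0 - p x) \<le> C * norm x ^ N"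
        using hgerm_taylor[OF H(1)] by blast
      have kp: "good (\<lambda>x. monom_power x k * p x)" using p(1)
      proof induction
        case zero
        then show ?case by (simp add: good_small bnd_zero)
      next
        case (add p k' w)
        have "total_degree k' > 0" using add by (simp add: total_degree_pos)
        moreover have "k + k' \<noteq> 0" using less.prems by (auto simp: vec_eq_iff)
        ultimately have "good (\<lambda>x. monom_power x (k + k'))"
          using False by (intro less.hyps) (auto simp: total_degree_add)
        from good_add[OF add.IH good_cmult[OF this, of w]]
        show ?case by (simp add: monom_power_add algebra_simps)
      qed
      have "bnd (0 + - (of_nat N * \<theta>)) (\<lambda>x. monom_power x k * (H x - H 0 - p x))"
        by (intro bnd_mult bnd_hgerm hgerm_monom_power bnd_norm_power[OF p(2)])
      then have rest: "good (\<lambda>x. monom_power x k * (H x - H 0 - p x))"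
        using N[of N] by (intro good_small) (elim bnd_weaken, simp)
      define l where "l = pairing a k - b"
      have l: "l \<noteq> 0" using nres by (simp add: l_def)
      have "good (\<lambda>x. 1 / l * (monom_power x k * H x) + ((- 1 / l) * (monom_power x k * p x) + (- 1 / l) * (monom_power x k * (H x - H 0 - p x))))"
        by (intro good_add good_cmult kp rest good_nonresonant[OF nres less.prems H(1,3)])
      also have "(\<lambda>x. 1 / l * (monom_power x k * H x) + ((- 1 / l) * (monom_power x k * p x) + (- 1 / l) * (monom_power x k * (H x - H 0 - p x))))
         = (\<lambda>x. monom_power x k)"
        using l by (simp add: fun_eq_iff H(2) l_def[symmetric] field_simps)
      finally show ?thesis .
    qed
  qed
qed

lemma good_hgerm:
  assumes "hgerm B" "B 0 = 0"
  shows "good B"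
proof -
  obtain p C where p: "poly0 p" "\<forall>\<^sub>F x in nhds 0. cmod (B x - B 0 - p x) \<le> C * norm x ^ N"
    using hgerm_taylor[OF assms(1)] by blast
  have "good p" using p(1)
  proof induction
    case zero
    show ?case by (intro good_small bnd_zero)
  next
    case (add p k w)
    show ?case using add by (intro good_add good_cmult good_monom)
  qed
  moreover have "good (\<lambda>x. B x - B 0 - p x)"
    using bnd_norm_power[OF p(2)] N[of N] by (intro good_small) (elim bnd_weaken, simp)
  ultimately have "good (\<lambda>x. p x + (B x - B 0 - p x))" by (rule good_add)
  then show ?thesis using assms(2) by simp
qed

theorem approximate_fatou_coordinate:
  "\<exists>\<Psi>. (\<forall>x\<in>SD. holo_at \<Psi> x) \<and> bnd (1 - \<delta>) \<Psi> \<and>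
    bnd (- 1 - \<delta>) (\<lambda>x. zc (f x) + \<Psi> (f x) - (zc x + \<Psi> x) - 1)"
proof -
  obtain B where B: "hgerm B" "B 0 = 0" "\<forall>\<^sub>F x in nhds 0. u x \<noteq> 0 \<longrightarrow> zc (f x) = zc x + 1 + B x"
    using step_zc by blast
  obtain \<Psi> where \<Psi>: "\<forall>x\<in>SD. holo_at \<Psi> x" "bnd (1 - \<delta>) \<Psi>" "bnd (- 1 - \<delta>) (\<lambda>x. B x + \<Psi> (f x) - \<Psi> x)"
    using good_hgerm[OF B(1,2)] unfolding good_def by blast
  have "\<forall>\<^sub>F x in at 0 within SD. B x + \<Psi> (f x) - \<Psi> x = zc (f x) + \<Psi> (f x) - (zc x + \<Psi> x) - 1"
    using eventually_SD[OF B(3)]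
  proof eventually_elim
    case (elim x)
    then have "zc (f x) = zc x + 1 + B x" using SD_zc by blast
    then show ?case by simp
  qed
  from bnd_cong[OF this \<Psi>(3)] show ?thesis using \<Psi>(1,2) by blast
qed

lemma bnd_Y: "\<exists>R. bnd (- 1 - \<theta>) R \<and> (\<forall>\<^sub>F x in at 0 within SD. Y q (f x) - Y q x = Y q x * R x)"
proof -
  obtain H where H: "hgerm H" "H 0 = 0" "\<forall>\<^sub>F x in at 0 within SD. x \<in> SD \<and> Y q (f x) = Y q x * (1 + u x * H x)"
    using step_Y by blast
  have "bnd (- 1 + - \<theta>) (\<lambda>x. u x * H x)" by (intro bnd_mult bnd_u bnd_hgerm0 H)
  moreover have "\<forall>\<^sub>F x in at 0 within SD. Y q (f x) - Y q x = Y q x * (u x * H x)"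
    using H(3) by eventually_elim (auto simp: algebra_simps)
  ultimately show ?thesis by (intro exI[of _ "\<lambda>x. u x * H x"]) simp
qed

end

section \<open>Invariant domains and limits along orbits\<close>

text \<open>Weierstrass's criterion for the telescoping series. The factor \<open>B\<close>, being
  continuous, is bounded on small closed balls, which gives local uniformity and a holomorphic
  limit; kept explicit, it also measures the distance of the limit from the initial term.\<close>

lemma telescoping_limit:
  fixes F :: "nat \<Rightarrow> complex ^ 'n \<Rightarrow> complex"
  assumes S: "open S" and hol: "\<And>j x. x \<in> S \<Longrightarrow> holo_at (F j) x"
    and step: "\<And>j x. x \<in> S \<Longrightarrow> cmod (F (Suc j) x - F j x) \<le> B x * w j"
    and w: "summable w" "\<And>j. w j \<ge> 0" and B: "continuous_on S B"
  shows "\<exists>L. \<forall>x\<in>S. holo_at L x \<and> (\<lambda>j. F j x) \<longlonglongrightarrow> L x \<and> cmod (L x - F 0 x) \<le> B x * suminf w"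
proof -
  define L where "L = (\<lambda>x. F 0 x + (\<Sum>j. F (Suc j) x - F j x))"
  have tel: "F 0 x + (\<Sum>j<k. F (Suc j) x - F j x) = F k x" for k x
    by (induction k) (auto simp: algebra_simps)
  have sm: "summable (\<lambda>j. F (Suc j) x - F j x)" if "x \<in> S" for x
    by (rule summable_comparison_test[OF _ summable_mult[OF w(1), of "B x"]]) (use step that in auto)
  have lim: "(\<lambda>j. F j x) \<longlonglongrightarrow> L x" if "x \<in> S" for x
    using tendsto_add[OF tendsto_const summable_LIMSEQ[OF sm[OF that]], of "F 0 x"] by (simp add: tel L_def)
  have est: "cmod (L x - F 0 x) \<le> B x * suminf w" if "x \<in> S" for x
  proof -
    have "cmod (\<Sum>j. F (Suc j) x - F j x) \<le> (\<Sum>j. B x * w j)"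
      by (rule norm_suminf_le) (use step that summable_mult[OF w(1)] in auto)
    then show ?thesis using w(1) by (simp add: L_def suminf_mult)
  qed
  have "holo_at L x" if x: "x \<in> S" for x
  proof -
    obtain r0 where r0: "r0 > 0" "cball x r0 \<subseteq> S" using S x open_contains_cball by blast
    have "bounded (B ` cball x r0)"
      using B r0(2) by (intro compact_imp_bounded compact_continuous_image continuous_on_subset[OF B]) auto
    then obtain K where K: "\<And>y. y \<in> cball x r0 \<Longrightarrow> B y \<le> K"
      unfolding bounded_iff by (metis abs_le_D1 imageI real_norm_def)
    have "uniform_limit (ball x r0) (\<lambda>k y. \<Sum>j<k. F (Suc j) y - F j y) (\<lambda>y. \<Sum>j. F (Suc j) y - F j y) sequentially"
    proof (rule Weierstrass_m_test)
      show "summable (\<lambda>j. K * w j)" using w(1) by (rule summable_mult)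
      fix j y assume y: "y \<in> ball x r0"
      then have "cmod (F (Suc j) y - F j y) \<le> B y * w j" using r0(2) by (intro step) auto
      also have "\<dots> \<le> K * w j" using y K[of y] w(2) by (intro mult_right_mono) auto
      finally show "cmod (F (Suc j) y - F j y) \<le> K * w j" .
    qed
    then have "uniform_limit (ball x r0) (\<lambda>k y. F 0 y + (\<Sum>j<k. F (Suc j) y - F j y)) L sequentially"
      unfolding L_def by (intro uniform_limit_intros)
    then have "uniform_limit (ball x r0) F L sequentially" by (simp add: tel)
    moreover have "holo_at (F j) y" if "y \<in> ball x r0" for j y
      using that r0(2) by (intro hol) auto
    ultimately show ?thesis using holo_at_uniform_limit[of x r0 F L] r0(1) by blast
  qed
  then show ?thesis using lim est by blast
qed

lemma summable_weight:
  assumes "s > 0"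
  shows "summable (\<lambda>j. (1 + real j / 2) powr (- 1 - s))"
proof (rule summable_comparison_test)
  have "summable (\<lambda>j. real (Suc j) powr (- 1 - s))"
    using assms summable_real_powr_iff[of "- 1 - s"] by (subst summable_Suc_iff) simp
  then show "summable (\<lambda>j. (1/2) powr (- 1 - s) * real (Suc j) powr (- 1 - s))" by (rule summable_mult)
  have "(1 + real j / 2) powr (- 1 - s) \<le> (1/2) powr (- 1 - s) * real (Suc j) powr (- 1 - s)" for j
  proof -
    have "(1 + real j / 2) powr (- 1 - s) \<le> (1/2 * real (Suc j)) powr (- 1 - s)"
      using assms by (intro powr_mono2') auto
    then show ?thesis by (subst (asm) powr_mult) auto
  qed
  then show "\<exists>N. \<forall>j\<ge>N. norm ((1 + real j / 2) powr (- 1 - s)) \<le> (1/2) powr (- 1 - s) * real (Suc j) powr (- 1 - s)"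
    by simp
qed

text \<open>The excess \<open>s\<close> over the exponent 1 is split: one half keeps the sum over
  \<open>j\<close> finite, the other gives decay in the initial \<open>G\<close>, so that limits are
  close to their initial terms far out.\<close>

lemma weight_le:
  fixes G s :: real
  assumes "G \<ge> 1" "s > 0"
  shows "(G + real j / 2) powr (- 1 - s) \<le> G powr (- s / 2) * (1 + real j / 2) powr (- 1 - s / 2)"
proof -
  have "(G + real j / 2) powr (- 1 - s) = (G + real j / 2) powr (- s / 2) * (G + real j / 2) powr (- 1 - s / 2)"
    by (subst powr_add[symmetric]) (rule arg_cong[where f = "\<lambda>e. _ powr e"], simp)
  also have "\<dots> \<le> G powr (- s / 2) * (1 + real j / 2) powr (- 1 - s / 2)"
    using assms by (intro mult_mono powr_mono2') auto
  finally show ?thesis .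
qed

text \<open>A relative growth of \<sigma>/(4G) is outweighed by G^\<sigma>: with t = 1/(2G), (1 +
  t)^\<sigma> is at least 1 + \<sigma> ln (1 + t), and ln (1 + t) is at least t/2 since t is at most
  1/2.\<close>

lemma powr_growth:
  fixes G G' \<sigma> y y' :: real
  assumes "G \<ge> 1" "G' \<ge> G + 1/2" "\<sigma> > 0" "y \<ge> 0" "y' \<le> y * (1 + \<sigma> / (4 * G))"
  shows "y' * G' powr (- \<sigma>) \<le> y * G powr (- \<sigma>)"
proof -
  define t where "t = 1 / (2 * G)"
  have t: "0 < t" "t \<le> 1/2" using assms(1) by (auto simp: t_def field_simps)
  have "t * t \<le> t * (1/2)" using t by (intro mult_left_mono) auto
  then have "t / 2 \<le> t - t^2" by (simp add: power2_eq_square)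
  also have "\<dots> \<le> ln (1 + t)" using t by (intro ln_one_plus_pos_lower_bound) auto
  finally have "1 + \<sigma> * (t / 2) \<le> 1 + \<sigma> * ln (1 + t)" using assms(3) by (simp add: mult_left_mono)
  also have "\<dots> \<le> exp (\<sigma> * ln (1 + t))" by (rule exp_ge_add_one_self)
  also have "\<dots> = (1 + t) powr \<sigma>" using t by (simp add: powr_def)
  also have "\<dots> \<le> (G' / G) powr \<sigma>"
  proof (rule powr_mono2)
    have "(1 + t) * G = G + 1/2" using assms(1) by (simp add: t_def field_simps)
    then show "1 + t \<le> G' / G" using assms(1,2) by (simp add: pos_le_divide_eq)
  qed (use assms t in auto)
  also have "\<dots> = G' powr \<sigma> / G powr \<sigma>" using assms by (simp add: powr_divide)
  finally have 1: "1 + \<sigma> / (4 * G) \<le> G' powr \<sigma> / G powr \<sigma>" by (simp add: t_def)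
  have pos: "G powr \<sigma> > 0" "G' powr \<sigma> > 0" using assms by auto
  have "y' \<le> y * (G' powr \<sigma> / G powr \<sigma>)" using assms(4,5) 1 mult_left_mono order_trans by blast
  then have "y' / G' powr \<sigma> \<le> y / G powr \<sigma>" using pos by (simp add: field_simps)
  then show ?thesis by (simp add: powr_minus divide_inverse)
qed

context parabolic_germ
begin

section \<open>The invariant domain and its size\<close>

definition E :: "'n \<Rightarrow> complex ^ 'n \<Rightarrow> complex" where "E i = Y (\<lambda>j. if j = i then 1 else 0)"

lemma E_eq: "E i x = x $ i * exp (\<alpha> i * Ln (zc x))"
proof -
  have "lam (\<lambda>j. if j = i then 1 else 0) = (\<Sum>j\<in>UNIV. if j = i then \<alpha> i else 0)"
    unfolding lam_def by (intro sum.cong) auto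
  then show ?thesis by (simp add: E_def Y_def lmono_axis)
qed

text \<open>Since |E_i| is comparable to |x_i| times G^\<beta>_i, this amounts to a bound on |x_i|:
  all points are near 0, and all points of \<open>SD\<close> near 0 belong. In terms of E_i the
  bound is preserved by \<open>f\<close>.\<close>

definition Om :: "real \<Rightarrow> (complex ^ 'n) set" where
  "Om \<epsilon> = {x \<in> SD. \<forall>i. cmod (E i x) < \<epsilon> * G x powr \<beta> i}"

text \<open>The powers of 3 come from comparing \<open>sgauge z\<close> with the modulus, the
  exponentials from comparing |z^\<alpha>_i| with |z|^\<beta>_i for arguments below \<pi>; the sum
  serves all i at once.\<close>

definition Dc :: real where "Dc = (\<Sum>i\<in>UNIV. 3 powr \<beta> i * exp (pi * \<bar>Im (\<alpha> i)\<bar>))"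

lemma Dc_pos: "Dc > 0"
  unfolding Dc_def by (intro sum_pos) auto

lemma coordinate_bounds:
  assumes x: "x \<in> SD"
  shows "cmod (x $ i) \<le> Dc * cmod (E i x) * G x powr (- \<beta> i)" "cmod (E i x) \<le> Dc * cmod (x $ i) * G x powr \<beta> i"
proof -
  define L where "L = Ln (zc x)"
  define t where "t = exp (pi * \<bar>Im (\<alpha> i)\<bar>)"
  have z: "zc x \<in> Sect" using x SD_zc by blast
  note g = Sect_sgauge[OF z]
  have Gp: "G x > 0" using g by (simp add: G_def)
  have zp: "cmod (zc x) > 0" using g(4) by simp
  have Di: "3 powr \<beta> i * t \<le> Dc" unfolding Dc_def t_def
    by (rule member_le_sum[of i UNIV "\<lambda>i. 3 powr \<beta> i * exp (pi * \<bar>Im (\<alpha> i)\<bar>)"]) auto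
  have "cmod (E i x) = cmod (x $ i) * exp (\<beta> i * ln (cmod (zc x)) - Im (\<alpha> i) * Im L)"
    using g(4) by (simp add: E_eq norm_mult L_def \<beta>_def)
  also have "exp (\<beta> i * ln (cmod (zc x)) - Im (\<alpha> i) * Im L) = cmod (zc x) powr \<beta> i * exp (- (Im (\<alpha> i) * Im L))"
    using g(4) by (simp add: powr_def exp_add[symmetric])
  finally have Eq: "cmod (E i x) = cmod (x $ i) * cmod (zc x) powr \<beta> i * exp (- (Im (\<alpha> i) * Im L))" by simp
  have "\<bar>Im (\<alpha> i) * Im L\<bar> \<le> \<bar>Im (\<alpha> i)\<bar> * pi"
    unfolding abs_mult using Sect_Ln[OF z] pi_gt_zero unfolding L_def by (intro mult_left_mono) linarith+
  then have "\<bar>Im (\<alpha> i) * Im L\<bar> \<le> pi * \<bar>Im (\<alpha> i)\<bar>" by (simp only: mult.commute)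
  then have ex: "exp (- (Im (\<alpha> i) * Im L)) \<le> t" "exp (Im (\<alpha> i) * Im L) \<le> t"
    unfolding t_def exp_le_cancel_iff by linarith+
  have "cmod (E i x) \<le> cmod (x $ i) * (2 * G x) powr \<beta> i * t"
    unfolding Eq using g(2) beta_pos[of i] ex(1) by (intro mult_mono powr_mono2) (auto simp: G_def less_imp_le)
  also have "\<dots> = cmod (x $ i) * G x powr \<beta> i * (2 powr \<beta> i * t)" using Gp by (simp add: powr_mult)
  also have "\<dots> \<le> cmod (x $ i) * G x powr \<beta> i * (3 powr \<beta> i * t)"
    using beta_pos[of i] by (intro mult_left_mono mult_right_mono powr_mono2) (auto simp: t_def less_imp_le)
  also have "\<dots> \<le> cmod (x $ i) * G x powr \<beta> i * Dc" using Di by (intro mult_left_mono) auto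
  finally show "cmod (E i x) \<le> Dc * cmod (x $ i) * G x powr \<beta> i" by (simp add: mult_ac)
  have "cmod (x $ i) = cmod (E i x) * cmod (zc x) powr (- \<beta> i) * exp (Im (\<alpha> i) * Im L)"
    unfolding Eq using zp by (simp add: powr_minus exp_minus field_simps)
  also have "\<dots> \<le> cmod (E i x) * (G x / 3) powr (- \<beta> i) * t"
    using g(3) Gp beta_pos[of i] ex(2) by (intro mult_mono powr_mono2') (auto simp: G_def)
  also have "(G x / 3) powr (- \<beta> i) = G x powr (- \<beta> i) * 3 powr \<beta> i"
  proof -
    have "(G x / 3) powr (- \<beta> i) = G x powr (- \<beta> i) / 3 powr (- \<beta> i)" using Gp by (simp add: powr_divide)
    also have "3 powr (- \<beta> i) = 1 / 3 powr \<beta> i" by (rule powr_minus_divide)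
    finally show ?thesis by simp
  qed
  also have "cmod (E i x) * (G x powr (- \<beta> i) * 3 powr \<beta> i) * t = cmod (E i x) * G x powr (- \<beta> i) * (3 powr \<beta> i * t)"
    by simp
  also have "\<dots> \<le> cmod (E i x) * G x powr (- \<beta> i) * Dc" using Di by (intro mult_left_mono) auto
  finally show "cmod (x $ i) \<le> Dc * cmod (E i x) * G x powr (- \<beta> i)" by (simp add: mult_ac)
qed

lemma G_pos: "x \<in> SD \<Longrightarrow> G x > 0" using Sect_sgauge(1) SD_zc(1) by (simp add: G_def)

lemma Om_norm_le:
  assumes "x \<in> Om \<epsilon>"
  shows "norm x \<le> CARD('n) * (Dc * \<epsilon>)"
proof -
  have x: "x \<in> SD" "\<And>i. cmod (E i x) < \<epsilon> * G x powr \<beta> i" using assms by (auto simp: Om_def)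
  have "cmod (x $ i) \<le> Dc * \<epsilon>" for i
  proof -
    have "cmod (x $ i) \<le> Dc * cmod (E i x) * G x powr (- \<beta> i)" by (rule coordinate_bounds[OF x(1)])
    also have "\<dots> \<le> Dc * (\<epsilon> * G x powr \<beta> i) * G x powr (- \<beta> i)"
      using x(2)[of i] Dc_pos by (intro mult_right_mono mult_left_mono) auto
    also have "\<dots> = Dc * \<epsilon>" using G_pos[OF x(1)] by (simp add: powr_minus)
    finally show ?thesis .
  qed
  then have "norm x \<le> (\<Sum>i::'n\<in>UNIV. Dc * \<epsilon>)" by (intro order_trans[OF norm_vec_le_sum] sum_mono)
  then show ?thesis by simp
qed

lemma SD_subset_Om:
  assumes "x \<in> SD" "\<epsilon> > 0" "norm x < \<epsilon> / Dc"
  shows "x \<in> Om \<epsilon>"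
proof -
  have "cmod (E i x) < \<epsilon> * G x powr \<beta> i" for i
  proof -
    have "Dc * cmod (x $ i) < \<epsilon>"
    proof -
      have "Dc * cmod (x $ i) \<le> Dc * norm x" using Dc_pos by (intro mult_left_mono Finite_Cartesian_Product.norm_nth_le) auto
      also have "Dc * norm x < \<epsilon>" using assms(3) Dc_pos by (simp add: pos_less_divide_eq mult.commute)
      finally show ?thesis .
    qed
    then have "Dc * cmod (x $ i) * G x powr \<beta> i < \<epsilon> * G x powr \<beta> i" using G_pos[OF assms(1)] by simp
    with coordinate_bounds(2)[OF assms(1), of i] show ?thesis by linarith
  qed
  then show ?thesis using assms(1) by (simp add: Om_def)
qed

lemma open_SD: "open SD"
proof -
  have cu: "continuous_on UNIV u" using holo_at_u holo_at_imp_isCont by (auto intro: continuous_at_imp_continuous_on)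
  have 1: "open {x. u x \<noteq> 0}" using cu by (intro open_Collect_neq) auto
  have "continuous_on {x. u x \<noteq> 0} zc"
    using holo_at_zc holo_at_imp_isCont by (auto intro!: continuous_at_imp_continuous_on)
  then have "open ({x. u x \<noteq> 0} \<inter> zc -` Sect)" using 1 open_Sect by (intro continuous_open_preimage)
  moreover have "{x. u x \<noteq> 0} \<inter> zc -` Sect = SD" by (auto simp: SD_def)
  ultimately show ?thesis by simp
qed

lemma holo_at_E: "x \<in> SD \<Longrightarrow> holo_at (E i) x"
  unfolding E_eq[abs_def] by (intro holo_at_intros(1,2,4) holo_at_exp holo_at_Ln_zc)

lemma continuous_on_SD_holo: "(\<And>x. x \<in> SD \<Longrightarrow> holo_at g x) \<Longrightarrow> continuous_on SD g"
  using holo_at_imp_isCont by (blast intro: continuous_at_imp_continuous_on)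

lemma continuous_on_G: "continuous_on SD G"
proof -
  have "continuous_on SD zc" using SD_zc holo_at_zc by (intro continuous_on_SD_holo) auto
  then show ?thesis unfolding G_def[abs_def] sgauge_def by (intro continuous_intros)
qed

lemma open_Om: "open (Om \<epsilon>)"
proof -
  have "open (SD \<inter> (\<lambda>x. \<epsilon> * G x powr \<beta> i - cmod (E i x)) -` {0<..})" for i
    using G_pos by (intro continuous_open_preimage open_SD continuous_intros continuous_on_G continuous_on_SD_holo holo_at_E) force+
  then have "open (\<Inter>i. SD \<inter> (\<lambda>x. \<epsilon> * G x powr \<beta> i - cmod (E i x)) -` {0<..})" by (intro open_INT) auto
  moreover have "(\<Inter>i. SD \<inter> (\<lambda>x. \<epsilon> * G x powr \<beta> i - cmod (E i x)) -` {0<..}) = Om \<epsilon>" by (auto simp: Om_def)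
  ultimately show ?thesis by simp
qed

end

text \<open>\<open>J\<close> collects the index \<open>p\<close> of the translated coordinate and the coordinates in the punctured plane.\<close>

locale petal = parabolic_germ f U V A a M
  for f :: "complex ^ 'n \<Rightarrow> complex ^ 'n" and U V A a M +
  fixes d :: nat and m :: "'n \<Rightarrow> nat" and P Q :: "'n \<Rightarrow> 'n \<Rightarrow> int" and p :: 'n and J :: "'n set"
    and Nb :: "(complex ^ 'n) set"
  assumes d: "d > 0" and M_eq: "\<And>i. M $ i = d * m i"
    and Pp: "\<And>i. P p i = int (m i)"
    and PQ: "\<And>i j. (\<Sum>k\<in>UNIV. P i k * Q k j) = (if i = j then 1 else 0)"
    and QP: "\<And>i j. (\<Sum>k\<in>UNIV. Q i k * P k j) = (if i = j then 1 else 0)"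
    and notJ: "\<And>l i. l \<notin> J \<Longrightarrow> Q i l \<ge> 0" "\<And>l i l'. l \<notin> J \<Longrightarrow> P l' i * Q i l \<ge> 0"
    and m0: "\<And>i l. m i = 0 \<Longrightarrow> P l i \<ge> 0" "\<And>i l i'. m i = 0 \<Longrightarrow> Q i' l * P l i \<ge> 0"
      "\<And>l i. l \<in> J \<Longrightarrow> m i = 0 \<Longrightarrow> P l i = 0"
    and p: "p \<in> J"
    and Nb: "open Nb" "0 \<in> Nb" "Nb \<subseteq> U"
begin

section \<open>The root-valued function K separating the petals\<close>

definition roots :: "complex set" where "roots = {w. w ^ d = - 1 / b}"

definition K :: "complex ^ 'n \<Rightarrow> complex" where "K = Y (P p)"

lemma lam_p: "of_nat d * lam (P p) = 1"
proof -
  have "(\<Sum>i\<in>UNIV. of_nat (M $ i) * \<alpha> i) = 1"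
  proof -
    have "(\<Sum>i\<in>UNIV. of_nat (M $ i) * \<alpha> i) = pairing a M / b"
      by (simp add: pairing_def \<alpha>_def sum_divide_distrib mult.commute)
    then show ?thesis using b0 by (simp add: b_def)
  qed
  then show ?thesis by (simp add: lam_def Pp M_eq sum_distrib_left mult.assoc)
qed

lemma monom_power_M: "monom_power x M = lmono (P p) x ^ d"
  by (simp add: monom_power_def lmono_def Pp M_eq prod_power_distrib power_mult[symmetric] mult.commute)

lemma K_root:
  assumes "x \<in> SD"
  shows "K x \<in> roots"
proof -
  have "K x ^ d = u x * exp (of_nat d * lam (P p) * Ln (zc x))"
    by (simp add: K_def Y_def power_mult_distrib exp_of_nat_mult[symmetric] monom_power_M u_def mult.assoc)
  also have "\<dots> = u x * zc x" using Sect_sgauge(4)[OF SD_zc(1)[OF assms]] by (simp add: lam_p)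
  also have "\<dots> = - 1 / b" using SD_zc(2)[OF assms] b0 by (simp add: zc_def)
  finally show ?thesis by (simp add: roots_def)
qed

lemma finite_roots: "finite roots" "card roots = d"
  using card_nth_roots[of "- 1 / b" d] finite_nth_roots[of d "- 1 / b"] d b0 by (auto simp: roots_def)

lemma root_nonzero: "w \<in> roots \<Longrightarrow> w \<noteq> 0"
  using d b0 by (auto simp: roots_def power_0_left)

text \<open>The relative change of \<open>K\<close> in one step is small, and its values lie in a
  finite set with positive distances.\<close>

lemma K_f: "\<forall>\<^sub>F x in at 0 within SD. K (f x) = K x"
proof -
  \<comment> \<open>Inserting 1 keeps the minimum meaningful for d = 1, when there are no distinct
    roots.\<close>
  define s where "s = Min (insert 1 ((\<lambda>(v, w). dist v w) ` {(v, w) \<in> roots \<times> roots. v \<noteq> w}))"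
  have fin: "finite {(v, w) \<in> roots \<times> roots. v \<noteq> w}"
    by (rule finite_subset[of _ "roots \<times> roots"]) (use finite_roots in auto)
  have s: "s > 0" using fin by (auto simp: s_def)
  have sep: "s \<le> dist v w" if "v \<in> roots" "w \<in> roots" "v \<noteq> w" for v w
    unfolding s_def using fin that by (intro Min_le) force+
  define Ks where "Ks = 1 + (\<Sum>w\<in>roots. cmod w)"
  have Ks: "Ks > 0" unfolding Ks_def by (intro add_pos_nonneg sum_nonneg) auto
  have Kle: "cmod w \<le> Ks" if "w \<in> roots" for w
    unfolding Ks_def using member_le_sum[of w roots cmod] that finite_roots(1) by simp
  have "s / (2 * Ks) > 0" using s Ks by simp
  from Y_small[OF this, of "P p"] G_large[of 3] f_step[of "1/8", simplified]
  show ?thesis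
  proof eventually_elim
    case (elim x)
    have K: "K x \<in> roots" "K (f x) \<in> roots" using elim K_root by auto
    have "1 \<le> cmod (zc x)" using Sect_sgauge(3)[OF SD_zc(1), of x] elim by (simp add: G_def)
    have "cmod (K (f x) - K x) \<le> s / (2 * Ks) * cmod (K x) / cmod (zc x)" using elim by (simp add: K_def)
    also have "\<dots> \<le> s / (2 * Ks) * Ks / 1"
      using Kle[OF K(1)] s Ks \<open>1 \<le> cmod (zc x)\<close> by (intro frac_le mult_left_mono) auto
    also have "\<dots> < s" using s Ks by simp
    finally have "dist (K (f x)) (K x) < s" by (simp add: dist_norm)
    then show ?case using sep[OF K(2,1)] by force
  qed
qed

text \<open>Finite, so that estimates hold uniformly. The unit vectors give the E_i, the rows of
  \<open>P\<close> the coordinates, and the negated rows the reciprocals needed for nonvanishing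
  limits.\<close>

definition Qs :: "('n \<Rightarrow> int) set" where
  "Qs = range (\<lambda>i j. if j = i then 1 else 0) \<union> range P \<union> range (\<lambda>l i. - P l i)"

lemma Qs: "finite Qs" "(\<lambda>j. if j = i then 1 else 0) \<in> Qs" "P l \<in> Qs" "(\<lambda>i. - P l i) \<in> Qs"
  by (auto simp: Qs_def)

end

text \<open>Turns the asymptotic statements into estimates valid on one domain with common
  constants. The 12 in \<open>Y_step\<close> is 3 * 4, with 3 from
  \<open>G x \<le> 3 * cmod (zc x)\<close> and 4 from \<open>powr_growth\<close>.\<close>

locale petal_scaled = petal f U V A a M d m P Q p J Nb
  for f :: "complex ^ 'n \<Rightarrow> complex ^ 'n" and U V A a M d m P Q p J Nb +
  fixes \<epsilon> :: real and \<Psi> :: "complex ^ 'n \<Rightarrow> complex" and C :: real and n :: nat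
  assumes eps: "\<epsilon> > 0" and C0: "C \<ge> 0"
    and Om_step: "\<And>x. x \<in> Om \<epsilon> \<Longrightarrow> x \<in> Nb \<and> G x \<ge> 1 \<and> f x \<in> SD \<and> cmod (zc (f x) - zc x - 1) \<le> 1/8 \<and>
        G (f x) \<ge> G x + 1/2 \<and> K (f x) = K x"
    and Y_step: "\<And>x q. x \<in> Om \<epsilon> \<Longrightarrow> q \<in> Qs \<Longrightarrow> cmod (Y q (f x) - Y q x) \<le> \<kappa> * \<mu> / 12 * cmod (Y q x) / cmod (zc x)"
    and Psi_holo: "\<And>x. x \<in> SD \<Longrightarrow> holo_at \<Psi> x"
    and Psi_bound: "\<And>x h. x \<in> Om \<epsilon> \<Longrightarrow> h \<ge> 1 \<Longrightarrow> (\<And>i. cmod (x $ i) \<le> h * G x powr (- \<rho> i)) \<Longrightarrow>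
        cmod (\<Psi> x) \<le> C * h ^ n * G x powr (1 - \<delta>) \<and>
        cmod (zc (f x) + \<Psi> (f x) - (zc x + \<Psi> x) - 1) \<le> C * h ^ n * G x powr (- 1 - \<delta>)"
    and Y_bound: "\<And>x h q. x \<in> Om \<epsilon> \<Longrightarrow> h \<ge> 1 \<Longrightarrow> (\<And>i. cmod (x $ i) \<le> h * G x powr (- \<rho> i)) \<Longrightarrow> q \<in> Qs \<Longrightarrow>
        cmod (Y q (f x) - Y q x) \<le> C * h ^ n * G x powr (- 1 - 2 * \<delta>) * cmod (Y q x)"

lemma (in petal) petal_scaled_exists: "\<exists>\<epsilon> \<Psi> C n. petal_scaled f U V A a M d m P Q p J Nb \<epsilon> \<Psi> C n"
proof -
  obtain \<Psi> where Psi: "\<forall>x\<in>SD. holo_at \<Psi> x" "bnd (1 - \<delta>) \<Psi>"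
     "bnd (- 1 - \<delta>) (\<lambda>x. zc (f x) + \<Psi> (f x) - (zc x + \<Psi> x) - 1)"
    using approximate_fatou_coordinate by blast
  obtain C1 n1 where 1: "C1 \<ge> 0" "\<forall>\<^sub>F x in at 0 within SD. \<forall>h\<ge>1. (\<forall>i. cmod (x $ i) \<le> h * G x powr (- \<rho> i)) \<longrightarrow>
     cmod (\<Psi> x) \<le> C1 * h ^ n1 * G x powr (1 - \<delta>)" using Psi(2) unfolding bnd_def by blast
  obtain C2 n2 where 2: "C2 \<ge> 0" "\<forall>\<^sub>F x in at 0 within SD. \<forall>h\<ge>1. (\<forall>i. cmod (x $ i) \<le> h * G x powr (- \<rho> i)) \<longrightarrow>
     cmod (zc (f x) + \<Psi> (f x) - (zc x + \<Psi> x) - 1) \<le> C2 * h ^ n2 * G x powr (- 1 - \<delta>)" using Psi(3) unfolding bnd_def by blast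
  have "\<exists>C\<ge>0. \<exists>n. \<forall>\<^sub>F x in at 0 within SD. \<forall>h\<ge>1. (\<forall>i. cmod (x $ i) \<le> h * G x powr (- \<rho> i)) \<longrightarrow>
     cmod (Y q (f x) - Y q x) \<le> C * h ^ n * G x powr (- 1 - 2 * \<delta>) * cmod (Y q x)" for q
  proof -
    obtain R where R: "bnd (- 1 - \<theta>) R" "\<forall>\<^sub>F x in at 0 within SD. Y q (f x) - Y q x = Y q x * R x"
      using bnd_Y by blast
    have "bnd (- 1 - 2 * \<delta>) R" using R(1) by (rule bnd_weaken) (use delta in linarith)
    then obtain C n where C: "C \<ge> 0" "\<forall>\<^sub>F x in at 0 within SD. \<forall>h\<ge>1. (\<forall>i. cmod (x $ i) \<le> h * G x powr (- \<rho> i)) \<longrightarrow>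
      cmod (R x) \<le> C * h ^ n * G x powr (- 1 - 2 * \<delta>)" unfolding bnd_def by blast
    have "\<forall>\<^sub>F x in at 0 within SD. \<forall>h\<ge>1. (\<forall>i. cmod (x $ i) \<le> h * G x powr (- \<rho> i)) \<longrightarrow>
      cmod (Y q (f x) - Y q x) \<le> C * h ^ n * G x powr (- 1 - 2 * \<delta>) * cmod (Y q x)"
      using C(2) R(2)
    proof eventually_elim
      case (elim x)
      then show ?case by (auto simp: norm_mult mult.commute[of "cmod (Y q x)"] intro!: mult_right_mono)
    qed
    with C(1) show ?thesis by blast
  qed
  then have "\<forall>q. \<exists>C n. C \<ge> 0 \<and> (\<forall>\<^sub>F x in at 0 within SD. \<forall>h\<ge>1. (\<forall>i. cmod (x $ i) \<le> h * G x powr (- \<rho> i)) \<longrightarrow>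
     cmod (Y q (f x) - Y q x) \<le> C * h ^ n * G x powr (- 1 - 2 * \<delta>) * cmod (Y q x))" by blast
  then obtain C3 n3 where 3: "\<And>q. C3 q \<ge> 0" "\<And>q. \<forall>\<^sub>F x in at 0 within SD. \<forall>h\<ge>1. (\<forall>i. cmod (x $ i) \<le> h * G x powr (- \<rho> i)) \<longrightarrow>
     cmod (Y q (f x) - Y q x) \<le> C3 q * h ^ n3 q * G x powr (- 1 - 2 * \<delta>) * cmod (Y q x)"
    unfolding choice_iff by blast
  define C where "C = C1 + C2 + (\<Sum>q\<in>Qs. C3 q)"
  define n where "n = n1 + n2 + (\<Sum>q\<in>Qs. n3 q)"
  have C: "C1 \<le> C" "C2 \<le> C" "0 \<le> C" using 1(1) 2(1) 3(1) sum_nonneg[of Qs C3] by (auto simp: C_def)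
  have C3: "C3 q \<le> C" "n3 q \<le> n" if "q \<in> Qs" for q
    using member_le_sum[of q Qs C3] member_le_sum[of q Qs n3] that Qs(1) 1(1) 2(1) 3(1) by (auto simp: C_def n_def)
  have n: "n1 \<le> n" "n2 \<le> n" by (auto simp: n_def)
  have le: "C' * h ^ n' * y \<le> C * h ^ n * y" if "C' \<le> C" "n' \<le> n" "h \<ge> 1" "y \<ge> 0" for C' h y :: real and n'
    using that C by (intro mult_right_mono mult_mono power_increasing) auto
  have "\<forall>\<^sub>F x in at 0 within SD. \<forall>q\<in>Qs. cmod (Y q (f x) - Y q x) \<le> \<kappa> * \<mu> / 12 * cmod (Y q x) / cmod (zc x)"
    using Qs(1) kappa mu by (intro eventually_ball_finite ballI Y_small) auto
  moreover have "\<forall>\<^sub>F x in at 0 within SD. \<forall>q\<in>Qs. \<forall>h\<ge>1. (\<forall>i. cmod (x $ i) \<le> h * G x powr (- \<rho> i)) \<longrightarrow>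
     cmod (Y q (f x) - Y q x) \<le> C3 q * h ^ n3 q * G x powr (- 1 - 2 * \<delta>) * cmod (Y q x)"
    using Qs(1) 3(2) by (intro eventually_ball_finite ballI)
  moreover have "\<forall>\<^sub>F x in at 0 within SD. x \<in> Nb"
    using eventually_SD[OF eventually_nhds_in_open[OF Nb(1,2)]] by eventually_elim auto
  ultimately have "\<forall>\<^sub>F x in at 0 within SD.
      (\<forall>q\<in>Qs. cmod (Y q (f x) - Y q x) \<le> \<kappa> * \<mu> / 12 * cmod (Y q x) / cmod (zc x)) \<and>
      (\<forall>q\<in>Qs. \<forall>h\<ge>1. (\<forall>i. cmod (x $ i) \<le> h * G x powr (- \<rho> i)) \<longrightarrow>
       cmod (Y q (f x) - Y q x) \<le> C3 q * h ^ n3 q * G x powr (- 1 - 2 * \<delta>) * cmod (Y q x)) \<and> x \<in> Nb \<and>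
      (\<forall>h\<ge>1. (\<forall>i. cmod (x $ i) \<le> h * G x powr (- \<rho> i)) \<longrightarrow> cmod (\<Psi> x) \<le> C1 * h ^ n1 * G x powr (1 - \<delta>)) \<and>
      (\<forall>h\<ge>1. (\<forall>i. cmod (x $ i) \<le> h * G x powr (- \<rho> i)) \<longrightarrow>
         cmod (zc (f x) + \<Psi> (f x) - (zc x + \<Psi> x) - 1) \<le> C2 * h ^ n2 * G x powr (- 1 - \<delta>)) \<and> G x \<ge> 1 \<and> K (f x) = K x \<and>
      f x \<in> SD \<and> cmod (zc (f x) - zc x - 1) \<le> 1/8 \<and> G (f x) \<ge> G x + 1/2"
    (is "\<forall>\<^sub>F x in _. ?A x")
    using 1(2) 2(2) G_large[of 1] K_f f_step[of "1/8", simplified] by eventually_elim simp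
  from this[unfolded eventually_at] obtain r where r: "r > 0" and r2: "\<forall>x\<in>SD. x \<noteq> 0 \<and> dist x 0 < r \<longrightarrow> ?A x"
    by (elim exE conjE)
  \<comment> \<open>Makes the bound of \<open>Om_norm_le\<close> equal to r/2.\<close>
  define \<epsilon> where "\<epsilon> = r / (2 * CARD('n) * Dc)"
  have eps: "\<epsilon> > 0" using r(1) Dc_pos by (simp add: \<epsilon>_def)
  have "real CARD('n) * (Dc * \<epsilon>) = r / 2" using Dc_pos by (simp add: \<epsilon>_def)
  then have rr: "?A x" if "x \<in> Om \<epsilon>" for x
  proof -
    have "x \<in> SD" using that by (simp add: Om_def)
    moreover from this have "x \<noteq> 0" using zero_notin_SD by blast
    moreover have "dist x 0 < r" using Om_norm_le[OF that] r \<open>real CARD('n) * (Dc * \<epsilon>) = r / 2\<close> by simp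
    ultimately have *: "x \<in> SD" "x \<noteq> 0 \<and> dist x 0 < r" by blast+
    show ?thesis by (rule mp[OF bspec[OF r2 *(1)] *(2)])
  qed
  have "petal_scaled f U V A a M d m P Q p J Nb \<epsilon> \<Psi> C n"
  proof unfold_locales
    fix x assume x: "x \<in> Om \<epsilon>"
    note A = rr[OF x]
    show "x \<in> Nb \<and> G x \<ge> 1 \<and> f x \<in> SD \<and> cmod (zc (f x) - zc x - 1) \<le> 1/8 \<and> G (f x) \<ge> G x + 1/2 \<and> K (f x) = K x"
      using A by blast
    show "cmod (Y q (f x) - Y q x) \<le> \<kappa> * \<mu> / 12 * cmod (Y q x) / cmod (zc x)" if "q \<in> Qs" for q
      using A that by blast
    fix h :: real assume h: "h \<ge> 1" "\<And>i. cmod (x $ i) \<le> h * G x powr (- \<rho> i)"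
    have "cmod (\<Psi> x) \<le> C1 * h ^ n1 * G x powr (1 - \<delta>)" using A h by blast
    also have "\<dots> \<le> C * h ^ n * G x powr (1 - \<delta>)" using C n h(1) by (intro le) auto
    finally have a: "cmod (\<Psi> x) \<le> C * h ^ n * G x powr (1 - \<delta>)" .
    have "cmod (zc (f x) + \<Psi> (f x) - (zc x + \<Psi> x) - 1) \<le> C2 * h ^ n2 * G x powr (- 1 - \<delta>)" using A h by blast
    also have "\<dots> \<le> C * h ^ n * G x powr (- 1 - \<delta>)" using C n h(1) by (intro le) auto
    finally show "cmod (\<Psi> x) \<le> C * h ^ n * G x powr (1 - \<delta>) \<and>
        cmod (zc (f x) + \<Psi> (f x) - (zc x + \<Psi> x) - 1) \<le> C * h ^ n * G x powr (- 1 - \<delta>)" using a by blast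
    fix q assume q: "q \<in> Qs"
    have "cmod (Y q (f x) - Y q x) \<le> C3 q * h ^ n3 q * G x powr (- 1 - 2 * \<delta>) * cmod (Y q x)" using A h q by blast
    also have "\<dots> \<le> C * h ^ n * G x powr (- 1 - 2 * \<delta>) * cmod (Y q x)"
      using C3[OF q] h(1) by (intro mult_right_mono[OF le]) auto
    finally show "cmod (Y q (f x) - Y q x) \<le> C * h ^ n * G x powr (- 1 - 2 * \<delta>) * cmod (Y q x)" .
  qed (use eps C Psi(1) in auto)
  then show ?thesis by blast
qed

context petal_scaled
begin

section \<open>Invariance and decay along orbits\<close>

abbreviation \<Omega> :: "(complex ^ 'n) set" where "\<Omega> \<equiv> Om \<epsilon>"

lemma Om_SD: "x \<in> \<Omega> \<Longrightarrow> x \<in> SD" by (simp add: Om_def)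

lemma Om_U: "x \<in> \<Omega> \<Longrightarrow> x \<in> U" using Om_step Nb by blast

lemma kappa_mu: "0 < \<kappa> * \<mu>" "\<kappa> * \<mu> \<le> \<delta>" "\<kappa> * \<mu> \<le> \<kappa> * \<beta> i" "\<kappa> * \<mu> \<le> \<beta> i"
proof -
  show "0 < \<kappa> * \<mu>" using kappa mu by simp
  have "\<kappa> * \<mu> \<le> 1/4 * \<mu>" using kappa mu by (intro mult_right_mono) auto
  then show "\<kappa> * \<mu> \<le> \<delta>" by (simp add: \<delta>_def)
  show "\<kappa> * \<mu> \<le> \<kappa> * \<beta> i" using kappa mu(3)[of i] by (intro mult_left_mono) auto
  have "\<kappa> * \<mu> \<le> 1 * \<mu>" using kappa mu by (intro mult_right_mono) auto
  then show "\<kappa> * \<mu> \<le> \<beta> i" using mu(3)[of i] by simp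
qed

text \<open>Needed for three values of \<sigma>: \<beta>_i gives invariance of the domain, \<kappa>
  \<beta>_i monotonicity of the weight \<open>hh\<close>, and \<delta> the convergence of Y. The
  constant \<kappa> \<mu> lies below all of them.\<close>

lemma Y_growth:
  assumes x: "x \<in> \<Omega>" and q: "q \<in> Qs" and \<sigma>: "\<sigma> \<ge> \<kappa> * \<mu>"
  shows "cmod (Y q (f x)) * G (f x) powr (- \<sigma>) \<le> cmod (Y q x) * G x powr (- \<sigma>)"
proof (rule powr_growth)
  note s = Om_step[OF x]
  show "G x \<ge> 1" "G (f x) \<ge> G x + 1/2" using s by auto
  have s0: "\<sigma> > 0" using \<sigma> kappa_mu(1) by linarith
  then show "\<sigma> > 0" .
  have z: "cmod (zc x) > 0" "G x \<le> 3 * cmod (zc x)"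
    using Sect_sgauge(3,4)[OF SD_zc(1)[OF Om_SD[OF x]]] by (auto simp: G_def)
  have "\<kappa> * \<mu> / 12 / cmod (zc x) \<le> \<sigma> / 12 / (G x / 3)"
    using z s s0 \<sigma> by (intro frac_le divide_right_mono) auto
  also have "\<dots> = \<sigma> / (4 * G x)" by simp
  finally have 1: "\<kappa> * \<mu> / 12 / cmod (zc x) \<le> \<sigma> / (4 * G x)" .
  have "cmod (Y q (f x)) \<le> cmod (Y q x) + cmod (Y q (f x) - Y q x)" by (metis norm_triangle_sub)
  also have "\<dots> \<le> cmod (Y q x) + cmod (Y q x) * (\<kappa> * \<mu> / 12 / cmod (zc x))" using Y_step[OF x q] by (simp add: mult_ac)
  also have "\<dots> \<le> cmod (Y q x) + cmod (Y q x) * (\<sigma> / (4 * G x))" by (intro add_left_mono mult_left_mono 1) auto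
  finally show "cmod (Y q (f x)) \<le> cmod (Y q x) * (1 + \<sigma> / (4 * G x))" by (simp add: distrib_left)
qed auto

lemma Om_f: assumes x: "x \<in> \<Omega>" shows "f x \<in> \<Omega>"
proof -
  have fx: "f x \<in> SD" using Om_step[OF x] by blast
  have "cmod (E i (f x)) < \<epsilon> * G (f x) powr \<beta> i" for i
  proof -
    have "cmod (E i (f x)) * G (f x) powr (- \<beta> i) \<le> cmod (E i x) * G x powr (- \<beta> i)"
      unfolding E_def by (rule Y_growth[OF x Qs(2) kappa_mu(4)])
    also have "\<dots> < \<epsilon>" using x G_pos[OF Om_SD[OF x]] by (auto simp: Om_def powr_minus field_simps)
    finally show ?thesis using G_pos[OF fx] by (simp add: powr_minus field_simps)
  qed
  then show ?thesis using fx by (simp add: Om_def)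
qed

lemma orbit_Om: "x \<in> \<Omega> \<Longrightarrow> (f ^^ j) x \<in> \<Omega>"
  by (induction j) (auto intro: Om_f)

lemma orbit_G: "x \<in> \<Omega> \<Longrightarrow> G ((f ^^ j) x) \<ge> G x + real j / 2"
proof (induction j)
  case (Suc j)
  then show ?case using Om_step[OF orbit_Om[OF Suc.prems, of j]] by (auto simp: add_divide_distrib)
qed simp

lemma G_ge1: "x \<in> \<Omega> \<Longrightarrow> G x \<ge> 1" using Om_step by blast

lemma orbit_Y:
  assumes "x \<in> \<Omega>" "q \<in> Qs" "\<sigma> \<ge> \<kappa> * \<mu>"
  shows "cmod (Y q ((f ^^ j) x)) * G ((f ^^ j) x) powr (- \<sigma>) \<le> cmod (Y q x) * G x powr (- \<sigma>)"
proof (induction j)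
  case (Suc j)
  then show ?case using Y_growth[OF orbit_Om[OF assms(1), of j] assms(2,3)] by auto
qed simp

text \<open>The weight of a starting point. The share \<kappa> \<beta>_i of the exponent compensates
  a possible growth of E_i, so \<open>hh\<close> does not increase along orbits; the remaining share
  \<rho>_i is the decay of x_i.\<close>

definition hh :: "complex ^ 'n \<Rightarrow> real" where
  "hh x = 1 + Dc * (\<Sum>i\<in>UNIV. cmod (E i x) * G x powr (- (\<kappa> * \<beta> i)))"

lemma hh_ge1: "hh x \<ge> 1"
  unfolding hh_def using Dc_pos by (simp add: sum_nonneg)

lemma hh_orbit:
  assumes "x \<in> \<Omega>"
  shows "hh ((f ^^ j) x) \<le> hh x"
  unfolding hh_def E_def using Dc_pos
  by (intro add_left_mono mult_left_mono sum_mono orbit_Y assms Qs(2) kappa_mu(3)) auto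

lemma coordinate_hh:
  assumes x: "x \<in> SD"
  shows "cmod (x $ i) \<le> hh x * G x powr (- \<rho> i)"
proof -
  have "cmod (x $ i) \<le> Dc * cmod (E i x) * G x powr (- \<beta> i)" by (rule coordinate_bounds[OF x])
  also have "- \<beta> i = - (\<kappa> * \<beta> i) + - \<rho> i" by (simp add: \<rho>_def algebra_simps)
  also have "Dc * cmod (E i x) * G x powr (- (\<kappa> * \<beta> i) + - \<rho> i) = (Dc * (cmod (E i x) * G x powr (- (\<kappa> * \<beta> i)))) * G x powr (- \<rho> i)"
    by (subst powr_add) (simp add: mult_ac)
  also have "\<dots> \<le> hh x * G x powr (- \<rho> i)"
  proof (intro mult_right_mono)
    have "cmod (E i x) * G x powr (- (\<kappa> * \<beta> i)) \<le> (\<Sum>i\<in>UNIV. cmod (E i x) * G x powr (- (\<kappa> * \<beta> i)))"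
      by (rule member_le_sum) auto
    then show "Dc * (cmod (E i x) * G x powr (- (\<kappa> * \<beta> i))) \<le> hh x"
      unfolding hh_def using Dc_pos by (intro add_increasing mult_left_mono) auto
  qed auto
  finally show ?thesis .
qed

text \<open>Bounds the weight by the E_i alone, hence uniformly when z is scaled up with the E_i
  fixed.\<close>

lemma hh_le:
  assumes "x \<in> \<Omega>"
  shows "hh x \<le> 1 + Dc * (\<Sum>i\<in>UNIV. cmod (E i x))"
  unfolding hh_def
proof (intro add_left_mono mult_left_mono sum_mono)
  fix i
  have "G x powr (- (\<kappa> * \<beta> i)) \<le> G x powr 0" using G_ge1[OF assms] kappa_mu(1) kappa_mu(3)[of i] by (intro powr_mono) auto
  then have "G x powr (- (\<kappa> * \<beta> i)) \<le> 1" using G_ge1[OF assms] by simp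
  then show "cmod (E i x) * G x powr (- (\<kappa> * \<beta> i)) \<le> cmod (E i x)" by (simp add: mult_left_le)
qed (use Dc_pos in auto)

lemma continuous_on_hh: "continuous_on \<Omega> hh"
proof -
  have "continuous_on SD hh" unfolding hh_def[abs_def]
    using G_pos by (intro continuous_intros continuous_on_SD_holo holo_at_E continuous_on_G) force+
  then show ?thesis using Om_SD by (meson continuous_on_subset subsetI)
qed

lemma continuous_on_GOm: "continuous_on \<Omega> G"
  using continuous_on_G Om_SD by (meson continuous_on_subset subsetI)

lemma orbit_coordinate:
  assumes "x \<in> \<Omega>"
  shows "cmod ((f ^^ j) x $ i) \<le> hh x * G ((f ^^ j) x) powr (- \<rho> i)"
  using coordinate_hh[OF Om_SD[OF orbit_Om[OF assms]], of j i] hh_orbit[OF assms, of j]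
  by (meson mult_right_mono order_trans powr_ge_zero)

lemma orbit_to_0:
  assumes "compact Kc" "Kc \<subseteq> \<Omega>"
  shows "uniform_limit Kc (\<lambda>j. f ^^ j) (\<lambda>_. 0) sequentially"
proof -
  have "bounded (hh ` Kc)"
    using assms by (intro compact_imp_bounded compact_continuous_image continuous_on_subset[OF continuous_on_hh])
  then obtain B where B: "\<And>x. x \<in> Kc \<Longrightarrow> hh x \<le> B"
    unfolding bounded_iff by (metis abs_le_D1 imageI real_norm_def)
  have lim: "(\<lambda>j. (\<Sum>i::'n\<in>UNIV. B * (real j / 2) powr (- \<rho> i))) \<longlonglongrightarrow> (\<Sum>i::'n\<in>UNIV. B * 0)"
  proof (intro tendsto_sum tendsto_mult_left tendsto_neg_powr)
    show "filterlim (\<lambda>j. real j / 2) at_top sequentially"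
      using filterlim_tendsto_pos_mult_at_top[OF tendsto_const _ filterlim_real_sequentially, of "1/2"] by simp
  qed (use rho(2) in auto)
  show ?thesis
  proof (rule uniform_limitI)
    fix e :: real assume "e > 0"
    then have "\<forall>\<^sub>F j in sequentially. (\<Sum>i\<in>UNIV. B * (real j / 2) powr (- \<rho> i)) < e"
      using lim by (intro order_tendstoD(2)[OF lim]) auto
    then show "\<forall>\<^sub>F j in sequentially. \<forall>x\<in>Kc. dist ((f ^^ j) x) 0 < e"
      using eventually_gt_at_top[of "0::nat"]
    proof eventually_elim
      case (elim j)
      have "dist ((f ^^ j) x) 0 < e" if x: "x \<in> Kc" for x
      proof -
        have xO: "x \<in> \<Omega>" using x assms by blast
        have "norm ((f ^^ j) x) \<le> (\<Sum>i\<in>UNIV. cmod ((f ^^ j) x $ i))" by (rule norm_vec_le_sum)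
        also have "\<dots> \<le> (\<Sum>i\<in>UNIV. B * (real j / 2) powr (- \<rho> i))"
        proof (intro sum_mono order_trans[OF orbit_coordinate[OF xO]] mult_mono B[OF x] powr_mono2')
          show "real j / 2 \<le> G ((f ^^ j) x)" using orbit_G[OF xO, of j] G_ge1[OF xO] by linarith
        qed (use rho(2) elim hh_ge1[of x] B[OF x] in \<open>auto simp: less_imp_le\<close>)
        finally show ?thesis using elim by simp
      qed
      then show ?case by blast
    qed
  qed
qed

lemma holo_f_iter: "x \<in> \<Omega> \<Longrightarrow> holo_map_at (f ^^ j) x"
proof (induction j)
  case 0
  then show ?case by (simp add: holo_map_at_ident id_def)
next
  case (Suc j)
  have "holo_map_at f ((f ^^ j) x)"
    using f_bihol Om_U[OF orbit_Om[OF Suc.prems]] by (auto simp: biholomorphism_def holomorphic_map_on_iff)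
  then show ?case using Suc holo_map_at_compose[of "f ^^ j" x f] by (simp add: o_def)
qed

section \<open>Limits along orbits\<close>

definition wt :: "nat \<Rightarrow> real" where "wt j = (1 + real j / 2) powr (- 1 - \<delta> / 2)"

lemma wt: "summable wt" "wt j \<ge> 0"
  using summable_weight[of "\<delta> / 2"] delta(1) by (simp_all add: wt_def[abs_def])

lemma orbit_wt:
  assumes "x \<in> \<Omega>"
  shows "G ((f ^^ j) x) powr (- 1 - \<delta>) \<le> G x powr (- \<delta> / 2) * wt j"
proof -
  have "G ((f ^^ j) x) powr (- 1 - \<delta>) \<le> (G x + real j / 2) powr (- 1 - \<delta>)"
    using orbit_G[OF assms, of j] G_ge1[OF assms] delta(1) by (intro powr_mono2') auto
  also have "\<dots> \<le> G x powr (- \<delta> / 2) * wt j" unfolding wt_def by (intro weight_le G_ge1 assms delta)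
  finally show ?thesis .
qed

definition psi0 :: "complex ^ 'n \<Rightarrow> complex" where "psi0 x = zc x + \<Psi> x"

lemma holo_psi0: "x \<in> SD \<Longrightarrow> holo_at psi0 x"
  unfolding psi0_def[abs_def] using SD_zc by (intro holo_at_add holo_at_zc Psi_holo)

lemma holo_Y: "x \<in> SD \<Longrightarrow> (\<And>i. m i = 0 \<Longrightarrow> q i \<ge> 0) \<Longrightarrow> holo_at (Y q) x"
proof -
  assume x: "x \<in> SD" and q: "\<And>i. m i = 0 \<Longrightarrow> q i \<ge> 0"
  have "x $ i \<noteq> 0" if "m i \<noteq> 0" for i
    using SD_zc(2)[OF x] that d by (auto simp: u_def monom_power_def M_eq)
  then show "holo_at (Y q) x" unfolding Y_def[abs_def]
    using q by (intro holo_at_mult holo_at_exp holo_at_const holo_at_Ln_zc x holo_at_lmono) blast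
qed

definition Bc :: "complex ^ 'n \<Rightarrow> real" where "Bc x = C * hh x ^ n * G x powr (- \<delta> / 2)"

lemma continuous_on_Bc: "continuous_on \<Omega> Bc"
  unfolding Bc_def[abs_def] using G_pos Om_SD
  by (intro continuous_intros continuous_on_hh continuous_on_GOm) force+

lemma psi_exists:
  "\<exists>\<psi>. \<forall>x\<in>\<Omega>. holo_at \<psi> x \<and> (\<lambda>j. psi0 ((f ^^ j) x) - of_nat j) \<longlonglongrightarrow> \<psi> x \<and> cmod (\<psi> x - psi0 x) \<le> Bc x * suminf wt"
proof -
  have "\<exists>L. \<forall>x\<in>\<Omega>. holo_at L x \<and> (\<lambda>j. psi0 ((f ^^ j) x) - of_nat j) \<longlonglongrightarrow> L x \<and>
      cmod (L x - (psi0 ((f ^^ 0) x) - of_nat 0)) \<le> Bc x * suminf wt"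
  proof (rule telescoping_limit[OF open_Om _ _ wt continuous_on_Bc])
    fix j x assume x: "x \<in> \<Omega>"
    show "holo_at (\<lambda>x. psi0 ((f ^^ j) x) - of_nat j) x"
      by (intro holo_at_diff holo_at_const holo_at_compose[OF holo_f_iter] x holo_psi0 Om_SD orbit_Om)
    let ?y = "(f ^^ j) x"
    have y: "?y \<in> \<Omega>" using orbit_Om[OF x] .
    have "cmod (psi0 ((f ^^ Suc j) x) - of_nat (Suc j) - (psi0 ?y - of_nat j))
        = cmod (zc (f ?y) + \<Psi> (f ?y) - (zc ?y + \<Psi> ?y) - 1)"
      by (simp add: psi0_def algebra_simps)
    also have "\<dots> \<le> C * hh x ^ n * G ?y powr (- 1 - \<delta>)"
      using Psi_bound[OF y hh_ge1[of x] orbit_coordinate[OF x]] by blast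
    also have "\<dots> \<le> C * hh x ^ n * (G x powr (- \<delta> / 2) * wt j)"
      using C0 hh_ge1[of x] by (intro mult_left_mono orbit_wt x) auto
    finally show "cmod (psi0 ((f ^^ Suc j) x) - of_nat (Suc j) - (psi0 ((f ^^ j) x) - of_nat j)) \<le> Bc x * wt j"
      by (simp add: Bc_def mult_ac)
  qed
  then show ?thesis by simp
qed

lemma Yinf_exists:
  assumes q: "q \<in> Qs" "\<And>i. m i = 0 \<Longrightarrow> q i \<ge> 0"
  shows "\<exists>\<psi>. \<forall>x\<in>\<Omega>. holo_at \<psi> x \<and> (\<lambda>j. Y q ((f ^^ j) x)) \<longlonglongrightarrow> \<psi> x \<and> cmod (\<psi> x - Y q x) \<le> Bc x * cmod (Y q x) * suminf wt"
proof -
  have contY: "continuous_on \<Omega> (Y q)"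
    by (intro continuous_at_imp_continuous_on ballI holo_at_imp_isCont holo_Y Om_SD q(2))
  have "\<exists>L. \<forall>x\<in>\<Omega>. holo_at L x \<and> (\<lambda>j. Y q ((f ^^ j) x)) \<longlonglongrightarrow> L x \<and>
      cmod (L x - Y q ((f ^^ 0) x)) \<le> Bc x * cmod (Y q x) * suminf wt"
  proof (rule telescoping_limit[OF open_Om _ _ wt])
    show "continuous_on \<Omega> (\<lambda>x. Bc x * cmod (Y q x))" by (intro continuous_intros continuous_on_Bc contY)
    fix j x assume x: "x \<in> \<Omega>"
    show "holo_at (\<lambda>x. Y q ((f ^^ j) x)) x"
      by (intro holo_at_compose[OF holo_f_iter] x holo_Y q Om_SD orbit_Om)
    let ?y = "(f ^^ j) x"
    have y: "?y \<in> \<Omega>" using orbit_Om[OF x] .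
    \<comment> \<open>As yet Y may grow like G^\<delta>; one half of the excess 2\<delta> in
      \<open>Y_bound\<close> is spent on this, the other half keeps the increments summable.\<close>
    have "cmod (Y q ?y) * G ?y powr (- \<delta>) \<le> cmod (Y q x) * G x powr (- \<delta>)"
      by (rule orbit_Y[OF x q(1) kappa_mu(2)])
    also have "G x powr (- \<delta>) \<le> G x powr 0" using G_ge1[OF x] delta by (intro powr_mono) auto
    finally have Yy: "cmod (Y q ?y) * G ?y powr (- \<delta>) \<le> cmod (Y q x)" using G_ge1[OF x] by (simp add: mult_left_mono)
    have "cmod (Y q ((f ^^ Suc j) x) - Y q ?y) \<le> C * hh x ^ n * G ?y powr (- 1 - 2 * \<delta>) * cmod (Y q ?y)"
      using Y_bound[OF y hh_ge1[of x] orbit_coordinate[OF x] q(1)] by simp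
    also have "G ?y powr (- 1 - 2 * \<delta>) = G ?y powr (- 1 - \<delta>) * G ?y powr (- \<delta>)"
      by (subst powr_add[symmetric]) (rule arg_cong[where f = "\<lambda>e. _ powr e"], simp)
    also have "C * hh x ^ n * (G ?y powr (- 1 - \<delta>) * G ?y powr (- \<delta>)) * cmod (Y q ?y) =
        C * hh x ^ n * G ?y powr (- 1 - \<delta>) * (cmod (Y q ?y) * G ?y powr (- \<delta>))" by (simp add: mult_ac)
    also have "\<dots> \<le> C * hh x ^ n * (G x powr (- \<delta> / 2) * wt j) * cmod (Y q x)"
      using C0 hh_ge1[of x] wt(2)[of j] by (intro mult_mono orbit_wt x Yy) auto
    finally show "cmod (Y q ((f ^^ Suc j) x) - Y q ((f ^^ j) x)) \<le> Bc x * cmod (Y q x) * wt j"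
      by (simp add: Bc_def mult_ac)
  qed
  then show ?thesis by simp
qed

definition \<psi> :: "complex ^ 'n \<Rightarrow> complex" where
  "\<psi> = (SOME \<psi>. \<forall>x\<in>\<Omega>. holo_at \<psi> x \<and> (\<lambda>j. psi0 ((f ^^ j) x) - of_nat j) \<longlonglongrightarrow> \<psi> x \<and> cmod (\<psi> x - psi0 x) \<le> Bc x * suminf wt)"

definition Yinf :: "('n \<Rightarrow> int) \<Rightarrow> complex ^ 'n \<Rightarrow> complex" where
  "Yinf q = (SOME \<psi>. \<forall>x\<in>\<Omega>. holo_at \<psi> x \<and> (\<lambda>j. Y q ((f ^^ j) x)) \<longlonglongrightarrow> \<psi> x \<and> cmod (\<psi> x - Y q x) \<le> Bc x * cmod (Y q x) * suminf wt)"

lemma psi: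
  assumes "x \<in> \<Omega>"
  shows "holo_at \<psi> x" "(\<lambda>j. psi0 ((f ^^ j) x) - of_nat j) \<longlonglongrightarrow> \<psi> x" "cmod (\<psi> x - psi0 x) \<le> Bc x * suminf wt"
  using someI_ex[OF psi_exists, folded \<psi>_def] assms by blast+

lemma Yinf:
  assumes "q \<in> Qs" "\<And>i. m i = 0 \<Longrightarrow> q i \<ge> 0" "x \<in> \<Omega>"
  shows "holo_at (Yinf q) x" "(\<lambda>j. Y q ((f ^^ j) x)) \<longlonglongrightarrow> Yinf q x"
    "cmod (Yinf q x - Y q x) \<le> Bc x * cmod (Y q x) * suminf wt"
  using someI_ex[OF Yinf_exists[OF assms(1,2)], folded Yinf_def] assms(3) by blast+

lemma psi_f: assumes x: "x \<in> \<Omega>" shows "\<psi> (f x) = \<psi> x + 1"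
proof -
  have "(\<lambda>j. psi0 ((f ^^ Suc j) x) - of_nat (Suc j)) \<longlonglongrightarrow> \<psi> x"
    using psi(2)[OF x] by (rule LIMSEQ_Suc)
  then have "(\<lambda>j. (psi0 ((f ^^ Suc j) x) - of_nat (Suc j)) + 1) \<longlonglongrightarrow> \<psi> x + 1" by (intro tendsto_add tendsto_const)
  then have "(\<lambda>j. psi0 ((f ^^ j) (f x)) - of_nat j) \<longlonglongrightarrow> \<psi> x + 1"
    by (simp add: funpow_swap1)
  then show ?thesis using psi(2)[OF Om_f[OF x]] LIMSEQ_unique by blast
qed

lemma Yinf_f:
  assumes "q \<in> Qs" "\<And>i. m i = 0 \<Longrightarrow> q i \<ge> 0" "x \<in> \<Omega>"
  shows "Yinf q (f x) = Yinf q x"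
proof -
  have "(\<lambda>j. Y q ((f ^^ Suc j) x)) \<longlonglongrightarrow> Yinf q x" using Yinf(2)[OF assms] by (rule LIMSEQ_Suc)
  then have "(\<lambda>j. Y q ((f ^^ j) (f x))) \<longlonglongrightarrow> Yinf q x" by (simp add: funpow_swap1)
  then show ?thesis using Yinf(2)[OF assms(1,2) Om_f[OF assms(3)]] LIMSEQ_unique by blast
qed

text \<open>The exponent 1 - \<delta> is below that of z, so the difference disappears when z is
  divided by a large scale.\<close>

lemma psi_close:
  assumes x: "x \<in> \<Omega>"
  shows "cmod (\<psi> x - zc x) \<le> (1 + suminf wt) * C * hh x ^ n * G x powr (1 - \<delta>)"
proof -
  have "cmod (\<psi> x - zc x) \<le> cmod (\<psi> x - psi0 x) + cmod (\<Psi> x)"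
    using norm_triangle_ineq[of "\<psi> x - psi0 x" "\<Psi> x"] by (simp add: psi0_def)
  also have "cmod (\<Psi> x) \<le> C * hh x ^ n * G x powr (1 - \<delta>)"
    using Psi_bound[OF x hh_ge1 coordinate_hh[OF Om_SD[OF x]]] by blast
  also have "cmod (\<psi> x - psi0 x) \<le> C * hh x ^ n * G x powr (1 - \<delta>) * suminf wt"
  proof (rule order_trans[OF psi(3)[OF x]])
    have "Bc x \<le> C * hh x ^ n * G x powr (1 - \<delta>)" unfolding Bc_def
      using G_ge1[OF x] C0 hh_ge1[of x] delta by (intro mult_left_mono powr_mono) auto
    then show "Bc x * suminf wt \<le> C * hh x ^ n * G x powr (1 - \<delta>) * suminf wt"
      by (intro mult_right_mono suminf_nonneg wt)
  qed
  finally show ?thesis by (simp add: algebra_simps)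
qed

end

section \<open>Charts of the petals\<close>

context petal_scaled
begin

definition Mod :: "(complex ^ 'n) set" where "Mod = {\<xi>. \<forall>l\<in>J - {p}. \<xi> $ l \<noteq> 0}"
definition MS :: "(complex ^ 'n) set" where "MS = {\<xi> \<in> Mod. \<xi> $ p \<in> Sect}"
text \<open>Coordinate \<open>p\<close> of a point holds z, but the monomial map \<open>Q\<close>
  expects the value of \<open>K\<close> there; on one petal this is the constant
  \<open>w\<close>.\<close>

definition sub :: "complex \<Rightarrow> complex ^ 'n \<Rightarrow> complex ^ 'n" where "sub w \<xi> = (\<chi> l. if l = p then w else \<xi> $ l)"
definition Eh :: "complex \<Rightarrow> complex ^ 'n \<Rightarrow> 'n \<Rightarrow> complex" where "Eh w \<xi> i = lmono (Q i) (sub w \<xi>)"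
definition X :: "complex \<Rightarrow> complex ^ 'n \<Rightarrow> complex ^ 'n" where
  "X w \<xi> = (\<chi> i. Eh w \<xi> i * exp (- (\<alpha> i * Ln (\<xi> $ p))))"
definition Zm :: "complex ^ 'n \<Rightarrow> complex ^ 'n" where "Zm x = (\<chi> l. if l = p then zc x else Y (P l) x)"

text \<open>\<open>P\<close> and \<open>Q\<close> define inverse monomial maps, so the E_i are
  recovered from \<open>w\<close> and the other coordinates and x_i from E_i by a power of the
  prescribed z. That z comes out right follows from w^d = -1/b and
  \<open>d * lam (P p) = 1\<close>.\<close>

lemma X_props:
  assumes w: "w \<in> roots" and xi: "\<xi> \<in> MS"
  shows "X w \<xi> \<in> SD" "zc (X w \<xi>) = \<xi> $ p" "E i (X w \<xi>) = Eh w \<xi> i" "K (X w \<xi>) = w" "Zm (X w \<xi>) = \<xi>"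
proof -
  let ?x = "X w \<xi>"
  have s: "\<xi> $ p \<in> Sect" using xi by (simp add: MS_def)
  have s0: "\<xi> $ p \<noteq> 0" using Sect_sgauge(4)[OF s] .
  have w0: "w \<noteq> 0" using root_nonzero[OF w] .
  have "lmono (P l) (\<chi> i. lmono (Q i) (sub w \<xi>)) = sub w \<xi> $ l" for l
  proof (rule lmono_inverse[OF PQ])
    fix l'
    show "sub w \<xi> $ l' \<noteq> 0 \<or> (\<forall>i k. P i k * Q k l' \<ge> 0)"
    proof (cases "l' \<in> J")
      case True
      then show ?thesis using xi w0 by (auto simp: sub_def MS_def Mod_def)
    next
      case False
      then show ?thesis using notJ(2) by blast
    qed
  qed
  then have PE: "lmono (P l) (\<chi> i. Eh w \<xi> i) = sub w \<xi> $ l" for l by (simp add: Eh_def)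
  have PX: "lmono (P l) ?x = sub w \<xi> $ l * exp (- (lam (P l) * Ln (\<xi> $ p)))" for l
  proof -
    have "lmono (P l) ?x = lmono (P l) (\<chi> i. (\<chi> i. Eh w \<xi> i) $ i * (\<chi> i. exp (- (\<alpha> i * Ln (\<xi> $ p)))) $ i)"
      by (simp add: X_def)
    also have "\<dots> = sub w \<xi> $ l * exp (\<Sum>i\<in>UNIV. of_int (P l i) * - (\<alpha> i * Ln (\<xi> $ p)))"
      by (subst lmono_mult) (simp only: PE lmono_exp)
    finally show ?thesis by (simp add: lam_def sum_distrib_right mult.assoc sum_negf)
  qed
  have "u ?x = (w * exp (- (lam (P p) * Ln (\<xi> $ p)))) ^ d"
    by (simp add: u_def monom_power_M PX sub_def)
  also have "\<dots> = w ^ d * exp (- (of_nat d * lam (P p) * Ln (\<xi> $ p)))"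
    by (simp add: power_mult_distrib exp_of_nat_mult[symmetric] mult.assoc)
  also have "\<dots> = - 1 / b * (1 / \<xi> $ p)" using w s0 by (simp add: lam_p roots_def exp_minus divide_inverse)
  finally have u: "u ?x = - 1 / (b * \<xi> $ p)" by simp
  then show z: "zc ?x = \<xi> $ p" using b0 s0 by (simp add: zc_def)
  show SD: "?x \<in> SD" using s s0 b0 by (simp add: SD_def z) (simp add: u)
  have YX: "Y (P l) ?x = sub w \<xi> $ l" for l
    by (simp add: Y_def PX z mult.assoc exp_add[symmetric])
  show "K ?x = w" by (simp add: K_def YX) (simp add: sub_def)
  show "E i ?x = Eh w \<xi> i" unfolding E_eq z by (simp add: X_def mult.assoc exp_add[symmetric])
  show "Zm ?x = \<xi>" by (simp add: Zm_def vec_eq_iff z YX) (simp add: sub_def)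
qed

lemma SD_coordinate: "x \<in> SD \<Longrightarrow> m i \<noteq> 0 \<Longrightarrow> x $ i \<noteq> 0"
  using SD_zc(2)[of x] d by (auto simp: u_def monom_power_def M_eq)

lemma Y_E: "Y q x = lmono q (\<chi> i. E i x)"
proof -
  have "lmono q (\<chi> i. E i x) = lmono q (\<chi> i. x $ i * (\<chi> i. exp (\<alpha> i * Ln (zc x))) $ i)" by (simp add: E_eq)
  also have "\<dots> = lmono q x * exp (\<Sum>i\<in>UNIV. of_int (q i) * (\<alpha> i * Ln (zc x)))" by (simp only: lmono_mult lmono_exp)
  finally show ?thesis by (simp add: Y_def lam_def sum_distrib_right mult.assoc)
qed

lemma Zm_props:
  assumes x: "x \<in> SD"
  shows "Zm x \<in> MS" "Eh (K x) (Zm x) i = E i x" "X (K x) (Zm x) = x"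
proof -
  have "Y (P l) x \<noteq> 0" if "l \<in> J" for l
    unfolding Y_def using m0(3)[OF that] SD_coordinate[OF x] by (auto intro!: lmono_nonzero)
  then show "Zm x \<in> MS" using SD_zc(1)[OF x] by (auto simp: MS_def Mod_def Zm_def)
  have sub: "sub (K x) (Zm x) = (\<chi> l. lmono (P l) (\<chi> i. E i x))"
    by (auto simp: sub_def Zm_def K_def vec_eq_iff Y_E)
  have Ei: "Eh (K x) (Zm x) i = E i x" for i
  proof -
    have "lmono (Q i) (\<chi> l. lmono (P l) (\<chi> i. E i x)) = (\<chi> i. E i x) $ i"
    proof (rule lmono_inverse[OF QP])
      fix i'
      show "(\<chi> i. E i x) $ i' \<noteq> 0 \<or> (\<forall>i k. Q i k * P k i' \<ge> 0)"
      proof (cases "m i' = 0")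
        case True
        then show ?thesis using m0(2) by blast
      next
        case False
        then show ?thesis using SD_coordinate[OF x] by (simp add: E_eq)
      qed
    qed
    then show ?thesis by (simp add: Eh_def sub)
  qed
  then show "Eh (K x) (Zm x) i = E i x" .
  show "X (K x) (Zm x) = x"
  proof (simp add: vec_eq_iff X_def Ei, intro allI)
    fix i
    have "Zm x $ p = zc x" by (simp add: Zm_def)
    then show "E i x * exp (- (\<alpha> i * Ln (Zm x $ p))) = x $ i"
      by (simp add: E_eq mult.assoc exp_add[symmetric])
  qed
qed

lemma holo_sub: "holo_map_at (sub w) \<xi>"
  unfolding holo_map_at_def
proof
  fix i show "holo_at (\<lambda>\<xi>. sub w \<xi> $ i) \<xi>" by (cases "i = p") (auto simp: sub_def)
qed

lemma holo_Eh:
  assumes "w \<noteq> 0" "\<xi> \<in> Mod"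
  shows "holo_at (\<lambda>\<xi>. Eh w \<xi> i) \<xi>"
  unfolding Eh_def
proof (rule holo_at_compose[OF holo_sub holo_at_lmono])
  fix l
  show "sub w \<xi> $ l \<noteq> 0 \<or> 0 \<le> Q i l" using assms notJ(1)[of l i] by (cases "l \<in> J") (auto simp: sub_def Mod_def)
qed

lemma holo_X:
  assumes "w \<noteq> 0" "\<xi> \<in> MS"
  shows "holo_map_at (X w) \<xi>"
  unfolding holo_map_at_def X_def using assms Sect_sgauge(5)[of "\<xi> $ p"]
  by (auto simp: MS_def intro!: holo_at_mult holo_Eh holo_at_exp holo_at_uminus holo_at_Ln)

lemma holo_Zm: "x \<in> SD \<Longrightarrow> holo_map_at Zm x"
  unfolding holo_map_at_def
proof
  fix l assume x: "x \<in> SD"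
  show "holo_at (\<lambda>x. Zm x $ l) x"
  proof (cases "l = p")
    case True
    then show ?thesis using holo_at_zc[OF SD_zc(2)[OF x]] by (simp add: Zm_def)
  next
    case False
    have "holo_at (Y (P l)) x" by (rule holo_Y[OF x m0(1)])
    then show ?thesis using False by (simp add: Zm_def)
  qed
qed

lemma open_MS: "open MS"
proof -
  have "MS = (\<Inter>l\<in>J - {p}. {\<xi>. \<xi> $ l \<noteq> 0}) \<inter> (\<lambda>\<xi>. \<xi> $ p) -` Sect" by (auto simp: MS_def Mod_def)
  moreover have "open ((\<lambda>\<xi> :: complex ^ 'n. \<xi> $ p) -` Sect)"
    by (intro open_vimage open_Sect continuous_intros)
  moreover have "open (\<Inter>l\<in>J - {p}. {\<xi> :: complex ^ 'n. \<xi> $ l \<noteq> 0})"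
    by (intro open_INT ballI open_Collect_neq continuous_intros) auto
  ultimately show ?thesis by auto
qed

section \<open>The petals in coordinates and their connectedness\<close>

definition Omk :: "complex \<Rightarrow> (complex ^ 'n) set" where "Omk w = {x \<in> \<Omega>. K x = w}"
definition Dk :: "complex \<Rightarrow> (complex ^ 'n) set" where
  "Dk w = {\<xi> \<in> MS. \<forall>i. cmod (Eh w \<xi> i) < \<epsilon> * sgauge (\<xi> $ p) powr \<beta> i}"

lemma X_Dk:
  assumes "w \<in> roots" "\<xi> \<in> Dk w"
  shows "X w \<xi> \<in> Omk w"
  using X_props[OF assms(1), of \<xi>] assms(2) by (auto simp: Dk_def Omk_def Om_def G_def)

lemma Zm_Dk: "x \<in> Omk w \<Longrightarrow> Zm x \<in> Dk w \<and> X w (Zm x) = x"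
  using Zm_props[of x] by (auto simp: Omk_def Om_def Dk_def G_def) (simp add: Zm_def)

lemma Omk_image: "w \<in> roots \<Longrightarrow> Omk w = X w ` Dk w"
  using X_Dk Zm_Dk by force

lemma open_Omk: "open (Omk w)"
proof -
  have "continuous_on \<Omega> K" unfolding K_def
    by (intro continuous_at_imp_continuous_on ballI holo_at_imp_isCont holo_Y Om_SD m0(1))
  \<comment> \<open>As \<open>K\<close> takes only finitely many values, the level set is also given
    by the open condition of avoiding the other roots.\<close>
  moreover have "open (- (roots - {w}))" using finite_roots(1) by (intro open_Compl finite_imp_closed) auto
  ultimately have "open (\<Omega> \<inter> K -` (- (roots - {w})))"
    by (intro continuous_open_preimage open_Om)
  moreover have "\<Omega> \<inter> K -` (- (roots - {w})) = Omk w" using K_root[OF Om_SD] by (auto simp: Omk_def)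
  ultimately show ?thesis by simp
qed

definition sc :: "real \<Rightarrow> complex ^ 'n \<Rightarrow> complex ^ 'n" where
  "sc t \<xi> = (\<chi> l. if l = p then of_real t * \<xi> $ p else \<xi> $ l)"

lemma sc_sc: "sc s (sc t \<xi>) = sc (s * t) \<xi>" and sc_1: "sc 1 \<xi> = \<xi>"
  by (auto simp: sc_def vec_eq_iff)

lemma sc_nth: "sc t \<xi> $ p = of_real t * \<xi> $ p" "l \<noteq> p \<Longrightarrow> sc t \<xi> $ l = \<xi> $ l" by (auto simp: sc_def)

lemma holo_sc: "holo_map_at (sc t) \<xi>"
  unfolding holo_map_at_def
proof
  fix i show "holo_at (\<lambda>\<xi>. sc t \<xi> $ i) \<xi>" by (cases "i = p") (auto simp: sc_def intro!: holo_at_intros)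
qed

lemma Sect_scale: "t > 0 \<Longrightarrow> z \<in> Sect \<Longrightarrow> of_real t * z \<in> Sect"
  by (auto simp: Sect_def abs_mult distrib_left[symmetric])

lemma sgauge_scale: "t > 0 \<Longrightarrow> sgauge (of_real t * z) = t * sgauge z"
  by (simp add: sgauge_def abs_mult algebra_simps)

lemma sc_MS: "t > 0 \<Longrightarrow> \<xi> \<in> MS \<Longrightarrow> sc t \<xi> \<in> MS"
  using Sect_scale by (auto simp: MS_def Mod_def sc_def)

lemma Eh_sc: "Eh w (sc t \<xi>) = Eh w \<xi>"
proof -
  have "sub w (sc t \<xi>) = sub w \<xi>" by (auto simp: sub_def sc_def vec_eq_iff)
  then show ?thesis by (simp add: Eh_def fun_eq_iff)
qed

lemma sc_Dk:
  assumes "\<xi> \<in> Dk w" "t \<ge> 1"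
  shows "sc t \<xi> \<in> Dk w"
proof -
  have xi: "\<xi> \<in> MS" "\<And>i. cmod (Eh w \<xi> i) < \<epsilon> * sgauge (\<xi> $ p) powr \<beta> i" using assms by (auto simp: Dk_def)
  have g: "sgauge (\<xi> $ p) > 0" using Sect_sgauge(1) xi(1) by (simp add: MS_def)
  have "cmod (Eh w \<xi> i) < \<epsilon> * (t * sgauge (\<xi> $ p)) powr \<beta> i" for i
  proof -
    have "sgauge (\<xi> $ p) powr \<beta> i \<le> (t * sgauge (\<xi> $ p)) powr \<beta> i"
      using g assms(2) beta_pos[of i] by (intro powr_mono2) auto
    then have "\<epsilon> * sgauge (\<xi> $ p) powr \<beta> i \<le> \<epsilon> * (t * sgauge (\<xi> $ p)) powr \<beta> i" using eps by simp
    with xi(2)[of i] show ?thesis by linarith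
  qed
  then show ?thesis using sc_MS[of t \<xi>] xi(1) assms(2) by (simp add: Dk_def Eh_sc sc_nth sgauge_scale)
qed

lemma continuous_on_Eh: "w \<noteq> 0 \<Longrightarrow> continuous_on MS (\<lambda>\<xi>. Eh w \<xi> i)"
  by (intro continuous_at_imp_continuous_on ballI holo_at_imp_isCont holo_Eh) (auto simp: MS_def)

lemma compact_MS_bounds:
  assumes "compact Kc" "Kc \<subseteq> MS" "w \<noteq> 0"
  shows "\<exists>B c c'. B > 0 \<and> c > 0 \<and> c' > 0 \<and> (\<forall>\<xi>\<in>Kc. (\<forall>i. cmod (Eh w \<xi> i) \<le> B) \<and> norm \<xi> \<le> B \<and> c \<le> sgauge (\<xi> $ p) \<and> sgauge (\<xi> $ p) \<le> c')"
proof (cases "Kc = {}")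
  case True
  then show ?thesis by (intro exI[of _ 1]) auto
next
  case False
  have "bounded ((\<lambda>\<xi>. Eh w \<xi> i) ` Kc)" for i
    using assms by (intro compact_imp_bounded compact_continuous_image continuous_on_subset[OF continuous_on_Eh])
  then have "\<forall>i. \<exists>B. \<forall>\<xi>\<in>Kc. cmod (Eh w \<xi> i) \<le> B" unfolding bounded_iff by blast
  then obtain Bi where Bi: "\<And>i \<xi>. \<xi> \<in> Kc \<Longrightarrow> cmod (Eh w \<xi> i) \<le> Bi i" unfolding choice_iff by blast
  obtain B0 where B0: "\<And>\<xi>. \<xi> \<in> Kc \<Longrightarrow> norm \<xi> \<le> B0" using compact_imp_bounded[OF assms(1)] unfolding bounded_iff by blast
  have cg: "continuous_on Kc (\<lambda>\<xi>. sgauge (\<xi> $ p))" unfolding sgauge_def by (intro continuous_intros)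
  obtain \<xi>1 where x1: "\<xi>1 \<in> Kc" "\<And>\<xi>. \<xi> \<in> Kc \<Longrightarrow> sgauge (\<xi>1 $ p) \<le> sgauge (\<xi> $ p)"
    using continuous_attains_inf[OF assms(1) False cg] by blast
  obtain \<xi>2 where x2: "\<xi>2 \<in> Kc" "\<And>\<xi>. \<xi> \<in> Kc \<Longrightarrow> sgauge (\<xi> $ p) \<le> sgauge (\<xi>2 $ p)"
    using continuous_attains_sup[OF assms(1) False cg] by blast
  have g: "sgauge (\<xi>1 $ p) > 0" using x1(1) assms(2) Sect_sgauge(1) by (auto simp: MS_def)
  define B where "B = 1 + \<bar>B0\<bar> + (\<Sum>i\<in>UNIV. \<bar>Bi i\<bar>)"
  have b1: "cmod (Eh w \<xi> i) \<le> B" if "\<xi> \<in> Kc" for \<xi> i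
    using Bi[OF that, of i] member_le_sum[of i UNIV "\<lambda>i. \<bar>Bi i\<bar>"] unfolding B_def by simp
  have b2: "norm \<xi> \<le> B" if "\<xi> \<in> Kc" for \<xi>
  proof -
    have "0 \<le> (\<Sum>i\<in>UNIV. \<bar>Bi i\<bar>)" by (simp add: sum_nonneg)
    then show ?thesis using B0[OF that] unfolding B_def by linarith
  qed
  have b3: "B > 0" unfolding B_def by (intro add_pos_nonneg sum_nonneg) auto
  have b4: "sgauge (\<xi>2 $ p) > 0" using g x2(2)[OF x1(1)] by linarith
  show ?thesis
    by (rule exI[of _ B], rule exI[of _ "sgauge (\<xi>1 $ p)"], rule exI[of _ "sgauge (\<xi>2 $ p)"])
      (intro conjI ballI allI b1 b2 b3 b4 g x1(2) x2(2); assumption)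
qed

text \<open>Scaling does not affect \<open>Eh\<close>, which ignores coordinate \<open>p\<close>,
  while the bound on it grows like a positive power of \<open>t\<close>.\<close>

lemma MS_scale:
  assumes "compact Kc" "Kc \<subseteq> MS" "w \<noteq> 0"
  shows "\<forall>\<^sub>F t in at_top. t \<ge> 1 \<and> (\<forall>\<xi>\<in>Kc. sc t \<xi> \<in> Dk w)"
proof -
  obtain B c c' where B: "B > 0" "c > 0" "\<And>\<xi> i. \<xi> \<in> Kc \<Longrightarrow> cmod (Eh w \<xi> i) \<le> B" "\<And>\<xi>. \<xi> \<in> Kc \<Longrightarrow> c \<le> sgauge (\<xi> $ p)"
    using compact_MS_bounds[OF assms] by blast
  have "\<forall>\<^sub>F t in at_top. B < \<epsilon> * (t * c) powr \<beta> i" for i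
  proof -
    \<comment> \<open>Solves \<epsilon> (T c)^\<beta>_i = B + 1; the surplus 1 makes the inequality
      strict.\<close>
    define T where "T = ((B + 1) / \<epsilon>) powr (1 / \<beta> i) / c"
    have Tp: "((B + 1) / \<epsilon>) > 0" using B eps by simp
    have "B < \<epsilon> * (t * c) powr \<beta> i" if t: "t \<ge> T" for t
    proof -
      have "((B + 1) / \<epsilon>) powr (1 / \<beta> i) \<le> t * c" using t B(2) by (simp add: T_def pos_divide_le_eq)
      then have "(((B + 1) / \<epsilon>) powr (1 / \<beta> i)) powr \<beta> i \<le> (t * c) powr \<beta> i" using beta_pos[of i] by (intro powr_mono2) auto
      then have "(B + 1) / \<epsilon> \<le> (t * c) powr \<beta> i" using beta_pos[of i] Tp B(1) eps by (simp add: powr_powr)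
      then have "B + 1 \<le> \<epsilon> * (t * c) powr \<beta> i" using eps by (simp add: pos_divide_le_eq mult.commute)
      then show ?thesis by simp
    qed
    then show ?thesis unfolding eventually_at_top_linorder by blast
  qed
  then have "\<forall>\<^sub>F t in at_top. \<forall>i. B < \<epsilon> * (t * c) powr \<beta> i" by (simp add: eventually_all_finite)
  with eventually_ge_at_top[of 1] show ?thesis
  proof eventually_elim
    case (elim t)
    have "sc t \<xi> \<in> Dk w" if xi: "\<xi> \<in> Kc" for \<xi>
    proof -
      have "cmod (Eh w \<xi> i) < \<epsilon> * (t * sgauge (\<xi> $ p)) powr \<beta> i" for i
      proof -
        have "(t * c) powr \<beta> i \<le> (t * sgauge (\<xi> $ p)) powr \<beta> i"
          using elim(1) B(2) B(4)[OF xi] beta_pos[of i] by (intro powr_mono2 mult_left_mono) auto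
        then have "\<epsilon> * (t * c) powr \<beta> i \<le> \<epsilon> * (t * sgauge (\<xi> $ p)) powr \<beta> i" using eps by simp
        with B(3)[OF xi, of i] elim(2) show ?thesis by (meson le_less_trans less_le_trans)
      qed
      then show ?thesis using sc_MS[of t \<xi>] xi assms(2) elim(1) by (auto simp add: Dk_def Eh_sc sc_nth sgauge_scale)
    qed
    then show ?case using elim(1) by blast
  qed
qed

text \<open>Exponentials in the punctured coordinates map a starlike set onto \<open>MS\<close>; its
  centre is the point with all coordinates 1, which sees the whole sector.\<close>

lemma path_connected_MS: "path_connected MS"
proof -
  define Sp where "Sp = {\<zeta> :: complex ^ 'n. \<zeta> $ p \<in> Sect}"
  define ex :: "complex ^ 'n \<Rightarrow> complex ^ 'n" where "ex = (\<lambda>\<zeta>. \<chi> l. if l \<in> J - {p} then exp (\<zeta> $ l) else \<zeta> $ l)"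
  have "starlike Sp" unfolding starlike_def
  proof (intro bexI[of _ "\<chi> l. 1"] ballI subsetI)
    show "(\<chi> l. 1) \<in> Sp" by (simp add: Sp_def Sect_def)
    fix \<zeta> \<eta> assume z: "\<zeta> \<in> Sp" "\<eta> \<in> closed_segment (\<chi> l. 1) \<zeta>"
    then obtain t where t: "0 \<le> t" "t \<le> 1" "\<eta> = (1 - t) *\<^sub>R (\<chi> l. 1) + t *\<^sub>R \<zeta>" by (auto simp: closed_segment_def)
    have zp: "Re (\<zeta> $ p) + \<bar>Im (\<zeta> $ p)\<bar> > 0" using z(1) by (simp add: Sp_def Sect_def)
    have "\<eta> $ p = (1 - t) *\<^sub>R 1 + t *\<^sub>R (\<zeta> $ p)" using t(3) by simp
    then have "Re (\<eta> $ p) = (1 - t) + t * Re (\<zeta> $ p)" "Im (\<eta> $ p) = t * Im (\<zeta> $ p)" by simp_all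
    then have "Re (\<eta> $ p) + \<bar>Im (\<eta> $ p)\<bar> = (1 - t) + t * (Re (\<zeta> $ p) + \<bar>Im (\<zeta> $ p)\<bar>)"
      using t(1) by (simp add: abs_mult algebra_simps)
    also have "\<dots> > 0"
    proof (cases "t = 0")
      case False
      have "t * (Re (\<zeta> $ p) + \<bar>Im (\<zeta> $ p)\<bar>) > 0" by (rule mult_pos_pos[OF _ zp]) (use t False in simp)
      with t(2) show ?thesis by linarith
    qed simp
    finally show "\<eta> \<in> Sp" by (simp add: Sp_def Sect_def)
  qed
  then have "path_connected Sp" by (rule starlike_imp_path_connected)
  moreover have "continuous_on Sp ex"
  proof (rule continuous_at_imp_continuous_on, intro ballI holo_map_at_imp_isCont)
    fix \<zeta> show "holo_map_at ex \<zeta>" unfolding holo_map_at_def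
    proof
      fix i show "holo_at (\<lambda>\<zeta>. ex \<zeta> $ i) \<zeta>" by (cases "i \<in> J - {p}") (auto simp: ex_def intro!: holo_at_exp holo_at_nth)
    qed
  qed
  ultimately have "path_connected (ex ` Sp)" by (rule path_connected_continuous_image[rotated])
  moreover have "ex ` Sp = MS"
  proof
    show "ex ` Sp \<subseteq> MS" by (auto simp: ex_def Sp_def MS_def Mod_def)
    show "MS \<subseteq> ex ` Sp"
    proof
      fix \<xi> assume xi: "\<xi> \<in> MS"
      define \<zeta> where "\<zeta> = (\<chi> l. if l \<in> J - {p} then Ln (\<xi> $ l) else \<xi> $ l)"
      have "ex \<zeta> = \<xi>" using xi by (auto simp: ex_def \<zeta>_def vec_eq_iff MS_def Mod_def)
      moreover have "\<zeta> \<in> Sp" using xi by (auto simp: \<zeta>_def Sp_def MS_def)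
      ultimately show "\<xi> \<in> ex ` Sp" by blast
    qed
  qed
  ultimately show ?thesis by simp
qed

text \<open>The reason is that scaling up the coordinate \<open>p\<close> moves every compact subset of \<open>MS\<close> into \<open>Dk w\<close>.\<close>

lemma connected_Dk:
  assumes "w \<noteq> 0"
  shows "connected (Dk w)"
  unfolding connected_iff_connected_component
proof (intro ballI)
  fix \<xi> \<xi>' assume xi: "\<xi> \<in> Dk w" "\<xi>' \<in> Dk w"
  then have "\<xi> \<in> MS" "\<xi>' \<in> MS" by (auto simp: Dk_def)
  then obtain g where g: "path g" "path_image g \<subseteq> MS" "pathstart g = \<xi>" "pathfinish g = \<xi>'"
    using path_connected_MS unfolding path_connected_def by blast
  have "\<forall>\<^sub>F t in at_top. t \<ge> 1 \<and> (\<forall>\<xi>\<in>path_image g. sc t \<xi> \<in> Dk w)"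
    by (intro MS_scale compact_path_image g assms)
  then obtain t :: real where t: "t \<ge> 1" "\<And>\<xi>. \<xi> \<in> path_image g \<Longrightarrow> sc t \<xi> \<in> Dk w"
    unfolding eventually_at_top_linorder by blast
  \<comment> \<open>The scaled path joins the scaled endpoints; each endpoint is linked to its
    scaled copy by a ray, on which the factors are at least 1.\<close>
  have ray: "connected_component (Dk w) \<zeta> (sc t \<zeta>)" if z: "\<zeta> \<in> Dk w" for \<zeta>
    unfolding connected_component_def
  proof (intro exI conjI)
    have "continuous_on {1..t} (\<lambda>s. sc s \<zeta>)"
      unfolding sc_def continuous_on_def
    proof (intro ballI tendsto_vec_lambda)
      fix s i
      show "((\<lambda>s. if i = p then of_real s * \<zeta> $ p else \<zeta> $ i) \<longlongrightarrow> (if i = p then of_real s * \<zeta> $ p else \<zeta> $ i)) (at s within {1..t})"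
        by (cases "i = p") (auto intro!: tendsto_intros)
    qed
    then show "connected ((\<lambda>s. sc s \<zeta>) ` {1..t})" by (intro connected_continuous_image) auto
    show "(\<lambda>s. sc s \<zeta>) ` {1..t} \<subseteq> Dk w" using sc_Dk[OF z] by auto
    show "\<zeta> \<in> (\<lambda>s. sc s \<zeta>) ` {1..t}" using t(1) sc_1[of \<zeta>] by (intro image_eqI[of _ _ 1]) auto
    show "sc t \<zeta> \<in> (\<lambda>s. sc s \<zeta>) ` {1..t}" using t(1) by auto
  qed
  have "connected_component (Dk w) (sc t \<xi>) (sc t \<xi>')" unfolding connected_component_def
  proof (intro exI conjI)
    have "continuous_on (path_image g) (sc t)"
      by (intro continuous_at_imp_continuous_on ballI holo_map_at_imp_isCont holo_sc)
    then show "connected (sc t ` path_image g)" by (intro connected_continuous_image connected_path_image g)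
    show "sc t ` path_image g \<subseteq> Dk w" using t(2) by blast
    show "sc t \<xi> \<in> sc t ` path_image g" "sc t \<xi>' \<in> sc t ` path_image g"
      using g pathstart_in_path_image[of g] pathfinish_in_path_image[of g] by auto
  qed
  with ray[OF xi(1)] ray[OF xi(2)] show "connected_component (Dk w) \<xi> \<xi>'"
    by (meson connected_component_sym connected_component_trans)
qed

lemma connected_Omk:
  assumes "w \<in> roots"
  shows "connected (Omk w)"
proof -
  have "continuous_on (Dk w) (X w)"
    by (intro continuous_at_imp_continuous_on ballI holo_map_at_imp_isCont holo_X root_nonzero[OF assms]) (auto simp: Dk_def)
  then show ?thesis unfolding Omk_image[OF assms]
    using connected_Dk root_nonzero[OF assms] by (intro connected_continuous_image) auto
qed

lemma Omk_f: "x \<in> Omk w \<Longrightarrow> f x \<in> Omk w"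
  using Om_f Om_step by (auto simp: Omk_def)

lemma Omk_nonempty:
  assumes "w \<in> roots"
  shows "Omk w \<noteq> {}"
proof -
  have "(\<chi> l. 1) \<in> MS" by (simp add: MS_def Mod_def Sect_def)
  then have "\<forall>\<^sub>F t in at_top. t \<ge> 1 \<and> (\<forall>\<xi>\<in>{\<chi> l. 1}. sc t \<xi> \<in> Dk w)"
    using root_nonzero[OF assms] by (intro MS_scale) auto
  then obtain t where "sc t (\<chi> l. 1) \<in> Dk w" unfolding eventually_at_top_linorder by blast
  then show ?thesis using X_Dk[OF assms] by blast
qed

lemma zero_frontier_Omk:
  assumes "w \<in> roots"
  shows "0 \<in> frontier (Omk w)"
proof -
  obtain x where x: "x \<in> Omk w" using Omk_nonempty[OF assms] by blast
  then have xO: "x \<in> \<Omega>" by (simp add: Omk_def)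
  have "(f ^^ j) x \<in> Omk w" for j using x by (induction j) (auto intro: Omk_f)
  moreover have "(\<lambda>j. (f ^^ j) x) \<longlonglongrightarrow> 0"
    using orbit_to_0[of "{x}"] xO by (auto dest: tendsto_uniform_limitI[where x = x])
  ultimately have "0 \<in> closure (Omk w)" unfolding closure_sequential
    by (intro exI[of _ "\<lambda>j. (f ^^ j) x"]) blast
  moreover have "0 \<notin> Omk w" using zero_notin_SD Om_SD by (auto simp: Omk_def)
  ultimately show ?thesis using open_Omk by (simp add: frontier_def interior_open)
qed

end

section \<open>Fatou coordinates\<close>

context petal_scaled
begin

definition \<phi> :: "complex ^ 'n \<Rightarrow> complex ^ 'n" where "\<phi> x = (\<chi> l. if l = p then \<psi> x else Yinf (P l) x)"

lemma phi_nth: "\<phi> x $ p = \<psi> x" "l \<noteq> p \<Longrightarrow> \<phi> x $ l = Yinf (P l) x" by (auto simp: \<phi>_def)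

lemma Yinf_P:
  assumes "x \<in> \<Omega>"
  shows "holo_at (Yinf (P l)) x" "(\<lambda>j. Y (P l) ((f ^^ j) x)) \<longlonglongrightarrow> Yinf (P l) x"
    "cmod (Yinf (P l) x - Y (P l) x) \<le> Bc x * cmod (Y (P l) x) * suminf wt" "Yinf (P l) (f x) = Yinf (P l) x"
  using Yinf[OF Qs(3) m0(1) assms] Yinf_f[OF Qs(3) m0(1) assms] by blast+

lemma holo_phi: "x \<in> \<Omega> \<Longrightarrow> holo_map_at \<phi> x"
  unfolding holo_map_at_def
proof
  fix l assume "x \<in> \<Omega>"
  then show "holo_at (\<lambda>x. \<phi> x $ l) x" using psi(1) Yinf_P(1) by (cases "l = p") (simp_all add: phi_nth)
qed

lemma phi_f: "x \<in> \<Omega> \<Longrightarrow> \<phi> (f x) = \<phi> x + axis p 1"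
  using psi_f Yinf_P(4) by (simp add: \<phi>_def vec_eq_iff axis_def)

lemma phi_orbit: "x \<in> \<Omega> \<Longrightarrow> \<phi> ((f ^^ j) x) = \<phi> x + axis p (of_nat j)"
proof (induction j)
  case 0
  then show ?case by (simp add: vec_eq_iff axis_def)
next
  case (Suc j)
  then show ?case using phi_f[OF orbit_Om[OF Suc.prems, of j]] by (simp add: vec_eq_iff axis_def)
qed

text \<open>The functions \<open>Y q\<close> and \<open>Y (- q)\<close> are reciprocal to each other, hence so are their limits.\<close>

lemma Yinf_nonzero:
  assumes x: "x \<in> \<Omega>" and l: "l \<in> J"
  shows "Yinf (P l) x \<noteq> 0"
proof -
  have q: "m i = 0 \<Longrightarrow> - P l i \<ge> 0" for i using m0(3)[OF l] by simp
  have lam: "lam (\<lambda>i. - P l i) = - lam (P l)" by (simp add: lam_def sum_negf)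
  have "Y (P l) y * Y (\<lambda>i. - P l i) y = 1" if y: "y \<in> SD" for y
  proof -
    have "lmono (P l) y \<noteq> 0" using m0(3)[OF l] SD_coordinate[OF y] by (auto intro!: lmono_nonzero)
    moreover have "lmono (\<lambda>i. - P l i) y = inverse (lmono (P l) y)"
      by (simp add: lmono_def power_int_minus prod_inversef[unfolded o_def])
    ultimately show ?thesis by (simp add: Y_def lam exp_minus field_simps)
  qed
  then have "(\<lambda>j. Y (P l) ((f ^^ j) x) * Y (\<lambda>i. - P l i) ((f ^^ j) x)) \<longlonglongrightarrow> 1"
    using Om_SD[OF orbit_Om[OF x]] by simp
  moreover have "(\<lambda>j. Y (P l) ((f ^^ j) x) * Y (\<lambda>i. - P l i) ((f ^^ j) x)) \<longlonglongrightarrow> Yinf (P l) x * Yinf (\<lambda>i. - P l i) x"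
    by (intro tendsto_mult Yinf_P x Yinf(2)[OF Qs(4) q x])
  ultimately have "Yinf (P l) x * Yinf (\<lambda>i. - P l i) x = 1" using LIMSEQ_unique by blast
  then show ?thesis by auto
qed

lemma phi_Mod: "x \<in> \<Omega> \<Longrightarrow> \<phi> x \<in> Mod"
  using Yinf_nonzero by (auto simp: Mod_def phi_nth)

text \<open>The map \<phi> in the coordinates \<open>Zm\<close>, viewed at scale \<open>j\<close> in
  coordinate \<open>p\<close>.\<close>

definition resc :: "nat \<Rightarrow> complex \<Rightarrow> complex ^ 'n \<Rightarrow> complex ^ 'n" where
  "resc j w \<xi> = sc (1 / real j) (\<phi> (X w (sc (real j) \<xi>)))"

lemma suminf_wt_nonneg: "suminf wt \<ge> 0" by (intro suminf_nonneg wt)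

lemma tendsto_scaled_powr:
  fixes s t :: real
  assumes "s < 0" "t > 0"
  shows "(\<lambda>j. (real j * t) powr s) \<longlonglongrightarrow> 0"
proof (intro tendsto_neg_powr assms(1))
  show "filterlim (\<lambda>j. real j * t) at_top sequentially"
    using filterlim_tendsto_pos_mult_at_top[OF tendsto_const assms(2) filterlim_real_sequentially] by (simp add: mult.commute)
qed

text \<open>In coordinate \<open>p\<close> the error is of order G^(1-\<delta>) divided by j, in the
  others a multiple of G^(-\<delta>/2). Both vanish uniformly, since G is of order j on the scaled
  ball and the weight stays bounded.\<close>

lemma resc_close:
  assumes w: "w \<in> roots" and xi: "\<xi>0 \<in> MS"
  shows "\<exists>r>0. \<forall>\<^sub>F j in sequentially. j > 0 \<and> (\<forall>\<xi>\<in>ball \<xi>0 r. sc (real j) \<xi> \<in> Dk w \<and> norm (resc j w \<xi> - \<xi>) \<le> r / (8 * CARD('n)))"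
proof -
  obtain r where r: "r > 0" "cball \<xi>0 r \<subseteq> MS" using open_MS xi open_contains_cball by blast
  have w0: "w \<noteq> 0" using root_nonzero[OF w] .
  obtain B c c' where B: "B > 0" "c > 0" "c' > 0" "\<And>\<xi> i. \<xi> \<in> cball \<xi>0 r \<Longrightarrow> cmod (Eh w \<xi> i) \<le> B"
      "\<And>\<xi>. \<xi> \<in> cball \<xi>0 r \<Longrightarrow> norm \<xi> \<le> B"
      "\<And>\<xi>. \<xi> \<in> cball \<xi>0 r \<Longrightarrow> c \<le> sgauge (\<xi> $ p)" "\<And>\<xi>. \<xi> \<in> cball \<xi>0 r \<Longrightarrow> sgauge (\<xi> $ p) \<le> c'"
    using compact_MS_bounds[OF compact_cball r(2) w0] by blast
  have ev: "\<forall>\<^sub>F j in sequentially. \<forall>\<xi>\<in>cball \<xi>0 r. sc (real j) \<xi> \<in> Dk w"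
    using eventually_compose_filterlim[OF MS_scale[OF compact_cball r(2) w0] filterlim_real_sequentially]
    by (rule eventually_mono) auto
  define H where "H = 1 + Dc * (\<Sum>i::'n\<in>UNIV. B)"
  have H: "H \<ge> 1" using Dc_pos B(1) by (simp add: H_def)
  define e1 where "e1 = (\<lambda>j. (1 + suminf wt) * C * H ^ n * c' * (real j * c') powr (- \<delta>))"
  define e2 where "e2 = (\<lambda>j. C * H ^ n * (real j * c) powr (- \<delta> / 2) * B * suminf wt)"
  have l1: "e1 \<longlonglongrightarrow> (1 + suminf wt) * C * H ^ n * c' * 0" unfolding e1_def
    using delta B by (intro tendsto_mult_left tendsto_scaled_powr) auto
  have l2: "e2 \<longlonglongrightarrow> C * H ^ n * 0 * B * suminf wt" unfolding e2_def
    using delta B by (intro tendsto_mult_left tendsto_mult_right tendsto_scaled_powr) auto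
  \<comment> \<open>The second division by n pays for estimating the norm by the sum of the n
    coordinates.\<close>
  define \<eta> where "\<eta> = r / (8 * CARD('n)) / CARD('n)"
  have eta: "\<eta> > 0" using r by (simp add: \<eta>_def)
  have "\<forall>\<^sub>F j in sequentially. e1 j < \<eta>" "\<forall>\<^sub>F j in sequentially. e2 j < \<eta>"
    using order_tendstoD(2)[OF l1] order_tendstoD(2)[OF l2] eta by auto
  with ev eventually_gt_at_top[of "0::nat"]
  have "\<forall>\<^sub>F j in sequentially. j > 0 \<and> (\<forall>\<xi>\<in>ball \<xi>0 r. sc (real j) \<xi> \<in> Dk w \<and> norm (resc j w \<xi> - \<xi>) \<le> r / (8 * CARD('n)))"
  proof eventually_elim
    case (elim j)
    have "sc (real j) \<xi> \<in> Dk w \<and> norm (resc j w \<xi> - \<xi>) \<le> r / (8 * CARD('n))" if "\<xi> \<in> ball \<xi>0 r" for \<xi>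
    proof
      have x': "\<xi> \<in> cball \<xi>0 r" using that by auto
      show D: "sc (real j) \<xi> \<in> Dk w" using elim x' by blast
      define x where "x = X w (sc (real j) \<xi>)"
      have xO: "x \<in> \<Omega>" using X_Dk[OF w D] by (simp add: x_def Omk_def)
      have MSx: "sc (real j) \<xi> \<in> MS" using D by (simp add: Dk_def)
      note Xp = X_props[OF w MSx, folded x_def]
      have zx: "zc x = of_real (real j) * \<xi> $ p" using Xp(2) by (simp add: sc_nth)
      have Gx: "G x = real j * sgauge (\<xi> $ p)" unfolding G_def zx using elim by (intro sgauge_scale) auto
      have G1: "real j * c \<le> G x" "G x \<le> real j * c'" unfolding Gx using B(6,7)[OF x'] by (intro mult_left_mono; simp)+
      have Gp: "G x > 0" using G_ge1[OF xO] by linarith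
      have hx: "hh x \<le> H"
      proof -
        have "hh x \<le> 1 + Dc * (\<Sum>i\<in>UNIV. cmod (E i x))" by (rule hh_le[OF xO])
        also have "\<dots> \<le> H" unfolding H_def using Dc_pos B(4)[OF x']
          by (intro add_left_mono mult_left_mono sum_mono) (auto simp: Xp(3) Eh_sc)
        finally show ?thesis .
      qed
      have hn: "hh x ^ n \<le> H ^ n" using hx hh_ge1[of x] by (intro power_mono) auto
      have "cmod ((resc j w \<xi> - \<xi>) $ l) \<le> \<eta>" for l
      proof (cases "l = p")
        case True
        have "(resc j w \<xi> - \<xi>) $ l = (\<psi> x - zc x) / of_nat j"
          using elim(2) True unfolding zx by (simp add: resc_def sc_nth x_def[symmetric] phi_nth field_simps)
        then have "cmod ((resc j w \<xi> - \<xi>) $ l) = cmod (\<psi> x - zc x) / real j" by (simp add: norm_divide)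
        also have "\<dots> \<le> (1 + suminf wt) * C * hh x ^ n * G x powr (1 - \<delta>) / real j"
          by (intro divide_right_mono psi_close xO) auto
        also have "\<dots> \<le> (1 + suminf wt) * C * H ^ n * (real j * c') powr (1 - \<delta>) / real j"
          using suminf_wt_nonneg C0 hh_ge1[of x] G1 Gp delta H
          by (intro divide_right_mono mult_mono hn powr_mono2 mult_nonneg_nonneg) auto
        also have "(real j * c') powr (1 - \<delta>) = real j * c' * (real j * c') powr (- \<delta>)"
          using elim(2) B(3) by (simp add: powr_diff powr_minus divide_inverse)
        also have "(1 + suminf wt) * C * H ^ n * (real j * c' * (real j * c') powr (- \<delta>)) / real j = e1 j"
          using elim(2) by (simp add: e1_def)
        finally show ?thesis using elim by simp
      next
        case False
        have Yx: "Y (P l) x = \<xi> $ l" using arg_cong[OF Xp(5), of "\<lambda>v. v $ l"] False by (simp add: Zm_def sc_nth)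
        have "(resc j w \<xi> - \<xi>) $ l = Yinf (P l) x - Y (P l) x"
          using False by (simp add: Yx resc_def sc_nth x_def[symmetric] phi_nth)
        then have "cmod ((resc j w \<xi> - \<xi>) $ l) \<le> Bc x * cmod (\<xi> $ l) * suminf wt"
          using Yinf_P(3)[OF xO, of l] Yx by simp
        also have "\<dots> \<le> C * H ^ n * (real j * c) powr (- \<delta> / 2) * B * suminf wt"
          unfolding Bc_def
        proof (intro mult_right_mono mult_mono hn suminf_wt_nonneg)
          show "G x powr (- \<delta> / 2) \<le> (real j * c) powr (- \<delta> / 2)"
            using G1(1) elim(2) B(2) delta by (intro powr_mono2') auto
          show "cmod (\<xi> $ l) \<le> B" using B(5)[OF x'] Finite_Cartesian_Product.norm_nth_le[of \<xi> l] by linarith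
        qed (use C0 hh_ge1[of x] H in auto)
        also have "\<dots> = e2 j" by (simp add: e2_def)
        finally show ?thesis using elim by simp
      qed
      then have "norm (resc j w \<xi> - \<xi>) \<le> (\<Sum>l::'n\<in>UNIV. \<eta>)"
        by (intro order_trans[OF norm_vec_le_sum] sum_mono)
      then show "norm (resc j w \<xi> - \<xi>) \<le> r / (8 * CARD('n))" by (simp add: \<eta>_def)
    qed
    then show ?case using elim by blast
  qed
  then show ?thesis using r(1) by blast
qed

lemma holo_resc:
  assumes "w \<in> roots" "sc (real j) \<xi> \<in> Dk w"
  shows "holo_map_at (resc j w) \<xi>"
proof -
  have "sc (real j) \<xi> \<in> MS" using assms(2) by (simp add: Dk_def)
  moreover have "X w (sc (real j) \<xi>) \<in> \<Omega>" using X_Dk[OF assms] by (simp add: Omk_def)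
  ultimately show ?thesis unfolding resc_def[abs_def]
    by (intro holo_map_at_compose[where G = "sc (1 / real j)", OF _ holo_sc] holo_map_at_compose[where G = \<phi>, OF _ holo_phi]
      holo_map_at_compose[where F = "sc (real j)", OF holo_sc holo_X] root_nonzero assms)
qed

text \<open>The limit of rescaled orbits: coordinate \<open>p\<close> becomes 1 because z grows like
  j, so only the invariant coordinates are remembered.\<close>

definition base :: "complex ^ 'n \<Rightarrow> complex ^ 'n" where "base \<xi> = sub 1 \<xi>"

lemma base_MS: "\<xi> \<in> Mod \<Longrightarrow> base \<xi> \<in> MS"
  by (auto simp: base_def sub_def MS_def Mod_def Sect_def)

text \<open>\<psi> grows by exactly 1 per step, and z differs from \<psi> by O(G^(1-\<delta>)),
  where G is at most linear in j.\<close>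

lemma zc_orbit:
  assumes "x \<in> \<Omega>"
  shows "(\<lambda>j. zc ((f ^^ j) x) / of_nat j) \<longlonglongrightarrow> 1"
proof -
  have bound: "cmod (zc ((f ^^ j) x)) \<le> cmod (zc x) + 2 * real j" for j
  proof (induction j)
    case (Suc j)
    let ?y = "(f ^^ j) x"
    have "cmod (zc (f ?y) - zc ?y - 1) \<le> 1/8" using Om_step[OF orbit_Om[OF assms]] by blast
    moreover have "cmod (zc (f ?y)) \<le> cmod (zc (f ?y) - zc ?y - 1) + cmod (zc ?y) + cmod 1"
      using norm_triangle_ineq[of "zc (f ?y) - zc ?y - 1" "zc ?y + 1"] norm_triangle_ineq[of "zc ?y" 1] by simp
    ultimately show ?case using Suc by simp
  qed simp
  \<comment> \<open>Three times the crude bound |zc x| + 2j on the modulus of z bounds G, and this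
    is at most a j for j at least 1.\<close>
  define a where "a = 3 * cmod (zc x) + 6"
  have a: "a > 0" unfolding a_def by (simp add: add_nonneg_pos)
  define C1 where "C1 = (1 + suminf wt) * C * hh x ^ n"
  have C1: "C1 \<ge> 0" unfolding C1_def using suminf_wt_nonneg C0 hh_ge1[of x] by simp
  define e where "e = (\<lambda>j. cmod (\<psi> x) / real j + C1 * a * (real j * a) powr (- \<delta>))"
  have "e \<longlonglongrightarrow> 0 + C1 * a * 0" unfolding e_def
    using delta a by (intro tendsto_add tendsto_mult_left tendsto_scaled_powr lim_const_over_n) auto
  then have e0: "e \<longlonglongrightarrow> 0" by simp
  have "cmod (zc ((f ^^ j) x) / of_nat j - 1) \<le> e j" if j: "j > 0" for j
  proof -
    let ?y = "(f ^^ j) x"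
    have y: "?y \<in> \<Omega>" by (rule orbit_Om[OF assms])
    have ps: "\<psi> ?y = \<psi> x + of_nat j" using arg_cong[OF phi_orbit[OF assms, of j], of "\<lambda>v. v $ p"] by (simp add: phi_nth)
    have "G ?y \<le> 3 * cmod (zc ?y)" using Sect_sgauge(3)[OF SD_zc(1)[OF Om_SD[OF y]]] by (simp add: G_def)
    also have "\<dots> \<le> 3 * cmod (zc x) * 1 + 6 * real j" using bound[of j] by simp
    also have "\<dots> \<le> 3 * cmod (zc x) * real j + 6 * real j" using j by (intro add_right_mono mult_left_mono) auto
    finally have Gy: "G ?y \<le> real j * a" by (simp add: a_def algebra_simps)
    have "cmod (zc ?y - of_nat j) \<le> cmod (\<psi> x) + cmod (\<psi> ?y - zc ?y)"
      unfolding ps using norm_triangle_ineq4[of "\<psi> x" "\<psi> x + of_nat j - zc ?y"] by (simp add: norm_minus_commute)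
    also have "cmod (\<psi> ?y - zc ?y) \<le> (1 + suminf wt) * C * hh ?y ^ n * G ?y powr (1 - \<delta>)" by (rule psi_close[OF y])
    also have "\<dots> \<le> C1 * (real j * a) powr (1 - \<delta>)" unfolding C1_def
      using suminf_wt_nonneg C0 hh_ge1 Gy G_ge1[OF y] delta hh_orbit[OF assms, of j]
      by (intro mult_mono powr_mono2 power_mono mult_nonneg_nonneg) (auto intro: order_trans[OF zero_le_one])
    also have "(real j * a) powr (1 - \<delta>) = real j * a * (real j * a) powr (- \<delta>)"
      using j a by (simp add: powr_diff powr_minus divide_inverse)
    finally have 1: "cmod (zc ?y - of_nat j) \<le> cmod (\<psi> x) + C1 * (real j * a * (real j * a) powr (- \<delta>))" by simp
    have "zc ?y / of_nat j - 1 = (zc ?y - of_nat j) / of_nat j" using j by (simp add: field_simps)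
    then have "cmod (zc ?y / of_nat j - 1) = cmod (zc ?y - of_nat j) / real j" by (simp add: norm_divide)
    also have "\<dots> \<le> (cmod (\<psi> x) + C1 * (real j * a * (real j * a) powr (- \<delta>))) / real j" by (intro divide_right_mono 1) auto
    also have "\<dots> = e j" using j by (simp add: e_def add_divide_distrib)
    finally show ?thesis .
  qed
  then have "(\<lambda>j. zc ((f ^^ j) x) / of_nat j - 1) \<longlonglongrightarrow> 0"
    by (intro Lim_null_comparison[OF _ e0] eventually_sequentiallyI[of 1]) auto
  then show ?thesis by (simp add: LIM_zero_iff)
qed

lemma rescaled_orbit:
  assumes "x \<in> \<Omega>"
  shows "(\<lambda>j. sc (1 / real j) (Zm ((f ^^ j) x))) \<longlonglongrightarrow> base (\<phi> x)"
proof (rule vec_tendstoI)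
  fix l
  show "(\<lambda>j. sc (1 / real j) (Zm ((f ^^ j) x)) $ l) \<longlonglongrightarrow> base (\<phi> x) $ l"
  proof (cases "l = p")
    case True
    then show ?thesis using zc_orbit[OF assms] by (simp add: sc_nth Zm_def base_def sub_def)
  next
    case False
    then show ?thesis using Yinf_P(2)[OF assms, of l] by (simp add: sc_nth Zm_def base_def sub_def phi_nth)
  qed
qed

lemma orbit_Omk: "x \<in> Omk w \<Longrightarrow> (f ^^ j) x \<in> Omk w"
  by (induction j) (auto intro: Omk_f)

lemma resc_orbit:
  assumes "x \<in> Omk w" "j > 0"
  shows "resc j w (sc (1 / real j) (Zm ((f ^^ j) x))) = sc (1 / real j) (\<phi> ((f ^^ j) x))"
  using Zm_Dk[OF orbit_Omk[OF assms(1), of j]] assms(2) by (simp add: resc_def sc_sc sc_1)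

text \<open>The neighbourhood does not depend on \<open>j\<close>, so rescaled orbits of points with
  the same image under \<phi> all enter it eventually.\<close>

lemma Omk_near_identity:
  assumes w: "w \<in> roots" and x: "x \<in> Omk w"
  shows "\<exists>B. open B \<and> base (\<phi> x) \<in> B \<and>
    (\<forall>\<^sub>F j in sequentially. j > 0 \<and> inj_on (resc j w) B \<and> (\<forall>\<xi>\<in>B. nondegenerate (resc j w) \<xi>))"
proof -
  have xO: "x \<in> \<Omega>" using x by (simp add: Omk_def)
  obtain r where r: "r > 0" "\<forall>\<^sub>F j in sequentially. j > 0 \<and> (\<forall>\<xi>\<in>ball (base (\<phi> x)) r. sc (real j) \<xi> \<in> Dk w \<and> norm (resc j w \<xi> - \<xi>) \<le> r / (8 * CARD('n)))"
    using resc_close[OF w base_MS[OF phi_Mod[OF xO]]] by blast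
  have "\<forall>\<^sub>F j in sequentially. j > 0 \<and> inj_on (resc j w) (ball (base (\<phi> x)) (r/2)) \<and> (\<forall>\<xi>\<in>ball (base (\<phi> x)) (r/2). nondegenerate (resc j w) \<xi>)"
    using r(2)
  proof eventually_elim
    case (elim j)
    then have h: "\<And>\<xi>. \<xi> \<in> ball (base (\<phi> x)) r \<Longrightarrow> holo_map_at (resc j w) \<xi>"
      "\<And>\<xi>. \<xi> \<in> ball (base (\<phi> x)) r \<Longrightarrow> norm (resc j w \<xi> - \<xi>) \<le> r / (8 * CARD('n))" using holo_resc[OF w] by blast+
    from near_identity[OF h(1) r(1) h(2)] show ?case using elim by blast
  qed
  then show ?thesis using r(1) by (intro exI[of _ "ball (base (\<phi> x)) (r/2)"]) auto
qed

text \<open>Two points with equal images have rescaled orbits with the same limit, near which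
  \<open>resc j\<close> is injective for large \<open>j\<close>. Their images under
  \<open>resc j\<close> agree by equivariance, so the j-th iterates coincide, and \<open>f\<close>
  is injective.\<close>

lemma inj_on_phi:
  assumes w: "w \<in> roots"
  shows "inj_on \<phi> (Omk w)"
proof (rule inj_onI)
  fix x y assume x: "x \<in> Omk w" and y: "y \<in> Omk w" and eq: "\<phi> x = \<phi> y"
  have xO: "x \<in> \<Omega>" "y \<in> \<Omega>" using x y by (auto simp: Omk_def)
  obtain B where B: "open B" "base (\<phi> x) \<in> B" "\<forall>\<^sub>F j in sequentially. j > 0 \<and> inj_on (resc j w) B \<and> (\<forall>\<xi>\<in>B. nondegenerate (resc j w) \<xi>)"
    using Omk_near_identity[OF w x] by blast
  have "\<forall>\<^sub>F j in sequentially. sc (1 / real j) (Zm ((f ^^ j) x)) \<in> B"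
    using topological_tendstoD[OF rescaled_orbit[OF xO(1)] B(1,2)] .
  moreover have "\<forall>\<^sub>F j in sequentially. sc (1 / real j) (Zm ((f ^^ j) y)) \<in> B"
    using topological_tendstoD[OF rescaled_orbit[OF xO(2)] B(1)] B(2) eq by simp
  ultimately have "\<forall>\<^sub>F j in sequentially. x = y" using B(3)
  proof eventually_elim
    case (elim j)
    have "resc j w (sc (1 / real j) (Zm ((f ^^ j) x))) = resc j w (sc (1 / real j) (Zm ((f ^^ j) y)))"
      using elim by (simp add: resc_orbit[OF x] resc_orbit[OF y] phi_orbit xO eq)
    then have "sc (1 / real j) (Zm ((f ^^ j) x)) = sc (1 / real j) (Zm ((f ^^ j) y))"
      using elim by (auto dest: inj_onD)
    then have "sc (real j) (sc (1 / real j) (Zm ((f ^^ j) x))) = sc (real j) (sc (1 / real j) (Zm ((f ^^ j) y)))" by simp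
    then have "Zm ((f ^^ j) x) = Zm ((f ^^ j) y)" using elim by (simp add: sc_sc sc_1)
    then have fj: "(f ^^ j) x = (f ^^ j) y" using Zm_Dk[OF orbit_Omk[OF x, of j]] Zm_Dk[OF orbit_Omk[OF y, of j]] by metis
    have inj: "inj_on f \<Omega>" using f_bihol Om_U unfolding biholomorphism_def bij_betw_def by (meson inj_on_subset subsetI)
    have "(f ^^ j) x = (f ^^ j) y \<Longrightarrow> x = y" for j
      using xO inj_onD[OF inj _ orbit_Om[OF xO(1)] orbit_Om[OF xO(2)]] by (induction j) auto
    then show ?case using fj by blast
  qed
  then show "x = y" by simp
qed

lemma nondegenerate_sc: "t > 0 \<Longrightarrow> nondegenerate (sc t) \<xi>"
  by (rule nondegenerate_if_left_inverse[where G = "sc (1 / t)"])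
    (auto simp: sc_sc sc_1 intro!: holo_map_at_differentiable holo_sc)

text \<open>By equivariance \<phi> is, up to a translation, its composition with a high iterate of
  \<open>f\<close>. This factors through \<open>resc j\<close> at a point where
  \<open>resc j\<close> is nondegenerate, and the other factors are locally invertible.\<close>

lemma nondegenerate_phi:
  assumes w: "w \<in> roots" and x: "x \<in> Omk w"
  shows "nondegenerate \<phi> x"
proof -
  have xO: "x \<in> \<Omega>" using x by (simp add: Omk_def)
  obtain B where B: "open B" "base (\<phi> x) \<in> B" "\<forall>\<^sub>F j in sequentially. j > 0 \<and> inj_on (resc j w) B \<and> (\<forall>\<xi>\<in>B. nondegenerate (resc j w) \<xi>)"
    using Omk_near_identity[OF w x] by blast
  have "\<forall>\<^sub>F j in sequentially. sc (1 / real j) (Zm ((f ^^ j) x)) \<in> B"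
    using topological_tendstoD[OF rescaled_orbit[OF xO] B(1,2)] .
  then have "\<forall>\<^sub>F j in sequentially. sc (1 / real j) (Zm ((f ^^ j) x)) \<in> B \<and> j > 0 \<and> (\<forall>\<xi>\<in>B. nondegenerate (resc j w) \<xi>)"
    using B(3) by eventually_elim auto
  then obtain j where j: "sc (1 / real j) (Zm ((f ^^ j) x)) \<in> B" "j > 0" "\<forall>\<xi>\<in>B. nondegenerate (resc j w) \<xi>"
    by (auto simp: eventually_sequentially)
  let ?y = "(f ^^ j) x"
  have y: "?y \<in> Omk w" by (rule orbit_Omk[OF x])
  have yS: "?y \<in> SD" using y Om_SD by (auto simp: Omk_def)
  have 1: "nondegenerate (f ^^ j) x"
    by (rule nondegenerate_iterate[where S = \<Omega>])
      (use xO Om_f biholomorphism_nondegenerate[OF f_bihol Om_U] in auto)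
  have Zy: "Zm ?y \<in> MS" using Zm_Dk[OF y] by (simp add: Dk_def)
  have 2: "nondegenerate Zm ?y"
  proof (rule nondegenerate_if_left_inverse[where G = "X w"])
    show "Zm differentiable at ?y" by (intro holo_map_at_differentiable holo_Zm yS)
    show "X w differentiable at (Zm ?y)" by (intro holo_map_at_differentiable holo_X root_nonzero w Zy)
    show "\<forall>\<^sub>F v in nhds ?y. X w (Zm v) = v"
      using eventually_nhds_in_open[OF open_Omk y] by eventually_elim (use Zm_Dk in blast)
  qed
  have "nondegenerate (\<lambda>v. sc (real j) (resc j w (sc (1 / real j) (Zm ((f ^^ j) v))))) x"
    by (rule nondegenerate_compose[where G = "sc (real j)"], rule nondegenerate_compose[where G = "resc j w"],
        rule nondegenerate_compose[where G = "sc (1 / real j)"], rule nondegenerate_compose[where G = Zm])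
      (use 1 2 j in \<open>auto intro: nondegenerate_sc\<close>)
  then have "nondegenerate (\<lambda>v. \<phi> v + axis p (of_nat j)) x"
  proof (rule nondegenerate_cong[rotated])
    show "\<forall>\<^sub>F v in nhds x. sc (real j) (resc j w (sc (1 / real j) (Zm ((f ^^ j) v)))) = \<phi> v + axis p (of_nat j)"
      using eventually_nhds_in_open[OF open_Omk x]
    proof eventually_elim
      case (elim v)
      then show ?case using resc_orbit[OF elim j(2)] phi_orbit[of v j] j(2) by (simp add: sc_sc sc_1 Omk_def)
    qed
  qed
  then have "nondegenerate (\<lambda>v. \<phi> v + axis p (of_nat j) - axis p (of_nat j)) x"
  proof (rule nondegenerate_compose)
    show "nondegenerate (\<lambda>v. v - axis p (of_nat j)) (\<phi> x + axis p (of_nat j))"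
      unfolding nondegenerate_def by (intro exI[of _ "\<lambda>v. v"]) (auto intro!: derivative_eq_intros)
  qed
  then show ?thesis by simp
qed

text \<open>For a target \<open>v\<close>, adding j in coordinate \<open>p\<close> and dividing that
  coordinate by j gives a sequence converging to \<open>base v\<close>; it finally lies in the ball
  covered by \<open>resc j\<close>.\<close>

lemma phi_exhausts:
  assumes w: "w \<in> roots"
  shows "(\<Union>j::nat. transl p (int j) ` \<phi> ` Omk w) = Mod"
proof
  have "transl p (int j) v \<in> Mod" if "v \<in> Mod" for j v
    using that by (auto simp: Mod_def transl_def axis_def)
  then show "(\<Union>j::nat. transl p (int j) ` \<phi> ` Omk w) \<subseteq> Mod" using phi_Mod by (auto simp: Omk_def)
  show "Mod \<subseteq> (\<Union>j::nat. transl p (int j) ` \<phi> ` Omk w)"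
  proof
    fix v assume v: "v \<in> Mod"
    define \<xi>0 where "\<xi>0 = base v"
    obtain r where r: "r > 0" "\<forall>\<^sub>F j in sequentially. j > 0 \<and> (\<forall>\<xi>\<in>ball \<xi>0 r. sc (real j) \<xi> \<in> Dk w \<and> norm (resc j w \<xi> - \<xi>) \<le> r / (8 * CARD('n)))"
      using resc_close[OF w base_MS[OF v]] unfolding \<xi>0_def by blast
    have "(\<lambda>j. sc (1 / real j) (v + axis p (of_nat j))) \<longlonglongrightarrow> \<xi>0"
    proof (rule vec_tendstoI)
      fix l
      show "(\<lambda>j. sc (1 / real j) (v + axis p (of_nat j)) $ l) \<longlonglongrightarrow> \<xi>0 $ l"
      proof (cases "l = p")
        case True
        have "(\<lambda>j. v $ p / of_nat j + 1) \<longlonglongrightarrow> 0 + 1" by (intro tendsto_add lim_const_over_n tendsto_const)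
        moreover have "\<forall>\<^sub>F j in sequentially. v $ p / of_nat j + 1 = sc (1 / real j) (v + axis p (of_nat j)) $ p"
          using eventually_gt_at_top[of "0::nat"] by eventually_elim (simp add: sc_nth field_simps)
        ultimately show ?thesis using True by (simp add: \<xi>0_def base_def sub_def tendsto_cong)
      next
        case False
        then show ?thesis by (simp add: \<xi>0_def base_def sub_def sc_nth axis_def)
      qed
    qed
    then have "\<forall>\<^sub>F j in sequentially. sc (1 / real j) (v + axis p (of_nat j)) \<in> ball \<xi>0 (r/4)"
      by (rule topological_tendstoD) (use r(1) in auto)
    with r(2) have "\<forall>\<^sub>F j in sequentially. v \<in> (\<Union>j::nat. transl p (int j) ` \<phi> ` Omk w)"
    proof eventually_elim
      case (elim j)
      then have h: "\<And>\<xi>. \<xi> \<in> ball \<xi>0 r \<Longrightarrow> holo_map_at (resc j w) \<xi>"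
        "\<And>\<xi>. \<xi> \<in> ball \<xi>0 r \<Longrightarrow> norm (resc j w \<xi> - \<xi>) \<le> r / (8 * CARD('n))" using holo_resc[OF w] by blast+
      from near_identity(3)[OF h(1) r(1) h(2)] elim obtain \<xi> where
        xi: "\<xi> \<in> ball \<xi>0 (r/2)" "resc j w \<xi> = sc (1 / real j) (v + axis p (of_nat j))" by force
      have "\<xi> \<in> ball \<xi>0 r" using xi(1) r(1) by auto
      then have "sc (real j) \<xi> \<in> Dk w" using elim by blast
      then have X: "X w (sc (real j) \<xi>) \<in> Omk w" by (rule X_Dk[OF w])
      have "sc (real j) (resc j w \<xi>) = v + axis p (of_nat j)" using elim by (simp add: xi(2) sc_sc sc_1)
      then have "\<phi> (X w (sc (real j) \<xi>)) = v + axis p (of_nat j)" using elim by (simp add: resc_def sc_sc sc_1)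
      then have "transl p (int j) (\<phi> (X w (sc (real j) \<xi>))) = v" by (simp add: transl_def)
      then show ?case using X by blast
    qed
    then show "v \<in> (\<Union>j::nat. transl p (int j) ` \<phi> ` Omk w)" by simp
  qed
qed

lemma biholomorphism_phi:
  assumes "w \<in> roots"
  shows "biholomorphism \<phi> (Omk w) (\<phi> ` Omk w)"
  by (rule biholomorphismI[OF open_Omk inj_on_phi[OF assms] _ nondegenerate_phi[OF assms]])
    (auto simp: Omk_def intro: holo_phi)

end

text \<open>Hides the auxiliary radius and constants, which may differ between the germ and its
  inverse.\<close>

theorem (in petal) petals:
  obtains Om' \<phi> where "\<forall>w\<in>roots. open (Om' w) \<and> connected (Om' w) \<and> Om' w \<subseteq> Nb \<and> 0 \<in> frontier (Om' w) \<and> f ` Om' w \<subseteq> Om' w \<and>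
      (\<forall>K. compact K \<and> K \<subseteq> Om' w \<longrightarrow> uniform_limit K (\<lambda>j. f ^^ j) (\<lambda>_. 0) sequentially) \<and>
      biholomorphism \<phi> (Om' w) (\<phi> ` Om' w) \<and> (\<forall>x\<in>Om' w. \<phi> (f x) = \<phi> x + axis p 1) \<and>
      (\<Union>j::nat. transl p (int j) ` \<phi> ` Om' w) = {\<xi>. \<forall>l\<in>J - {p}. \<xi> $ l \<noteq> 0}"
    "\<forall>w w'. w \<noteq> w' \<longrightarrow> Om' w \<inter> Om' w' = {}" "\<exists>r>0. \<forall>x\<in>SD. norm x < r \<longrightarrow> (\<exists>w\<in>roots. x \<in> Om' w)"
proof -
  obtain \<epsilon> \<Psi> C n where "petal_scaled f U V A a M d m P Q p J Nb \<epsilon> \<Psi> C n" using petal_scaled_exists by blast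
  then interpret petal_scaled f U V A a M d m P Q p J Nb \<epsilon> \<Psi> C n .
  have cover: "\<exists>w\<in>roots. x \<in> Omk w" if "x \<in> SD" "norm x < \<epsilon> / Dc" for x
    using SD_subset_Om[OF that(1) eps that(2)] K_root[OF that(1)] by (auto simp: Omk_def)
  have lim: "uniform_limit Kc (\<lambda>j. f ^^ j) (\<lambda>_. 0) sequentially" if "compact Kc \<and> Kc \<subseteq> Omk w" for Kc w
    using that by (intro orbit_to_0) (auto simp: Omk_def)
  show ?thesis
  proof (rule that[of Omk \<phi>]; (intro ballI conjI allI impI)?)
    fix w assume w: "w \<in> roots"
    show "Omk w \<subseteq> Nb" using Om_step by (auto simp: Omk_def)
    show "f ` Omk w \<subseteq> Omk w" using Omk_f by blast
    show "\<phi> (f x) = \<phi> x + axis p 1" if "x \<in> Omk w" for x using that phi_f by (simp add: Omk_def)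
    show "(\<Union>j::nat. transl p (int j) ` \<phi> ` Omk w) = {\<xi>. \<forall>l\<in>J - {p}. \<xi> $ l \<noteq> 0}"
      using phi_exhausts[OF w] by (simp add: Mod_def)
  next
    fix w w' :: complex assume "w \<noteq> w'"
    then show "Omk w \<inter> Omk w' = {}" by (auto simp: Omk_def)
  next
    have "\<epsilon> / Dc > 0" using eps Dc_pos by simp
    then show "\<exists>r>0. \<forall>x\<in>SD. norm x < r \<longrightarrow> (\<exists>w\<in>roots. x \<in> Omk w)" using cover by blast
  qed (auto intro: open_Omk connected_Omk zero_frontier_Omk biholomorphism_phi lim)
qed

section \<open>The inverse germ and the theorem\<close>

context parabolic_germ
begin

text \<open>Solves 1 / (1 + u c_i) = 1 + u \<gamma>M (-a_i + Ainv_i), where u \<gamma>M is the value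
  of u at the image point; composition with the inverse then gives its coefficient germ.\<close>

definition Ainv :: "'n \<Rightarrow> complex ^ 'n \<Rightarrow> complex" where
  "Ainv i x = a $ i - c i x / (\<gamma>M x * (1 + u x * c i x))"

lemma hgerm_Ainv: "hgerm (Ainv i)" "Ainv i 0 = 0"
proof -
  obtain H where H: "hgerm H" "\<forall>\<^sub>F x in nhds 0. \<gamma>M x = 1 + u x * H x"
    using unit_germ_\<gamma>M by (auto simp: unit_germ_def)
  have g0: "\<gamma>M 0 = 1" using eventually_nhds_x_imp_x[OF H(2)] by (simp add: u_0)
  have "hgerm (\<lambda>x. 1 + u x * H x)" by (intro hgerm_add hgerm_mult hgerm_u H hgerm_const)
  then have "hgerm \<gamma>M" by (rule hgerm_cong[rotated]) (use H(2) in \<open>auto elim: eventually_mono\<close>)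
  then show "hgerm (Ainv i)" unfolding Ainv_def[abs_def]
    by (intro hgerm_diff hgerm_divide hgerm_mult hgerm_add hgerm_const hgerm_c hgerm_u) (auto simp: u_0 g0)
  show "Ainv i 0 = 0" by (simp add: Ainv_def c_0 u_0 g0)
qed

lemma inverse_germ: "parabolic_germ (inv_into U f) V U (\<lambda>i y. Ainv i (inv_into U f y)) (- a) M"
proof -
  define g where "g = inv_into U f"
  have bij: "bij_betw f U V" and UV: "open U" "open V" and hol: "holomorphic_map_on f U" "holomorphic_map_on g V"
    using f_bihol by (auto simp: biholomorphism_def g_def)
  have V0: "0 \<in> V" using bij U0 f0 by (metis bij_betwE)
  have g0: "g 0 = 0" unfolding g_def using bij U0 f0 by (metis bij_betw_inv_into_left)
  have fg: "f (g y) = y" if "y \<in> V" for y unfolding g_def using bij that by (simp add: bij_betw_inv_into_right)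
  have "holomorphic_map_on (inv_into V g) U" unfolding holomorphic_map_on_iff
  proof
    fix x assume x: "x \<in> U"
    have "\<forall>\<^sub>F y in nhds x. f y = inv_into V g y"
      using eventually_nhds_in_open[OF UV(1) x]
      by eventually_elim (simp add: g_def inv_into_inv_into_eq[OF bij])
    then show "holo_map_at (inv_into V g) x"
      by (rule holo_map_at_cong) (use hol(1) x in \<open>simp add: holomorphic_map_on_iff\<close>)
  qed
  then have bihol: "biholomorphism g V U"
    using UV hol bij bij_betw_inv_into[OF bij] by (simp add: biholomorphism_def g_def)
  have gh: "\<forall>\<^sub>F y in nhds 0. holo_map_at g y"
    using eventually_nhds_in_open[OF UV(2) V0] by eventually_elim (use hol(2) in \<open>simp add: holomorphic_map_on_iff\<close>)
  then have "isCont g 0" using eventually_nhds_x_imp_x holo_map_at_imp_isCont by blast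
  then have g_lim: "(g \<longlongrightarrow> 0) (nhds 0)" using g0 tendsto_at_iff_tendsto_nhds[of g 0] by (simp add: isCont_def)
  have ev: "\<forall>\<^sub>F y in nhds 0. R (g y)" if "\<forall>\<^sub>F x in nhds 0. R x" for R
    using that g_lim by (rule eventually_compose_filterlim)
  have A': "holomorphic_germ0 (\<lambda>y. Ainv i (g y))" for i
  proof -
    have "\<forall>\<^sub>F y in nhds 0. holo_at (Ainv i) (g y)" using hgerm_Ainv(1)[of i] unfolding hgerm_def by (rule ev)
    with gh have "\<forall>\<^sub>F y in nhds 0. holo_at (\<lambda>y. Ainv i (g y)) y"
      by eventually_elim (rule holo_at_compose)
    then have "hgerm (\<lambda>y. Ainv i (g y))" by (simp add: hgerm_def)
    then show ?thesis by (simp add: holomorphic_germ0_def hgerm_iff g0 hgerm_Ainv)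
  qed
  have "\<forall>\<^sub>F x in nhds 0. \<forall>i. 1 + u x * c i x \<noteq> 0"
  proof (rule eventually_all_finite)
    fix i
    have "hgerm (\<lambda>x. 1 + u x * c i x)" by (intro hgerm_add hgerm_mult hgerm_u hgerm_c hgerm_const)
    from tendsto_imp_eventually_ne[OF hgerm_tendsto[OF this], of 0] show "\<forall>\<^sub>F x in nhds 0. 1 + u x * c i x \<noteq> 0" by (simp add: u_0)
  qed
  then have "\<forall>\<^sub>F x in nhds 0. (\<forall>i. f x $ i = x $ i * (1 + u x * c i x)) \<and> u (f x) = u x * \<gamma>M x \<and> \<gamma>M x \<noteq> 0 \<and> (\<forall>i. 1 + u x * c i x \<noteq> 0)"
    using f_eq u_f \<gamma>M_nonzero by eventually_elim auto
  from ev[OF this] have "\<forall>\<^sub>F y in nhds 0. \<forall>i. g y $ i = y $ i * (1 + monom_power y M * ((- a) $ i + Ainv i (g y)))"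
    using eventually_nhds_in_open[OF UV(2) V0]
  proof eventually_elim
    case (elim y)
    show ?case
    proof
      fix i
      define x where "x = g y"
      have x: "f x = y" "y $ i = x $ i * (1 + u x * c i x)" "u y = u x * \<gamma>M x" "\<gamma>M x \<noteq> 0" "1 + u x * c i x \<noteq> 0"
        using elim fg[of y] unfolding x_def[symmetric] by metis+
      have "y $ i * (1 + u y * ((- a) $ i + Ainv i x)) = x $ i * ((1 + u x * c i x) * (1 - u x * \<gamma>M x * (c i x / (\<gamma>M x * (1 + u x * c i x)))))"
        by (simp add: x(2,3) Ainv_def)
      also have "u x * \<gamma>M x * (c i x / (\<gamma>M x * (1 + u x * c i x))) = u x * c i x / (1 + u x * c i x)"
        using x(4) by simp
      also have "(1 + u x * c i x) * (1 - u x * c i x / (1 + u x * c i x)) = 1"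
        using x(5) by (simp add: right_diff_distrib)
      finally show "g y $ i = y $ i * (1 + monom_power y M * ((- a) $ i + Ainv i (g y)))"
        by (simp add: x_def[symmetric] u_def)
    qed
  qed
  \<comment> \<open>Numerator and denominator of a_i / \<langle>a, M\<rangle> both change sign, so
    positivity of the real parts is inherited.\<close>
  moreover have "pairing (- a) M = - pairing a M" by (simp add: pairing_def sum_negf)
  ultimately show ?thesis unfolding g_def[symmetric]
    using bihol V0 g0 A' aM Re_pos by unfold_locales auto
qed

end

text \<open>Replacing a by -a replaces b by -b and hence z by -z, and every nonzero number lies in
  the sector or in its opposite.\<close>

lemma SD_cover:
  assumes "parabolic_germ f U V A a M" "parabolic_germ f' U' V' A' (- a) M" "monom_power x M \<noteq> 0"
  shows "x \<in> parabolic_germ.SD a M \<or> x \<in> parabolic_germ.SD (- a) M"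
proof -
  interpret p: parabolic_germ f U V A a M by fact
  interpret m: parabolic_germ f' U' V' A' "- a" M by fact
  have "m.b = - p.b" by (simp add: m.b_def p.b_def pairing_def sum_negf)
  then have z: "m.zc x = - p.zc x" by (simp add: m.zc_def p.zc_def m.u_def p.u_def)
  have "p.zc x \<noteq> 0" using p.b0 assms(3) by (simp add: p.zc_def p.u_def)
  then have "p.zc x \<in> Sect \<or> - p.zc x \<in> Sect" by (auto simp: Sect_def complex_eq_iff)
  then show ?thesis using assms(3) by (auto simp: p.SD_def m.SD_def p.u_def m.u_def z)
qed

text \<open>A Fatou coordinate of the inverse adds 1 under the inverse, hence subtracts 1 under
  \<open>f\<close>; changing the sign of coordinate \<open>p\<close> corrects this.\<close>

definition flip :: "'n \<Rightarrow> complex ^ 'n \<Rightarrow> complex ^ 'n" where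
  "flip p v = (\<chi> l. if l = p then - v $ l else v $ l)"

lemma flip_flip: "flip p (flip p v) = v" by (simp add: flip_def vec_eq_iff)

lemma holo_flip: "holo_map_at (flip p) v"
  unfolding holo_map_at_def
proof
  fix i show "holo_at (\<lambda>v. flip p v $ i) v" by (cases "i = p") (auto simp: flip_def intro!: holo_at_uminus)
qed

lemma nondegenerate_flip: "nondegenerate (flip p) v"
  by (rule nondegenerate_if_left_inverse[where G = "flip p"])
    (auto simp: flip_flip intro!: holo_map_at_differentiable holo_flip)

lemma biholomorphism_flip:
  fixes \<phi> :: "complex ^ 'n \<Rightarrow> complex ^ 'n"
  assumes "biholomorphism \<phi> S (\<phi> ` S)"
  shows "biholomorphism (\<lambda>x. flip p (\<phi> x)) S ((\<lambda>x. flip p (\<phi> x)) ` S)"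
proof (rule biholomorphismI)
  show "open S" using assms by (simp add: biholomorphism_def)
  have "inj_on \<phi> S" using assms by (simp add: biholomorphism_def bij_betw_def)
  then show "inj_on (\<lambda>x. flip p (\<phi> x)) S" by (auto simp: inj_on_def) (metis flip_flip)
  fix x assume x: "x \<in> S"
  show "holo_map_at (\<lambda>x. flip p (\<phi> x)) x"
    using assms x by (intro holo_map_at_compose[where G = "flip p", OF _ holo_flip]) (simp add: biholomorphism_def holomorphic_map_on_iff)
  show "nondegenerate (\<lambda>x. flip p (\<phi> x)) x"
    by (rule nondegenerate_compose[where G = "flip p", OF biholomorphism_nondegenerate[OF assms x] nondegenerate_flip])
qed

lemma transl_flip: "transl p (- k) (flip p v) = flip p (transl p k v)"
  by (simp add: transl_def flip_def vec_eq_iff axis_def)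

theorem theorem1:
  fixes f :: "complex ^ 'n \<Rightarrow> complex ^ 'n" and U V N :: "(complex ^ 'n) set"
    and A :: "'n \<Rightarrow> complex ^ 'n \<Rightarrow> complex"
    and a :: "complex ^ 'n" and M m :: "nat ^ 'n" and d mbar :: nat
    and e :: "nat \<Rightarrow> 'n" and finv :: "complex ^ 'n \<Rightarrow> complex ^ 'n"
  assumes e: "bij_betw e {1..CARD('n)} UNIV"
    and f_bihol: "biholomorphism f U V" and U0: "0 \<in> U" and f0: "f 0 = 0"
    and f_form: "\<forall>\<^sub>F x in nhds 0. \<forall>i. f x $ i = x $ i * (1 + monom_power x M * (a $ i + A i x))"
    and A: "\<And>i. holomorphic_germ0 (A i)"
    and a: "\<And>i. a $ i \<noteq> 0"
    and aM: "pairing a M \<noteq> 0"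
    and Re_pos: "\<And>i. Re (a $ i / pairing a M) > 0"
    and d: "d = Gcd (range (($) M))"
    and m: "\<And>i. m $ i = M $ i div d"
    and mbar: "mbar = card {i. m $ i = 0}"
    and finv: "finv = inv_into U f"
    and N: "0 \<in> interior N"
  shows "\<exists>\<Omega>p \<Omega>m :: nat \<Rightarrow> (complex ^ 'n) set.
    (\<forall>k<d. open (\<Omega>p k) \<and> connected (\<Omega>p k) \<and> \<Omega>p k \<subseteq> N \<inter> U \<inter> V \<and> 0 \<in> frontier (\<Omega>p k)) \<and>
    disjoint_family_on \<Omega>p {..<d} \<and>
    (\<forall>k<d. open (\<Omega>m k) \<and> connected (\<Omega>m k) \<and> \<Omega>m k \<subseteq> N \<inter> U \<inter> V \<and> 0 \<in> frontier (\<Omega>m k)) \<and>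
    disjoint_family_on \<Omega>m {..<d} \<and>
    (\<forall>k<d. f ` \<Omega>p k \<subseteq> \<Omega>p k \<and>
       (\<forall>K. compact K \<and> K \<subseteq> \<Omega>p k \<longrightarrow> uniform_limit K (\<lambda>j. f ^^ j) (\<lambda>_. 0) sequentially)) \<and>
    (\<forall>k<d. finv ` \<Omega>m k \<subseteq> \<Omega>m k \<and>
       (\<forall>K. compact K \<and> K \<subseteq> \<Omega>m k \<longrightarrow> uniform_limit K (\<lambda>j. finv ^^ j) (\<lambda>_. 0) sequentially)) \<and>
    0 \<in> interior ((\<Union>k<d. \<Omega>p k) \<union> (\<Union>k<d. \<Omega>m k) \<union> {x. monom_power x M = 0}) \<and>
    (\<forall>k<d. \<exists>\<phi>p \<phi>m :: complex ^ 'n \<Rightarrow> complex ^ 'n. \<exists>Wp Wm.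
       biholomorphism \<phi>p (\<Omega>p k) Wp \<and> biholomorphism \<phi>m (\<Omega>m k) Wm \<and>
       (\<forall>x\<in>\<Omega>p k. \<phi>p (f x) = \<phi>p x + axis (e 1) 1) \<and>
       (\<forall>x\<in>\<Omega>m k. f x \<in> \<Omega>m k \<longrightarrow> \<phi>m (f x) = \<phi>m x + axis (e 1) 1) \<and>
       (\<Union>j::nat. transl (e 1) (int j) ` Wp) = model_space e mbar \<and>
       (\<Union>j::nat. transl (e 1) (- int j) ` Wm) = model_space e mbar)"
proof -
  interpret plus: parabolic_germ f U V A a M
    using f_bihol U0 f0 f_form A aM Re_pos by unfold_locales
  obtain A' where minus_germ: "parabolic_germ finv V U A' (- a) M"
    using plus.inverse_germ unfolding finv by blast
  interpret minus: parabolic_germ finv V U A' "- a" M by (rule minus_germ)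
  obtain i0 where i0: "M $ i0 \<noteq> 0" using plus.M0 by (auto simp: vec_eq_iff)
  have d_dvd: "d dvd M $ i" for i unfolding d by (rule Gcd_dvd) auto
  have d0: "d > 0" using d_dvd[of i0] i0 by (auto intro: Nat.gr0I)
  have Mm: "M $ i = d * m $ i" for i using m d_dvd by simp
  have gcdm: "Gcd (range (($) m)) = 1"
  proof -
    have "d * Gcd (range (($) m)) dvd M $ i" for i unfolding Mm by (intro mult_dvd_mono Gcd_dvd) auto
    then have "d * Gcd (range (($) m)) dvd Gcd (range (($) M))" by (intro Gcd_greatest) auto
    then have "d * Gcd (range (($) m)) dvd d" by (simp only: d[symmetric])
    then show ?thesis using d0 by (simp add: dvd_mult_cancel1)
  qed
  define p where "p = e 1"
  \<comment> \<open>The translated coordinate followed by those in the punctured plane: as many as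
    there are nonzero m_i, as the matrix completion requires.\<close>
  define J where "J = e ` {1..CARD('n) - mbar}"
  define I where "I = {i. m $ i \<noteq> 0}"
  have inj: "inj_on e {1..CARD('n)}" using e by (simp add: bij_betw_def)
  have cardI: "card I = CARD('n) - mbar"
  proof -
    have "I = UNIV - {i. m $ i = 0}" by (auto simp: I_def)
    then show ?thesis by (simp add: card_Diff_subset mbar)
  qed
  have "i0 \<in> I" using i0 Mm[of i0] by (auto simp: I_def)
  then have "card I > 0" by (auto simp: card_gt_0_iff)
  then have pos: "1 \<le> CARD('n) - mbar" using cardI by simp
  have "inj_on e {1..CARD('n) - mbar}" by (rule inj_on_subset[OF inj]) auto
  then have cardJ: "card J = CARD('n) - mbar" by (simp add: J_def card_image)
  have pJ: "p \<in> J" using pos by (auto simp: p_def J_def)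
  have JmP: "J - {p} = e ` {2..CARD('n) - mbar}"
  proof -
    have "{1..CARD('n) - mbar} - {1} = {2..CARD('n) - mbar}" by auto
    moreover have "e ` ({1..CARD('n) - mbar} - {1}) = e ` {1..CARD('n) - mbar} - e ` {1}"
      using pos by (intro inj_on_image_set_diff[OF inj]) auto
    ultimately show ?thesis by (simp add: J_def p_def)
  qed
  have model: "{\<xi>. \<forall>l\<in>J - {p}. \<xi> $ l \<noteq> 0} = model_space e mbar" unfolding JmP model_space_def by auto
  obtain P Q :: "'n \<Rightarrow> 'n \<Rightarrow> int" where PQ: "(\<forall>i. P p i = int (m $ i)) \<and>
    (\<forall>i j. (\<Sum>k\<in>UNIV. P i k * Q k j) = (if i = j then 1 else 0)) \<and>
    (\<forall>i j. (\<Sum>k\<in>UNIV. Q i k * P k j) = (if i = j then 1 else 0)) \<and>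
    (\<forall>l. l \<notin> J \<longrightarrow> (\<forall>i. Q i l \<ge> 0 \<and> (\<forall>l'. P l' i * Q i l \<ge> 0))) \<and>
    (\<forall>i. i \<notin> I \<longrightarrow> (\<forall>l. P l i \<ge> 0 \<and> (\<forall>i'. Q i' l * P l i \<ge> 0))) \<and>
    (\<forall>l\<in>J. \<forall>i. i \<notin> I \<longrightarrow> P l i = 0)"
    using unimodular_completion[OF gcdm pJ I_def] cardI cardJ by auto
  define Nb where "Nb = interior N \<inter> U \<inter> V"
  have V0: "0 \<in> V" by (rule minus.U0)
  have Nb: "open Nb" "0 \<in> Nb" "Nb \<subseteq> U" "Nb \<subseteq> V"
    using f_bihol U0 V0 N by (auto simp: Nb_def biholomorphism_def)
  have NbN: "Nb \<subseteq> N \<inter> U \<inter> V" using interior_subset by (auto simp: Nb_def)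
  \<comment> \<open>The same matrices serve both germs, since the inverse has the same exponent
    vector M.\<close>
  interpret pl: petal f U V A a M d "($) m" P Q p J Nb
    using d0 Mm PQ pJ Nb by unfold_locales (auto simp: I_def)
  interpret mi: petal finv V U A' "- a" M d "($) m" P Q p J Nb
    using d0 Mm PQ pJ Nb by unfold_locales (auto simp: I_def)
  obtain Op \<phi>p where plus: "\<forall>w\<in>pl.roots. open (Op w) \<and> connected (Op w) \<and> Op w \<subseteq> Nb \<and> 0 \<in> frontier (Op w) \<and> f ` Op w \<subseteq> Op w \<and>
      (\<forall>K. compact K \<and> K \<subseteq> Op w \<longrightarrow> uniform_limit K (\<lambda>j. f ^^ j) (\<lambda>_. 0) sequentially) \<and>
      biholomorphism \<phi>p (Op w) (\<phi>p ` Op w) \<and> (\<forall>x\<in>Op w. \<phi>p (f x) = \<phi>p x + axis p 1) \<and>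
      (\<Union>j::nat. transl p (int j) ` \<phi>p ` Op w) = {\<xi>. \<forall>l\<in>J - {p}. \<xi> $ l \<noteq> 0}"
    "\<forall>w w'. w \<noteq> w' \<longrightarrow> Op w \<inter> Op w' = {}" "\<exists>r>0. \<forall>x\<in>plus.SD. norm x < r \<longrightarrow> (\<exists>w\<in>pl.roots. x \<in> Op w)"
    by (rule pl.petals)
  obtain Om' \<phi>m where minus: "\<forall>w\<in>mi.roots. open (Om' w) \<and> connected (Om' w) \<and> Om' w \<subseteq> Nb \<and> 0 \<in> frontier (Om' w) \<and> finv ` Om' w \<subseteq> Om' w \<and>
      (\<forall>K. compact K \<and> K \<subseteq> Om' w \<longrightarrow> uniform_limit K (\<lambda>j. finv ^^ j) (\<lambda>_. 0) sequentially) \<and>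
      biholomorphism \<phi>m (Om' w) (\<phi>m ` Om' w) \<and> (\<forall>x\<in>Om' w. \<phi>m (finv x) = \<phi>m x + axis p 1) \<and>
      (\<Union>j::nat. transl p (int j) ` \<phi>m ` Om' w) = {\<xi>. \<forall>l\<in>J - {p}. \<xi> $ l \<noteq> 0}"
    "\<forall>w w'. w \<noteq> w' \<longrightarrow> Om' w \<inter> Om' w' = {}" "\<exists>r>0. \<forall>x\<in>minus.SD. norm x < r \<longrightarrow> (\<exists>w\<in>mi.roots. x \<in> Om' w)"
    by (rule mi.petals)
  obtain kp where kp: "bij_betw kp {..<d} pl.roots"
    using ex_bij_betw_nat_finite[OF pl.finite_roots(1)] by (auto simp: pl.finite_roots atLeast0LessThan)
  obtain km where km: "bij_betw km {..<d} mi.roots"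
    using ex_bij_betw_nat_finite[OF mi.finite_roots(1)] by (auto simp: mi.finite_roots atLeast0LessThan)
  have kpr: "kp k \<in> pl.roots" and kmr: "km k \<in> mi.roots" if "k < d" for k
    using that bij_betwE[OF kp] bij_betwE[OF km] by auto
  have PL: "open (Op (kp k))" "connected (Op (kp k))" "Op (kp k) \<subseteq> Nb" "0 \<in> frontier (Op (kp k))" "f ` Op (kp k) \<subseteq> Op (kp k)"
      "\<forall>K. compact K \<and> K \<subseteq> Op (kp k) \<longrightarrow> uniform_limit K (\<lambda>j. f ^^ j) (\<lambda>_. 0) sequentially"
      "biholomorphism \<phi>p (Op (kp k)) (\<phi>p ` Op (kp k))" "\<forall>x\<in>Op (kp k). \<phi>p (f x) = \<phi>p x + axis p 1"
      "(\<Union>j::nat. transl p (int j) ` \<phi>p ` Op (kp k)) = model_space e mbar" if k: "k < d" for k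
    using bspec[OF plus(1) kpr[OF k]] unfolding model by - (elim conjE, assumption)+
  have MI: "open (Om' (km k))" "connected (Om' (km k))" "Om' (km k) \<subseteq> Nb" "0 \<in> frontier (Om' (km k))" "finv ` Om' (km k) \<subseteq> Om' (km k)"
      "\<forall>K. compact K \<and> K \<subseteq> Om' (km k) \<longrightarrow> uniform_limit K (\<lambda>j. finv ^^ j) (\<lambda>_. 0) sequentially"
      "biholomorphism \<phi>m (Om' (km k)) (\<phi>m ` Om' (km k))" "\<forall>x\<in>Om' (km k). \<phi>m (finv x) = \<phi>m x + axis p 1"
      "(\<Union>j::nat. transl p (int j) ` \<phi>m ` Om' (km k)) = model_space e mbar" if k: "k < d" for k
    using bspec[OF minus(1) kmr[OF k]] unfolding model by - (elim conjE, assumption)+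
  define Fm where "Fm = (\<lambda>x. flip p (\<phi>m x))"
  have disj: "disjoint_family_on (\<lambda>k. Op (kp k)) {..<d}" "disjoint_family_on (\<lambda>k. Om' (km k)) {..<d}"
  proof -
    have "inj_on kp {..<d}" "inj_on km {..<d}" using kp km by (auto simp: bij_betw_def)
    then show "disjoint_family_on (\<lambda>k. Op (kp k)) {..<d}" "disjoint_family_on (\<lambda>k. Om' (km k)) {..<d}"
      using plus(2) minus(2) unfolding disjoint_family_on_def by (metis inj_onD)+
  qed
  have cover: "0 \<in> interior ((\<Union>k<d. Op (kp k)) \<union> (\<Union>k<d. Om' (km k)) \<union> {x. monom_power x M = 0})"
  proof -
    obtain r1 where r1: "r1 > 0" "\<forall>x\<in>plus.SD. norm x < r1 \<longrightarrow> (\<exists>w\<in>pl.roots. x \<in> Op w)" using plus(3) by blast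
    obtain r2 where r2: "r2 > 0" "\<forall>x\<in>minus.SD. norm x < r2 \<longrightarrow> (\<exists>w\<in>mi.roots. x \<in> Om' w)" using minus(3) by blast
    have surj: "\<exists>k<d. w = kp k" if "w \<in> pl.roots" for w using kp that by (auto simp: bij_betw_def)
    have surj': "\<exists>k<d. w = km k" if "w \<in> mi.roots" for w using km that by (auto simp: bij_betw_def)
    have "x \<in> (\<Union>k<d. Op (kp k)) \<union> (\<Union>k<d. Om' (km k)) \<union> {x. monom_power x M = 0}" if x: "x \<in> ball 0 (min r1 r2)" for x
    proof (cases "monom_power x M = 0")
      case False
      then have "x \<in> plus.SD \<or> x \<in> minus.SD"
        by (rule SD_cover[OF plus.parabolic_germ_axioms minus.parabolic_germ_axioms])
      then show ?thesis
      proof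
        assume "x \<in> plus.SD"
        then obtain w where "w \<in> pl.roots" "x \<in> Op w" using r1(2) x by auto
        then show ?thesis using surj by blast
      next
        assume "x \<in> minus.SD"
        then obtain w where "w \<in> mi.roots" "x \<in> Om' w" using r2(2) x by auto
        then show ?thesis using surj' by blast
      qed
    qed simp
    then have "ball 0 (min r1 r2) \<subseteq> (\<Union>k<d. Op (kp k)) \<union> (\<Union>k<d. Om' (km k)) \<union> {x. monom_power x M = 0}" by blast
    then show ?thesis using r1(1) r2(1) by (auto simp: mem_interior intro!: exI[of _ "min r1 r2"])
  qed
  \<comment> \<open>The functional equation for the inverse is applied at \<open>f x\<close>, whose
    image is \<open>x\<close>; this is where \<open>f x\<close> has to lie in the petal.\<close>
  have conj_m: "Fm (f x) = Fm x + axis p 1" if "k < d" "x \<in> Om' (km k)" "f x \<in> Om' (km k)" for k x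
  proof -
    have "x \<in> U" using MI(3)[OF that(1)] that(2) Nb by blast
    then have "finv (f x) = x" unfolding finv using f_bihol by (auto simp: biholomorphism_def bij_betw_def inv_into_f_f)
    then have "\<phi>m x = \<phi>m (f x) + axis p 1" using MI(8)[OF that(1)] that(3) by metis
    then show ?thesis by (simp add: Fm_def flip_def vec_eq_iff axis_def)
  qed
  have exh_m: "(\<Union>j::nat. transl p (- int j) ` Fm ` Om' (km k)) = model_space e mbar" if "k < d" for k
  proof -
    have "(\<Union>j::nat. transl p (- int j) ` Fm ` Om' (km k)) = flip p ` (\<Union>j::nat. transl p (int j) ` \<phi>m ` Om' (km k))"
      by (simp add: Fm_def image_UN image_image transl_flip)
    also have "(\<Union>j::nat. transl p (int j) ` \<phi>m ` Om' (km k)) = model_space e mbar" by (rule MI(9)[OF that])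
    also have "flip p ` model_space e mbar = model_space e mbar"
    proof -
      have mem: "flip p v \<in> model_space e mbar" if "v \<in> model_space e mbar" for v
        using that by (auto simp: model_space_def flip_def)
      show ?thesis
      proof
        show "flip p ` model_space e mbar \<subseteq> model_space e mbar" using mem by blast
        show "model_space e mbar \<subseteq> flip p ` model_space e mbar"
        proof
          fix v assume "v \<in> model_space e mbar"
          then show "v \<in> flip p ` model_space e mbar" by (intro image_eqI[of _ _ "flip p v"] mem) (simp_all add: flip_flip)
        qed
      qed
    qed
    finally show ?thesis .
  qed
  show ?thesis
  proof (rule exI[of _ "\<lambda>k. Op (kp k)"], rule exI[of _ "\<lambda>k. Om' (km k)"], intro conjI disj cover allI impI)
    fix k assume k: "k < d"
    show "open (Op (kp k))" "connected (Op (kp k))" "0 \<in> frontier (Op (kp k))" "f ` Op (kp k) \<subseteq> Op (kp k)"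
      "open (Om' (km k))" "connected (Om' (km k))" "0 \<in> frontier (Om' (km k))" "finv ` Om' (km k) \<subseteq> Om' (km k)"
      by (fact PL[OF k] MI[OF k])+
    show "Op (kp k) \<subseteq> N \<inter> U \<inter> V" "Om' (km k) \<subseteq> N \<inter> U \<inter> V" using PL(3)[OF k] MI(3)[OF k] NbN by blast+
    show "uniform_limit K (\<lambda>j. f ^^ j) (\<lambda>_. 0) sequentially" if "compact K \<and> K \<subseteq> Op (kp k)" for K
      using PL(6)[OF k] that by blast
    show "uniform_limit K (\<lambda>j. finv ^^ j) (\<lambda>_. 0) sequentially" if "compact K \<and> K \<subseteq> Om' (km k)" for K
      using MI(6)[OF k] that by blast
    show "\<exists>\<phi>p \<phi>m :: complex ^ 'n \<Rightarrow> complex ^ 'n. \<exists>Wp Wm.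
       biholomorphism \<phi>p (Op (kp k)) Wp \<and> biholomorphism \<phi>m (Om' (km k)) Wm \<and>
       (\<forall>x\<in>Op (kp k). \<phi>p (f x) = \<phi>p x + axis (e 1) 1) \<and>
       (\<forall>x\<in>Om' (km k). f x \<in> Om' (km k) \<longrightarrow> \<phi>m (f x) = \<phi>m x + axis (e 1) 1) \<and>
       (\<Union>j::nat. transl (e 1) (int j) ` Wp) = model_space e mbar \<and>
       (\<Union>j::nat. transl (e 1) (- int j) ` Wm) = model_space e mbar"
    proof (rule exI[of _ \<phi>p], rule exI[of _ Fm], rule exI[of _ "\<phi>p ` Op (kp k)"], rule exI[of _ "Fm ` Om' (km k)"], intro conjI)
      show "biholomorphism \<phi>p (Op (kp k)) (\<phi>p ` Op (kp k))" by (rule PL(7)[OF k])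
      show "biholomorphism Fm (Om' (km k)) (Fm ` Om' (km k))"
        unfolding Fm_def by (rule biholomorphism_flip[OF MI(7)[OF k]])
      show "\<forall>x\<in>Op (kp k). \<phi>p (f x) = \<phi>p x + axis (e 1) 1" using PL(8)[OF k] unfolding p_def .
      show "\<forall>x\<in>Om' (km k). f x \<in> Om' (km k) \<longrightarrow> Fm (f x) = Fm x + axis (e 1) 1"
        using conj_m[OF k] unfolding p_def by blast
      show "(\<Union>j::nat. transl (e 1) (int j) ` \<phi>p ` Op (kp k)) = model_space e mbar"
        using PL(9)[OF k] unfolding p_def .
      show "(\<Union>j::nat. transl (e 1) (- int j) ` Fm ` Om' (km k)) = model_space e mbar"
        using exh_m[OF k] unfolding p_def .
    qed
  qed
qed

end
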